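(* Let $p$ be a prime. There is a deterministic algorithm which, given nonzero residues $d_1,\ldots,d_{p-1}\in\mathbb Z_p\setminus\{0\}$ and a target residue $\tau\in\mathbb Z_p$, outputs a subset $J\subseteq\{1,\ldots,p-1\}$ such that $\sum_{j\in J}d_j=\tau$ in $\mathbb Z_p$, and runs in $O(p)$ time and $O(p)$ space.
   Context: Computational model: the word RAM, in which arithmetic, division with remainder, and modular inverses on $O(\log p)$-bit words are constant-time operations. *)

theory Defs
  imports
    "HOL-Computational_Algebra.Primes"
    "HOL-Number_Theory.Modular_Inverse"
    "HOL-Library.Log_Nat"
    "HOL-Library.Landau_Symbols"
begin

text \<open>
  A word RAM with \<open>w\<close>-bit words. A program is a finite list of instructions, so it refers to
  finitely many registers, numbered by naturals; the random access memory is addressed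
  indirectly through registers. Register operands come destination first. All results are
  reduced modulo \<open>2 ^ w\<close> (subtraction wraps around).
\<close>

datatype instr =
    LoadConst nat nat
  | Move nat nat
  | Add nat nat nat
  | Sub nat nat nat
  | Mult nat nat nat
  | Div nat nat nat
  | Rem nat nat nat
  | ModInv nat nat nat  \<comment> \<open>\<open>ModInv r a m\<close>: inverse of \<open>a\<close> modulo \<open>m\<close>, or \<open>0\<close> if \<open>a\<close> is not a unit\<close>
  | Load nat nat        \<comment> \<open>\<open>Load r a\<close>: \<open>r := mem[a]\<close>\<close>
  | Store nat nat       \<comment> \<open>\<open>Store a r\<close>: \<open>mem[a] := r\<close>\<close>
  | Jump nat
  | JumpEq nat nat nat    \<comment> \<open>\<open>JumpEq a b l\<close>: go to \<open>l\<close> if \<open>a = b\<close>\<close>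
  | JumpLess nat nat nat  \<comment> \<open>\<open>JumpLess a b l\<close>: go to \<open>l\<close> if \<open>a < b\<close>\<close>

type_synonym program = "instr list"

record config =
  pc :: nat
  reg :: "nat \<Rightarrow> nat"
  mem :: "nat \<Rightarrow> nat"

definition set_reg :: "nat \<Rightarrow> nat \<Rightarrow> int \<Rightarrow> config \<Rightarrow> config" where
  "set_reg w r v c = c\<lparr>pc := Suc (pc c), reg := (reg c)(r := nat (v mod 2 ^ w))\<rparr>"

fun exec_instr :: "nat \<Rightarrow> instr \<Rightarrow> config \<Rightarrow> config" where
  "exec_instr w (LoadConst r n) c = set_reg w r (int n) c"
| "exec_instr w (Move r a) c = set_reg w r (int (reg c a)) c"
| "exec_instr w (Add r a b) c = set_reg w r (int (reg c a) + int (reg c b)) c"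
| "exec_instr w (Sub r a b) c = set_reg w r (int (reg c a) - int (reg c b)) c"
| "exec_instr w (Mult r a b) c = set_reg w r (int (reg c a) * int (reg c b)) c"
| "exec_instr w (Div r a b) c = set_reg w r (int (reg c a) div int (reg c b)) c"
| "exec_instr w (Rem r a b) c = set_reg w r (int (reg c a) mod int (reg c b)) c"
| "exec_instr w (ModInv r a m) c = set_reg w r (modular_inverse (int (reg c m)) (int (reg c a))) c"
| "exec_instr w (Load r a) c = set_reg w r (int (mem c (reg c a))) c"
| "exec_instr w (Store a r) c = c\<lparr>pc := Suc (pc c), mem := (mem c)(reg c a := reg c r)\<rparr>"
| "exec_instr w (Jump l) c = c\<lparr>pc := l\<rparr>"
| "exec_instr w (JumpEq a b l) c = c\<lparr>pc := (if reg c a = reg c b then l else Suc (pc c))\<rparr>"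
| "exec_instr w (JumpLess a b l) c = c\<lparr>pc := (if reg c a < reg c b then l else Suc (pc c))\<rparr>"

definition halted :: "program \<Rightarrow> config \<Rightarrow> bool" where
  "halted P c \<longleftrightarrow> pc c \<ge> length P"

definition step :: "nat \<Rightarrow> program \<Rightarrow> config \<Rightarrow> config" where
  "step w P c = (if halted P c then c else exec_instr w (P ! pc c) c)"

fun instr_addresses :: "instr \<Rightarrow> config \<Rightarrow> nat set" where
  "instr_addresses (Load r a) c = {reg c a}"
| "instr_addresses (Store a r) c = {reg c a}"
| "instr_addresses _ c = {}"

definition accessed :: "program \<Rightarrow> config \<Rightarrow> nat set" where
  "accessed P c = (if halted P c then {} else instr_addresses (P ! pc c) c)"

text \<open>
  Time is the number of executed instructions. Space is measured by the length of the initial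
  memory segment that contains every cell addressed during the run, which is at least the
  number of distinct cells touched.
\<close>

definition runs_within ::
    "nat \<Rightarrow> program \<Rightarrow> config \<Rightarrow> nat \<Rightarrow> nat \<Rightarrow> config \<Rightarrow> bool" where
  "runs_within w P c time space c' \<longleftrightarrow>
     (\<exists>t\<le>time. (step w P ^^ t) c = c' \<and> halted P c' \<and>
        (\<forall>i<t. accessed P ((step w P ^^ i) c) \<subseteq> {..<space}))"

text \<open>
  Residues modulo \<open>p\<close> are given by their representatives in \<open>{0..<p}\<close>. Input: \<open>p\<close> and \<open>\<tau>\<close> in
  registers \<open>0\<close> and \<open>1\<close>, and \<open>d j\<close> in memory cell \<open>j\<close>; everything else is zero.
  Output: the characteristic vector of \<open>J\<close> in memory cells \<open>1, \<dots>, p - 1\<close>.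
\<close>

definition input_config :: "nat \<Rightarrow> (nat \<Rightarrow> nat) \<Rightarrow> nat \<Rightarrow> config" where
  "input_config p d \<tau> =
     \<lparr>pc = 0,
      reg = (\<lambda>_. 0)(0 := p, 1 := \<tau>),
      mem = (\<lambda>j. if j \<in> {1..p - 1} then d j else 0)\<rparr>"

definition outputs_subset :: "nat \<Rightarrow> config \<Rightarrow> nat set \<Rightarrow> bool" where
  "outputs_subset p c J \<longleftrightarrow>
     J \<subseteq> {1..p - 1} \<and> (\<forall>j\<in>{1..p - 1}. mem c j = (if j \<in> J then 1 else 0))"

end

theory Submission
  imports Defs
begin

text \<open>
  Dividing by the most frequent value we may assume that the residue \<open>1\<close> occurs \<open>mu\<close> times and no
  residue more often. Let \<open>S\<close> be the set of known subset sums; it starts as the interval \<open>[0, mu]\<close>.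

  If \<open>p \<le> 16384 mu\<close>, add the remaining elements one at a time, keeping \<open>S\<close> a union of intervals with
  more than \<open>mu\<close> elements each, so that there are at most \<open>16384\<close> of them. For a new element \<open>d\<close> the
  pairs \<open>x \<in> S\<close>, \<open>x + d \<notin> S\<close> can be moved to an end point of an interval of \<open>S\<close> or of \<open>S + d\<close>, so one is
  found in constant time and every element enlarges \<open>S\<close> as long as \<open>S\<close> is not everything.

  If \<open>p > 16384 mu\<close>, elements are paired: from \<open>a < b\<close> exactly one is used, which offers the
  choice \<open>{0, b - a}\<close> up to a shift. A majority-vote pairing inside windows yields without sorting
  about \<open>7p/16\<close> pairs with differences in \<open>[1, 8 mu)\<close>. Either some difference \<open>u\<close> occurs \<open>32 mu\<close>
  times; after division by \<open>u\<close> these pairs yield the interval \<open>[0, 32 mu]\<close>, and pairing the unused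
  elements in windows of length \<open>32 mu\<close> gives enough differences in \<open>[8, 32 mu)\<close>. Or all differences
  are rarer than that, and pairing the pairs in windows of length \<open>mu\<close> gives enough second
  differences in \<open>[8, mu)\<close>, to be used with the interval \<open>[0, mu]\<close>. In both cases the differences do not
  exceed the length of the interval and add up to at least \<open>p\<close>, so a greedy choice reaches every residue.
\<close>

section \<open>A structured language over the word RAM\<close>

text \<open>Linear time rules out sorting, so pairs must be formed without knowing neighbouring
  keys; the price is that items with equal keys may be left over. This waste is bounded by the
  largest multiplicity, and the constants keep it a small fraction of \<open>p\<close>. A window of
  length \<open>8 * mu\<close> loses at most \<open>mu\<close> elements, so the first pairing wastes
  about \<open>p / 8\<close> of them. Pairing the pairs once more leaves at most a quarter as many
  differences as elements, so each must be at least a constant if they are to add up to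
  \<open>p\<close>; the value 8 leaves room for the waste. The second pairing breaks down on a very
  frequent difference, which forces the case distinction: if each occurs less than
  \<open>32 * mu\<close> times, 8 windows with 8 residues each waste at most
  \<open>64 * 32 * mu = 2048 * mu\<close>, and \<open>16384 = 8 * 2048\<close> makes this less than
  \<open>p / 8\<close>, out of about \<open>7 * p / 16\<close> pairs. A frequent difference is put
  to use as a longer interval instead, which permits longer windows and saves one round of pairing.
  If \<open>mu\<close> is itself a constant fraction of \<open>p\<close>, there are few intervals
  and all their ends can be inspected.\<close>

datatype exp =
    N nat
  | V nat
  | Plus exp exp
  | Minus exp exp
  | Times exp exp
  | Quot exp exp
  | Modulo exp exp
  | Inv exp exp
  | Arr nat exp

datatype bexp = Less exp exp | Eq exp exp

datatype com =
    Skip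
  | Assign nat exp
  | Upd nat exp exp
  | Seq com com  (infixr \<open>;;\<close> 60)
  | If bexp com com
  | While bexp com

type_synonym vars = "nat \<Rightarrow> nat"
type_synonym arrays = "nat \<Rightarrow> nat \<Rightarrow> nat"

fun aval :: "exp \<Rightarrow> vars \<Rightarrow> arrays \<Rightarrow> nat" where
  "aval (N n) s a = n"
| "aval (V x) s a = s x"
| "aval (Plus e f) s a = aval e s a + aval f s a"
| "aval (Minus e f) s a = aval e s a - aval f s a"
| "aval (Times e f) s a = aval e s a * aval f s a"
| "aval (Quot e f) s a = aval e s a div aval f s a"
| "aval (Modulo e f) s a = aval e s a mod aval f s a"
| "aval (Inv m e) s a = nat (modular_inverse (int (aval m s a)) (int (aval e s a)))"
| "aval (Arr k e) s a = a k (aval e s a)"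

text \<open>Conditions under which word arithmetic agrees with \<open>aval\<close>. Quotients and
  remainders carry no bound because they never exceed the dividend, inverses because they lie below
  the modulus. An array read only has its index checked, since \<open>match\<close> bounds all
  stored values.\<close>

fun eok :: "nat \<Rightarrow> exp \<Rightarrow> vars \<Rightarrow> arrays \<Rightarrow> bool" where
  "eok B (N n) s a \<longleftrightarrow> n < B"
| "eok B (V x) s a \<longleftrightarrow> True"
| "eok B (Plus e f) s a \<longleftrightarrow> eok B e s a \<and> eok B f s a \<and> aval e s a + aval f s a < B"
| "eok B (Minus e f) s a \<longleftrightarrow> eok B e s a \<and> eok B f s a \<and> aval f s a \<le> aval e s a"
| "eok B (Times e f) s a \<longleftrightarrow> eok B e s a \<and> eok B f s a \<and> aval e s a * aval f s a < B"
| "eok B (Quot e f) s a \<longleftrightarrow> eok B e s a \<and> eok B f s a"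
| "eok B (Modulo e f) s a \<longleftrightarrow> eok B e s a \<and> eok B f s a"
| "eok B (Inv m e) s a \<longleftrightarrow> eok B m s a \<and> eok B e s a \<and> aval m s a > 0"
| "eok B (Arr k e) s a \<longleftrightarrow> eok B e s a \<and> aval e s a < 2 * s 0"

fun bval :: "bexp \<Rightarrow> vars \<Rightarrow> arrays \<Rightarrow> bool" where
  "bval (Less e f) s a \<longleftrightarrow> aval e s a < aval f s a"
| "bval (Eq e f) s a \<longleftrightarrow> aval e s a = aval f s a"

fun bok :: "nat \<Rightarrow> bexp \<Rightarrow> vars \<Rightarrow> arrays \<Rightarrow> bool" where
  "bok B (Less e f) s a \<longleftrightarrow> eok B e s a \<and> eok B f s a"
| "bok B (Eq e f) s a \<longleftrightarrow> eok B e s a \<and> eok B f s a"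

text \<open>
  The index \<open>n\<close> counts executed assignments and tests. A command gets stuck on overflow of the
  word bound \<open>B\<close>, on negative differences and on array indices beyond \<open>2 * s 0\<close>; variable \<open>0\<close>
  is meant to hold \<open>p\<close> throughout.
\<close>

inductive big :: "nat \<Rightarrow> com \<Rightarrow> vars \<Rightarrow> arrays \<Rightarrow> nat \<Rightarrow> vars \<Rightarrow> arrays \<Rightarrow> bool" for B where
  big_Skip: "big B Skip s a 0 s a"
| big_Assign: "eok B e s a \<Longrightarrow> big B (Assign x e) s a 1 (s(x := aval e s a)) a"
| big_Upd: "eok B e s a \<Longrightarrow> eok B f s a \<Longrightarrow> aval e s a < 2 * s 0 \<Longrightarrow>
    big B (Upd k e f) s a 1 s (a(k := (a k)(aval e s a := aval f s a)))"
| big_Seq: "big B c s a m s' a' \<Longrightarrow> big B d s' a' n s'' a'' \<Longrightarrow> big B (c ;; d) s a (m + n) s'' a''"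
| big_IfT: "bok B b s a \<Longrightarrow> bval b s a \<Longrightarrow> big B c s a n s' a' \<Longrightarrow> big B (If b c d) s a (Suc n) s' a'"
| big_IfF: "bok B b s a \<Longrightarrow> \<not> bval b s a \<Longrightarrow> big B d s a n s' a' \<Longrightarrow> big B (If b c d) s a (Suc n) s' a'"
| big_WhileT: "bok B b s a \<Longrightarrow> bval b s a \<Longrightarrow> big B c s a m s' a' \<Longrightarrow>
    big B (While b c) s' a' n s'' a'' \<Longrightarrow> big B (While b c) s a (Suc (m + n)) s'' a''"
| big_WhileF: "bok B b s a \<Longrightarrow> \<not> bval b s a \<Longrightarrow> big B (While b c) s a 1 s a"

section \<open>Compilation to RAM instructions\<close>

fun cexp :: "exp \<Rightarrow> nat \<Rightarrow> instr list" where
  "cexp (N n) r = [LoadConst r n]"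
| "cexp (V x) r = [Move r x]"
| "cexp (Plus e f) r = cexp e r @ cexp f (Suc r) @ [Add r r (Suc r)]"
| "cexp (Minus e f) r = cexp e r @ cexp f (Suc r) @ [Sub r r (Suc r)]"
| "cexp (Times e f) r = cexp e r @ cexp f (Suc r) @ [Mult r r (Suc r)]"
| "cexp (Quot e f) r = cexp e r @ cexp f (Suc r) @ [Div r r (Suc r)]"
| "cexp (Modulo e f) r = cexp e r @ cexp f (Suc r) @ [Rem r r (Suc r)]"
| "cexp (Inv m e) r = cexp m r @ cexp e (Suc r) @ [ModInv r (Suc r) r]"
| "cexp (Arr k e) r = cexp e r @
    [LoadConst (Suc r) (2 * k), Mult (Suc r) (Suc r) 0, Add r r (Suc r), Load r r]"

fun esize :: "exp \<Rightarrow> nat" where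
  "esize (N n) = 1"
| "esize (V x) = 1"
| "esize (Plus e f) = esize e + esize f + 1"
| "esize (Minus e f) = esize e + esize f + 1"
| "esize (Times e f) = esize e + esize f + 1"
| "esize (Quot e f) = esize e + esize f + 1"
| "esize (Modulo e f) = esize e + esize f + 1"
| "esize (Inv e f) = esize e + esize f + 1"
| "esize (Arr k e) = esize e + 4"

text \<open>Variables are the registers below \<open>tmp\<close>, and expressions are evaluated on a
  stack of registers from \<open>tmp\<close> on. Array \<open>k\<close> occupies the
  \<open>2 * p\<close> cells from address \<open>2 * k * p\<close>, so array \<open>0\<close> covers
  the input and output cells, and all \<open>narr\<close> arrays together take \<open>40 * p\<close>
  cells.\<close>

definition tmp :: nat where "tmp = 100"
definition narr :: nat where "narr = 20"

fun ewf :: "exp \<Rightarrow> bool" where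
  "ewf (N n) \<longleftrightarrow> True"
| "ewf (V x) \<longleftrightarrow> x < tmp"
| "ewf (Plus e f) \<longleftrightarrow> ewf e \<and> ewf f"
| "ewf (Minus e f) \<longleftrightarrow> ewf e \<and> ewf f"
| "ewf (Times e f) \<longleftrightarrow> ewf e \<and> ewf f"
| "ewf (Quot e f) \<longleftrightarrow> ewf e \<and> ewf f"
| "ewf (Modulo e f) \<longleftrightarrow> ewf e \<and> ewf f"
| "ewf (Inv e f) \<longleftrightarrow> ewf e \<and> ewf f"
| "ewf (Arr k e) \<longleftrightarrow> k < narr \<and> ewf e"

fun bsize :: "bexp \<Rightarrow> nat" where
  "bsize (Less e f) = esize e + esize f + 1"
| "bsize (Eq e f) = esize e + esize f + 1"

fun bwf :: "bexp \<Rightarrow> bool" where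
  "bwf (Less e f) \<longleftrightarrow> ewf e \<and> ewf f"
| "bwf (Eq e f) \<longleftrightarrow> ewf e \<and> ewf f"

fun cbexp :: "bexp \<Rightarrow> nat \<Rightarrow> instr list" where
  "cbexp (Less e f) l = cexp e tmp @ cexp f (Suc tmp) @ [JumpLess tmp (Suc tmp) l]"
| "cbexp (Eq e f) l = cexp e tmp @ cexp f (Suc tmp) @ [JumpEq tmp (Suc tmp) l]"

fun clen :: "com \<Rightarrow> nat" where
  "clen Skip = 0"
| "clen (Assign x e) = esize e + 1"
| "clen (Upd k e f) = esize e + esize f + 4"
| "clen (c ;; d) = clen c + clen d"
| "clen (If b c d) = bsize b + clen d + 1 + clen c"
| "clen (While b c) = bsize b + 1 + clen c + 1"

text \<open>Jumps are absolute, hence the start address \<open>l\<close> and the lengths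
  \<open>clen\<close>, which do not depend on it. In a conditional the else branch comes first and
  is reached by falling through the test.\<close>

fun compile :: "nat \<Rightarrow> com \<Rightarrow> instr list" where
  "compile l Skip = []"
| "compile l (Assign x e) = cexp e tmp @ [Move x tmp]"
| "compile l (Upd k e f) = cexp e tmp @ cexp f (Suc tmp) @
    [LoadConst (tmp + 2) (2 * k), Mult (tmp + 2) (tmp + 2) 0, Add tmp tmp (tmp + 2), Store tmp (Suc tmp)]"
| "compile l (c ;; d) = compile l c @ compile (l + clen c) d"
| "compile l (If b c d) =
    cbexp b (l + bsize b + clen d + 1) @ compile (l + bsize b) d @
    [Jump (l + clen (If b c d))] @ compile (l + bsize b + clen d + 1) c"
| "compile l (While b c) =
    cbexp b (l + bsize b + 1) @ [Jump (l + clen (While b c))] @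
    compile (l + bsize b + 1) c @ [Jump l]"

text \<open>Variable \<open>0\<close> may not be assigned, because compiled array accesses compute
  addresses from register \<open>0\<close>, which has to keep the value \<open>p\<close>.\<close>

fun cwf :: "com \<Rightarrow> bool" where
  "cwf Skip \<longleftrightarrow> True"
| "cwf (Assign x e) \<longleftrightarrow> 0 < x \<and> x < tmp \<and> ewf e"
| "cwf (Upd k e f) \<longleftrightarrow> k < narr \<and> ewf e \<and> ewf f"
| "cwf (c ;; d) \<longleftrightarrow> cwf c \<and> cwf d"
| "cwf (If b c d) \<longleftrightarrow> bwf b \<and> cwf c \<and> cwf d"
| "cwf (While b c) \<longleftrightarrow> bwf b \<and> cwf c"

section \<open>Simulation of the structured language by its compiled code\<close>

lemma length_cexp [simp]: "length (cexp e r) = esize e"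
  by (induction e arbitrary: r) auto

lemma length_cbexp [simp]: "length (cbexp b l) = bsize b"
  by (cases b) auto

lemma length_compile [simp]: "length (compile l c) = clen c"
  by (induction c arbitrary: l) auto

definition code_at :: "program \<Rightarrow> nat \<Rightarrow> instr list \<Rightarrow> bool" where
  "code_at P l xs \<longleftrightarrow> l + length xs \<le> length P \<and> (\<forall>i<length xs. P ! (l + i) = xs ! i)"

lemma code_at_Nil [simp]: "code_at P l [] \<longleftrightarrow> l \<le> length P"
  by (simp add: code_at_def)

lemma code_at_append:
  "code_at P l (xs @ ys) \<longleftrightarrow> code_at P l xs \<and> code_at P (l + length xs) ys"
proof
  assume h: "code_at P l (xs @ ys)"
  have "P ! (l + length xs + i) = ys ! i" if "i < length ys" for i
    using h that unfolding code_at_def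
    by (auto dest!: spec[of _ "length xs + i"] simp: nth_append add.assoc)
  then show "code_at P l xs \<and> code_at P (l + length xs) ys"
    using h unfolding code_at_def by (auto simp: nth_append)
next
  assume h: "code_at P l xs \<and> code_at P (l + length xs) ys"
  have "P ! (l + i) = (xs @ ys) ! i" if "i < length (xs @ ys)" for i
  proof (cases "i < length xs")
    case True then show ?thesis using h by (simp add: code_at_def nth_append)
  next
    case False
    then obtain j where j: "i = length xs + j" by (metis le_add_diff_inverse not_less)
    then show ?thesis using h that unfolding code_at_def by (simp add: nth_append add.assoc)
  qed
  then show "code_at P l (xs @ ys)" using h by (auto simp: code_at_def)
qed

lemma code_at_Cons:
  "code_at P l (x # xs) \<longleftrightarrow> l < length P \<and> P ! l = x \<and> code_at P (Suc l) xs"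
  using code_at_append[of P l "[x]" xs] by (auto simp: code_at_def)

text \<open>Carries the address bound of \<open>runs_within\<close> along with an exact step count,
  so that both resources compose by transitivity.\<close>

inductive reach :: "nat \<Rightarrow> program \<Rightarrow> nat \<Rightarrow> nat \<Rightarrow> config \<Rightarrow> config \<Rightarrow> bool" for w P sp where
  reach_refl: "reach w P sp 0 c c"
| reach_step: "\<not> halted P c \<Longrightarrow> accessed P c \<subseteq> {..<sp} \<Longrightarrow> reach w P sp n (step w P c) c' \<Longrightarrow>
    reach w P sp (Suc n) c c'"

lemma reach_trans:
  "reach w P sp m c c' \<Longrightarrow> reach w P sp n c' c'' \<Longrightarrow> reach w P sp (m + n) c c''"
  by (induction rule: reach.induct) (auto intro: reach.intros)

lemma reach_instr:
  assumes "pc c < length P" "P ! pc c = ins" "instr_addresses ins c \<subseteq> {..<sp}"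
  shows "reach w P sp 1 c (exec_instr w ins c)"
proof -
  have "step w P c = exec_instr w ins c" "\<not> halted P c" "accessed P c \<subseteq> {..<sp}"
    using assms by (auto simp: step_def halted_def accessed_def)
  then show ?thesis using reach_step[OF _ _ reach_refl, of P c sp w] by simp
qed

lemma reach_funpow:
  assumes "reach w P sp n c c'"
  shows "(step w P ^^ n) c = c' \<and> (\<forall>i<n. accessed P ((step w P ^^ i) c) \<subseteq> {..<sp})"
  using assms
proof (induction rule: reach.induct)
  case (reach_step c n c')
  have "accessed P ((step w P ^^ i) c) \<subseteq> {..<sp}" if "i < Suc n" for i
    using reach_step that by (cases i) (auto simp: funpow_swap1)
  then show ?case using reach_step by (auto simp: funpow_swap1)
qed auto

definition match :: "nat \<Rightarrow> nat \<Rightarrow> vars \<Rightarrow> arrays \<Rightarrow> config \<Rightarrow> bool" where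
  "match p B s a c \<longleftrightarrow> s 0 = p \<and>
     (\<forall>x<tmp. reg c x = s x \<and> s x < B) \<and>
     (\<forall>k<narr. \<forall>i<2 * p. mem c (2 * k * p + i) = a k i \<and> a k i < B)"

lemma array_address_less:
  assumes "k < narr" "i < 2 * p"
  shows "2 * k * p + i < 2 * narr * p"
proof -
  have "2 * k * p + i < 2 * (Suc k) * p" using assms by simp
  also have "\<dots> \<le> 2 * narr * p" using assms by (intro mult_le_mono) auto
  finally show ?thesis .
qed

lemma array_address_inj:
  assumes "i < 2 * p" "i' < 2 * p" "2 * k * p + i = 2 * k' * p + (i'::nat)"
  shows "k = k' \<and> i = i'"
proof -
  have eq: "k * (2 * p) + i = k' * (2 * p) + i'" using assms(3) by (simp add: mult_ac)
  have "(k * (2 * p) + i) div (2 * p) = k" "(k' * (2 * p) + i') div (2 * p) = k'"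
    using assms by auto
  then have "k = k'" using eq by metis
  then show ?thesis using eq by simp
qed

lemma word_eqI: "(n::nat) < 2 ^ w \<Longrightarrow> v = int n \<Longrightarrow> nat (v mod 2 ^ w) = n"
proof -
  assume n: "n < 2 ^ w" and v: "v = int n"
  have "int n < 2 ^ w" using n by (metis of_nat_less_iff of_nat_numeral of_nat_power)
  then show ?thesis using v by simp
qed

lemma exec_set_reg:
  assumes "pc c < length P" "P ! pc c = ins" "instr_addresses ins c \<subseteq> {..<sp}"
    "exec_instr w ins c = set_reg w r v c" "v = int n" "n < 2 ^ w"
  shows "reach w P sp 1 c (c\<lparr>pc := Suc (pc c), reg := (reg c)(r := n)\<rparr>)"
  using reach_instr[OF assms(1-3), of w] word_eqI[OF assms(6,5)] assms(4) by (simp add: set_reg_def)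

text \<open>The common part of all binary operators: the second operand is evaluated one register
  higher, and agreement below \<open>Suc r\<close> protects the first result.\<close>

lemma cexp_binop:
  assumes IH1: "\<And>c. code_at P (pc c) (cexp e r) \<Longrightarrow> match p (2 ^ w) s a c \<Longrightarrow>
      \<exists>c'. reach w P sp (esize e) c c' \<and> pc c' = pc c + esize e \<and> reg c' r = x \<and>
        (\<forall>z<r. reg c' z = reg c z) \<and> mem c' = mem c"
    and IH2: "\<And>c. code_at P (pc c) (cexp f (Suc r)) \<Longrightarrow> match p (2 ^ w) s a c \<Longrightarrow>
      \<exists>c'. reach w P sp (esize f) c c' \<and> pc c' = pc c + esize f \<and> reg c' (Suc r) = y \<and>
        (\<forall>z<Suc r. reg c' z = reg c z) \<and> mem c' = mem c"
    and ins: "\<And>c. reg c r = x \<Longrightarrow> reg c (Suc r) = y \<Longrightarrow>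
      exec_instr w ins c = set_reg w r v c \<and> instr_addresses ins c = {}"
    and v: "v = int n" "n < 2 ^ w" and r: "tmp \<le> r"
    and code: "code_at P (pc c) (cexp e r @ cexp f (Suc r) @ [ins])" and mt: "match p (2 ^ w) s a c"
  shows "\<exists>c'. reach w P sp (esize e + esize f + 1) c c' \<and> pc c' = pc c + (esize e + esize f + 1) \<and>
    reg c' r = n \<and> (\<forall>z<r. reg c' z = reg c z) \<and> mem c' = mem c"
proof -
  have cd: "code_at P (pc c) (cexp e r)" "code_at P (pc c + esize e) (cexp f (Suc r))"
     "code_at P (pc c + esize e + esize f) [ins]"
    using code by (auto simp: code_at_append)
  obtain c1 where c1: "reach w P sp (esize e) c c1" "pc c1 = pc c + esize e" "reg c1 r = x"
      "\<forall>z<r. reg c1 z = reg c z" "mem c1 = mem c"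
    using IH1[OF cd(1) mt] by blast
  have "match p (2 ^ w) s a c1" using mt c1 r by (auto simp: match_def)
  then obtain c2 where c2: "reach w P sp (esize f) c1 c2" "pc c2 = pc c1 + esize f" "reg c2 (Suc r) = y"
      "\<forall>z<Suc r. reg c2 z = reg c1 z" "mem c2 = mem c1"
    using IH2[of c1] cd(2) c1(2) by auto
  let ?c3 = "c2\<lparr>pc := Suc (pc c2), reg := (reg c2)(r := n)\<rparr>"
  have "reach w P sp 1 c2 ?c3"
    using ins[of c2] c2 c1 cd(3) v
    by (intro exec_set_reg) (auto simp: code_at_Cons add.assoc)
  then have "reach w P sp (esize e + esize f + 1) c ?c3"
    using reach_trans[OF reach_trans[OF c1(1) c2(1)]] by blast
  then show ?thesis using c1 c2 by (intro exI[of _ ?c3]) auto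
qed

text \<open>The bound on the value takes part in the induction: for differences, quotients and
  remainders it comes from the left operand, for inverses from the modulus.\<close>

lemma cexp_correct:
  assumes "code_at P (pc c) (cexp e r)" "match p (2 ^ w) s a c" "tmp \<le> r" "ewf e"
    "eok (2 ^ w) e s a" "2 * narr * p \<le> 2 ^ w" "2 * narr * p \<le> sp"
  shows "aval e s a < 2 ^ w \<and> (\<exists>c'. reach w P sp (esize e) c c' \<and> pc c' = pc c + esize e \<and>
    reg c' r = aval e s a \<and> (\<forall>z<r. reg c' z = reg c z) \<and> mem c' = mem c)"
  using assms(1-5)
proof (induction e arbitrary: c r)
  case (N n)
  let ?c = "c\<lparr>pc := Suc (pc c), reg := (reg c)(r := n)\<rparr>"
  have "reach w P sp 1 c ?c" using N by (intro exec_set_reg) (auto simp: code_at_Cons)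
  then show ?case using N by (auto intro!: exI[of _ ?c])
next
  case (V x)
  let ?c = "c\<lparr>pc := Suc (pc c), reg := (reg c)(r := s x)\<rparr>"
  have sx: "reg c x = s x" "s x < 2 ^ w" using V by (auto simp: match_def)
  have "reach w P sp 1 c ?c"
    using V sx by (intro exec_set_reg[where v = "int (s x)"]) (auto simp: code_at_Cons)
  with sx show ?case by (auto intro!: exI[of _ ?c])
next
  case (Plus e f)
  show ?case
    apply (simp only: aval.simps esize.simps)
    apply (intro conjI)
    subgoal using Plus.prems by simp
    apply (rule cexp_binop[where x = "aval e s a" and y = "aval f s a" and e = e and f = f
      and ins = "Add r r (Suc r)" and v = "int (aval e s a) + int (aval f s a)" and s = s and a = a and p = p])
    using Plus by (auto simp: match_def)
next
  case (Minus e f)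
  have "aval e s a < 2 ^ w"
    using Minus.IH(1)[of c r] Minus.prems by (auto simp: code_at_append)
  then show ?case
    apply (simp only: aval.simps esize.simps)
    apply (intro conjI)
    subgoal by simp
    apply (rule cexp_binop[where x = "aval e s a" and y = "aval f s a" and e = e and f = f
      and ins = "Sub r r (Suc r)" and v = "int (aval e s a) - int (aval f s a)" and s = s and a = a and p = p])
    using Minus by (auto simp: match_def of_nat_diff)
next
  case (Times e f)
  show ?case
    apply (simp only: aval.simps esize.simps)
    apply (intro conjI)
    subgoal using Times.prems by simp
    apply (rule cexp_binop[where x = "aval e s a" and y = "aval f s a" and e = e and f = f
      and ins = "Mult r r (Suc r)" and v = "int (aval e s a) * int (aval f s a)" and s = s and a = a and p = p])
    using Times by (auto simp: match_def)
next
  case (Quot e f)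
  have "aval e s a < 2 ^ w"
    using Quot.IH(1)[of c r] Quot.prems by (auto simp: code_at_append)
  then have lt: "aval e s a div aval f s a < 2 ^ w" by (meson div_le_dividend le_less_trans)
  then show ?case
    apply (simp only: aval.simps esize.simps)
    apply (intro conjI)
    subgoal by simp
    apply (rule cexp_binop[where x = "aval e s a" and y = "aval f s a" and e = e and f = f
      and ins = "Div r r (Suc r)" and v = "int (aval e s a) div int (aval f s a)" and s = s and a = a and p = p])
    using Quot by (auto simp: match_def zdiv_int)
next
  case (Modulo e f)
  have "aval e s a < 2 ^ w"
    using Modulo.IH(1)[of c r] Modulo.prems by (auto simp: code_at_append)
  then have lt: "aval e s a mod aval f s a < 2 ^ w" by (meson mod_less_eq_dividend le_less_trans)
  then show ?case
    apply (simp only: aval.simps esize.simps)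
    apply (intro conjI)
    subgoal by simp
    apply (rule cexp_binop[where x = "aval e s a" and y = "aval f s a" and e = e and f = f
      and ins = "Rem r r (Suc r)" and v = "int (aval e s a) mod int (aval f s a)" and s = s and a = a and p = p])
    using Modulo by (auto simp: match_def zmod_int)
next
  case (Inv e f)
  let ?v = "modular_inverse (int (aval e s a)) (int (aval f s a))"
  have "aval e s a < 2 ^ w"
    using Inv.IH(1)[of c r] Inv.prems by (auto simp: code_at_append)
  moreover have "0 \<le> ?v" "?v < int (aval e s a)"
    using Inv.prems by (simp_all add: modular_inverse_int_nonneg modular_inverse_int_less)
  ultimately have lt: "nat ?v < 2 ^ w" "?v = int (nat ?v)" by linarith+
  show ?case
    apply (simp only: aval.simps esize.simps)
    apply (intro conjI)
    subgoal using lt by simp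
    apply (rule cexp_binop[where x = "aval e s a" and y = "aval f s a" and e = e and f = f
      and ins = "ModInv r (Suc r) r" and v = ?v and s = s and a = a and p = p])
    using Inv lt by (auto simp: match_def)
next
  case (Arr k e)
  let ?i = "aval e s a"
  have cd: "code_at P (pc c) (cexp e r)" and cd2: "code_at P (pc c + esize e)
      [LoadConst (Suc r) (2 * k), Mult (Suc r) (Suc r) 0, Add r r (Suc r), Load r r]"
    using Arr.prems by (auto simp: code_at_append)
  have k: "k < narr" "?i < 2 * p" and p: "s 0 = p" "reg c 0 = p" and r: "0 < r"
    using Arr.prems by (auto simp: match_def tmp_def)
  have ad: "2 * k * p + ?i < 2 * narr * p" using array_address_less[OF k] .
  obtain c1 where c1: "reach w P sp (esize e) c c1" "pc c1 = pc c + esize e" "reg c1 r = ?i"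
      "\<forall>z<r. reg c1 z = reg c z" "mem c1 = mem c"
    using Arr.IH[OF cd] Arr.prems by auto
  have val: "a k ?i < 2 ^ w" "mem c (2 * k * p + ?i) = a k ?i"
    using Arr.prems(2) k by (auto simp: match_def)
  have p0: "p > 0" using k by auto
  have k2: "2 * k * p < 2 ^ w" using ad assms(6) by linarith
  moreover have "2 * k \<le> 2 * k * p" using p0 by simp
  ultimately have k1: "2 * k < 2 ^ w" by linarith
  let ?c2 = "c1\<lparr>pc := Suc (pc c1), reg := (reg c1)(Suc r := 2 * k)\<rparr>"
  let ?c3 = "?c2\<lparr>pc := Suc (pc ?c2), reg := (reg ?c2)(Suc r := 2 * k * p)\<rparr>"
  let ?c4 = "?c3\<lparr>pc := Suc (pc ?c3), reg := (reg ?c3)(r := 2 * k * p + ?i)\<rparr>"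
  let ?c5 = "?c4\<lparr>pc := Suc (pc ?c4), reg := (reg ?c4)(r := a k ?i)\<rparr>"
  have "reach w P sp 1 c1 ?c2"
    using cd2 k1 by (intro exec_set_reg) (auto simp: code_at_Cons c1)
  moreover have "reach w P sp 1 ?c2 ?c3"
    using cd2 k2 c1 p r by (intro exec_set_reg[where v = "int (2 * k) * int p"]) (auto simp: code_at_Cons)
  moreover have "reach w P sp 1 ?c3 ?c4"
    using cd2 ad assms(6) c1 by (intro exec_set_reg[where v = "int (2 * k * p + ?i)"]) (auto simp: code_at_Cons algebra_simps)
  moreover have "reach w P sp 1 ?c4 ?c5"
    using cd2 ad assms(7) val c1
    by (intro exec_set_reg[where v = "int (a k ?i)"]) (auto simp: code_at_Cons algebra_simps)
  ultimately have "reach w P sp (esize e + 1 + 1 + 1 + 1) c ?c5"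
    using c1(1) by (meson reach_trans)
  then show ?case using val c1 by (intro conjI exI[of _ ?c5]) (auto simp: numeral_eq_Suc)
qed

lemma cbexp_correct:
  assumes code: "code_at P (pc c) (cbexp b l)" and mt: "match p (2 ^ w) s a c"
    and wf: "bwf b" "bok (2 ^ w) b s a" and sp: "2 * narr * p \<le> 2 ^ w" "2 * narr * p \<le> sp"
  shows "\<exists>c'. reach w P sp (bsize b) c c' \<and> match p (2 ^ w) s a c' \<and>
    pc c' = (if bval b s a then l else pc c + bsize b)"
proof -
  obtain e f ins where b: "cbexp b l = cexp e tmp @ cexp f (Suc tmp) @ [ins]"
      "ewf e" "ewf f" "eok (2 ^ w) e s a" "eok (2 ^ w) f s a" "bsize b = esize e + esize f + 1"
    and ins: "\<And>c. reg c tmp = aval e s a \<Longrightarrow> reg c (Suc tmp) = aval f s a \<Longrightarrow>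
      exec_instr w ins c = c\<lparr>pc := (if bval b s a then l else Suc (pc c))\<rparr>" "\<And>c. instr_addresses ins c = {}"
  proof (cases b)
    case (Less e f)
    then show thesis using wf that[of e f "JumpLess tmp (Suc tmp) l"] by auto
  next
    case (Eq e f)
    then show thesis using wf that[of e f "JumpEq tmp (Suc tmp) l"] by auto
  qed
  have cd: "code_at P (pc c) (cexp e tmp)" "code_at P (pc c + esize e) (cexp f (Suc tmp))"
     "code_at P (pc c + esize e + esize f) [ins]"
    using code b(1) by (auto simp: code_at_append)
  obtain c1 where c1: "reach w P sp (esize e) c c1" "pc c1 = pc c + esize e" "reg c1 tmp = aval e s a"
      "\<forall>z<tmp. reg c1 z = reg c z" "mem c1 = mem c"
    using cexp_correct[OF cd(1) mt _ b(2,4) sp] by auto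
  have mt1: "match p (2 ^ w) s a c1" using mt c1 by (auto simp: match_def)
  obtain c2 where c2: "reach w P sp (esize f) c1 c2" "pc c2 = pc c1 + esize f" "reg c2 (Suc tmp) = aval f s a"
      "\<forall>z<Suc tmp. reg c2 z = reg c1 z" "mem c2 = mem c1"
    using cexp_correct[OF cd(2)[folded c1(2)] mt1 _ b(3,5) sp] by auto
  let ?c3 = "c2\<lparr>pc := (if bval b s a then l else Suc (pc c2))\<rparr>"
  have "reach w P sp 1 c2 (exec_instr w ins c2)"
    using cd(3) c1 c2 ins(2) by (intro reach_instr) (auto simp: code_at_Cons add.assoc)
  then have "reach w P sp 1 c2 ?c3" using ins(1)[of c2] c1 c2 by simp
  then have "reach w P sp (bsize b) c ?c3"
    using reach_trans[OF reach_trans[OF c1(1) c2(1)]] b(6) by metis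
  moreover have "match p (2 ^ w) s a ?c3" using mt1 c2 by (auto simp: match_def)
  ultimately show ?thesis using b(6) c1 c2 by (intro exI[of _ ?c3]) auto
qed

lemma reach_Jump:
  assumes "code_at P (pc c) (Jump l # xs)"
  shows "reach w P sp 1 c (c\<lparr>pc := l\<rparr>)"
  using reach_instr[of c P "Jump l" sp w] assms by (simp add: code_at_Cons)

lemma match_pc: "match p B s a c \<Longrightarrow> match p B s a (c\<lparr>pc := l\<rparr>)"
  by (simp add: match_def)

lemma Upd_correct:
  assumes code: "code_at P (pc c) (compile (pc c) (Upd k e f))" and mt: "match p (2 ^ w) s a c"
    and wf: "cwf (Upd k e f)" "eok (2 ^ w) e s a" "eok (2 ^ w) f s a" "aval e s a < 2 * s 0"
    and sp: "2 * narr * p \<le> 2 ^ w" "2 * narr * p \<le> sp"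
  shows "\<exists>c'. reach w P sp (clen (Upd k e f)) c c' \<and>
    match p (2 ^ w) s (a(k := (a k)(aval e s a := aval f s a))) c' \<and> pc c' = pc c + clen (Upd k e f)"
proof -
  let ?i = "aval e s a"
  let ?v = "aval f s a"
  have cd: "code_at P (pc c) (cexp e tmp)" "code_at P (pc c + esize e) (cexp f (Suc tmp))"
     "code_at P (pc c + esize e + esize f) [LoadConst (tmp + 2) (2 * k),
        Mult (tmp + 2) (tmp + 2) 0, Add tmp tmp (tmp + 2), Store tmp (Suc tmp)]"
    using code by (auto simp: code_at_append)
  have k: "k < narr" "?i < 2 * p" and p: "s 0 = p" "reg c 0 = p"
    using wf mt by (auto simp: match_def tmp_def)
  obtain c1 where c1: "reach w P sp (esize e) c c1" "pc c1 = pc c + esize e" "reg c1 tmp = ?i"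
      "\<forall>z<tmp. reg c1 z = reg c z" "mem c1 = mem c"
    using cexp_correct[OF cd(1) mt _ _ _ sp] wf by auto
  have mt1: "match p (2 ^ w) s a c1" using mt c1 by (auto simp: match_def)
  obtain c2 where c2: "reach w P sp (esize f) c1 c2" "pc c2 = pc c1 + esize f" "reg c2 (Suc tmp) = ?v"
      "\<forall>z<Suc tmp. reg c2 z = reg c1 z" "mem c2 = mem c1" and vlt: "?v < 2 ^ w"
    using cexp_correct[OF cd(2)[folded c1(2)] mt1 _ _ _ sp] wf by auto
  have ad: "2 * k * p + ?i < 2 * narr * p" using array_address_less[OF k] .
  have p0: "p > 0" using k by auto
  have k2: "2 * k * p < 2 ^ w" using ad sp by linarith
  moreover have "2 * k \<le> 2 * k * p" using p0 by simp
  ultimately have k1: "2 * k < 2 ^ w" by linarith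
  let ?c3 = "c2\<lparr>pc := Suc (pc c2), reg := (reg c2)(tmp + 2 := 2 * k)\<rparr>"
  let ?c4 = "?c3\<lparr>pc := Suc (pc ?c3), reg := (reg ?c3)(tmp + 2 := 2 * k * p)\<rparr>"
  let ?c5 = "?c4\<lparr>pc := Suc (pc ?c4), reg := (reg ?c4)(tmp := 2 * k * p + ?i)\<rparr>"
  let ?c6 = "?c5\<lparr>pc := Suc (pc ?c5), mem := (mem ?c5)(2 * k * p + ?i := ?v)\<rparr>"
  have t0: "0 < tmp" by (simp add: tmp_def)
  have "reach w P sp 1 c2 ?c3"
    using cd k1 by (intro exec_set_reg) (auto simp: code_at_Cons c1 c2 add.assoc)
  moreover have "reach w P sp 1 ?c3 ?c4"
    using cd k2 c1 c2 p t0
    by (intro exec_set_reg[where v = "int (2 * k) * int p"]) (auto simp: code_at_Cons add.assoc)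
  moreover have "reach w P sp 1 ?c4 ?c5"
    using cd ad sp c1 c2
    by (intro exec_set_reg[where v = "int (2 * k * p + ?i)"]) (auto simp: code_at_Cons algebra_simps)
  moreover have "reach w P sp 1 ?c5 (exec_instr w (Store tmp (Suc tmp)) ?c5)"
    using cd ad sp c1 c2 by (intro reach_instr) (auto simp: code_at_Cons algebra_simps)
  then have "reach w P sp 1 ?c5 ?c6" using c2 by simp
  ultimately have "reach w P sp (esize e + esize f + 1 + 1 + 1 + 1) c ?c6"
    using c1(1) c2(1) by (meson reach_trans)
  moreover have "match p (2 ^ w) s (a(k := (a k)(?i := ?v))) ?c6"
    using mt c1 c2 vlt k array_address_inj[of _ p ?i _ k]
    by (auto simp: match_def)
  ultimately show ?thesis using c1 c2 by (intro exI[of _ ?c6]) (auto simp: numeral_eq_Suc)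
qed

text \<open>The counted test of a conditional or of a loop iteration pays for the test code and the
  jumps around it; the rest is paid by the parts, whose text is no longer than that of the whole
  command. This gives the factor \<open>clen c\<close>.\<close>

lemma compile_correct:
  assumes "big (2 ^ w) c s a n s' a'"
    and "cwf c" "match p (2 ^ w) s a cf" "code_at P (pc cf) (compile (pc cf) c)"
    and sp: "2 * narr * p \<le> 2 ^ w" "2 * narr * p \<le> sp"
  shows "\<exists>t cf'. t \<le> clen c * n \<and> reach w P sp t cf cf' \<and>
    pc cf' = pc cf + clen c \<and> match p (2 ^ w) s' a' cf'"
  using assms(1-4)
proof (induction arbitrary: cf rule: big.induct)
  case (big_Skip s a)
  then show ?case by (intro exI[of _ 0] exI[of _ cf]) (auto intro: reach_refl)
next
  case (big_Assign e s a x)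
  have cd: "code_at P (pc cf) (cexp e tmp)" "code_at P (pc cf + esize e) [Move x tmp]"
    using big_Assign by (auto simp: code_at_append)
  have x: "0 < x" "x < tmp" "ewf e" using big_Assign by auto
  obtain c1 where c1: "reach w P sp (esize e) cf c1" "pc c1 = pc cf + esize e" "reg c1 tmp = aval e s a"
      "\<forall>z<tmp. reg c1 z = reg cf z" "mem c1 = mem cf" and lt: "aval e s a < 2 ^ w"
    using cexp_correct[OF cd(1) big_Assign.prems(2) order_refl x(3) big_Assign.hyps sp] by auto
  let ?c2 = "c1\<lparr>pc := Suc (pc c1), reg := (reg c1)(x := aval e s a)\<rparr>"
  have "reach w P sp 1 c1 ?c2"
    using cd c1 lt by (intro exec_set_reg[where v = "int (aval e s a)"]) (auto simp: code_at_Cons)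
  then have "reach w P sp (esize e + 1) cf ?c2" using c1(1) reach_trans by blast
  moreover have "match p (2 ^ w) (s(x := aval e s a)) a ?c2"
    using big_Assign.prems c1 lt x by (auto simp: match_def)
  moreover have "pc ?c2 = pc cf + clen (Assign x e)" using c1 by simp
  moreover have "esize e + 1 \<le> clen (Assign x e) * 1" by simp
  ultimately show ?case by blast
next
  case (big_Upd e s a f k)
  have "clen (Upd k e f) \<le> clen (Upd k e f) * 1" by simp
  then show ?case using Upd_correct[OF big_Upd.prems(3,2,1) big_Upd.hyps sp] by blast
next
  case (big_Seq c s a m s' a' d n s'' a'')
  obtain t1 c1 where c1: "t1 \<le> clen c * m" "reach w P sp t1 cf c1" "pc c1 = pc cf + clen c"
      "match p (2 ^ w) s' a' c1"
    using big_Seq.IH(1)[of cf] big_Seq.prems by (auto simp: code_at_append)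
  obtain t2 c2 where c2: "t2 \<le> clen d * n" "reach w P sp t2 c1 c2" "pc c2 = pc c1 + clen d"
      "match p (2 ^ w) s'' a'' c2"
    using big_Seq.IH(2)[of c1] big_Seq.prems c1 by (auto simp: code_at_append)
  have "t1 + t2 \<le> clen (c ;; d) * (m + n)" using c1(1) c2(1) by (simp add: algebra_simps)
  then show ?case using reach_trans[OF c1(2) c2(2)] c1 c2 by (metis add.assoc clen.simps(4))
next
  case (big_IfT b s a c n s' a' d)
  have cd: "code_at P (pc cf) (cbexp b (pc cf + bsize b + clen d + 1))"
      "code_at P (pc cf + bsize b + clen d + 1) (compile (pc cf + bsize b + clen d + 1) c)"
    using big_IfT.prems by (auto simp: code_at_append code_at_Cons add.assoc)
  obtain c1 where c1: "reach w P sp (bsize b) cf c1" "match p (2 ^ w) s a c1"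
      "pc c1 = pc cf + bsize b + clen d + 1"
    using cbexp_correct[OF cd(1) big_IfT.prems(2) _ _ sp] big_IfT by auto
  obtain t2 c2 where c2: "t2 \<le> clen c * n" "reach w P sp t2 c1 c2" "pc c2 = pc c1 + clen c"
      "match p (2 ^ w) s' a' c2"
    using big_IfT.IH[of c1] big_IfT.prems(1) cd(2) c1 by auto
  have "bsize b + t2 \<le> clen (If b c d) * Suc n" using c2(1) by (simp add: algebra_simps)
  then show ?case using reach_trans[OF c1(1) c2(2)] c1 c2 by (intro exI[of _ "bsize b + t2"] exI[of _ c2]) auto
next
  case (big_IfF b s a d n s' a' c)
  have cd: "code_at P (pc cf) (cbexp b (pc cf + bsize b + clen d + 1))"
      "code_at P (pc cf + bsize b) (compile (pc cf + bsize b) d)"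
      "code_at P (pc cf + bsize b + clen d) [Jump (pc cf + clen (If b c d))]"
    using big_IfF.prems by (auto simp: code_at_append code_at_Cons add.assoc)
  obtain c1 where c1: "reach w P sp (bsize b) cf c1" "match p (2 ^ w) s a c1"
      "pc c1 = pc cf + bsize b"
    using cbexp_correct[OF cd(1) big_IfF.prems(2) _ _ sp] big_IfF by auto
  obtain t2 c2 where c2: "t2 \<le> clen d * n" "reach w P sp t2 c1 c2" "pc c2 = pc c1 + clen d"
      "match p (2 ^ w) s' a' c2"
    using big_IfF.IH[of c1] big_IfF.prems(1) cd(2) c1 by auto
  have j: "reach w P sp 1 c2 (c2\<lparr>pc := pc cf + clen (If b c d)\<rparr>)"
    using cd(3) c1 c2 by (intro reach_Jump) auto
  have "bsize b + t2 + 1 \<le> clen (If b c d) * Suc n" using c2(1) by (simp add: algebra_simps)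
  then show ?case using reach_trans[OF reach_trans[OF c1(1) c2(2)] j] match_pc[OF c2(4)]
    by (intro exI[of _ "bsize b + t2 + 1"] exI[of _ "c2\<lparr>pc := pc cf + clen (If b c d)\<rparr>"]) auto
next
  case (big_WhileT b s a c m s' a' n s'' a'')
  let ?W = "While b c"
  have cd: "code_at P (pc cf) (cbexp b (pc cf + bsize b + 1))"
      "code_at P (pc cf + bsize b + 1) (compile (pc cf + bsize b + 1) c)"
      "code_at P (pc cf + bsize b + 1 + clen c) [Jump (pc cf)]"
    using big_WhileT.prems by (auto simp: code_at_append code_at_Cons add.assoc)
  obtain c1 where c1: "reach w P sp (bsize b) cf c1" "match p (2 ^ w) s a c1"
      "pc c1 = pc cf + bsize b + 1"
    using cbexp_correct[OF cd(1) big_WhileT.prems(2) _ _ sp] big_WhileT by auto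
  obtain t2 c2 where c2: "t2 \<le> clen c * m" "reach w P sp t2 c1 c2" "pc c2 = pc c1 + clen c"
      "match p (2 ^ w) s' a' c2"
    using big_WhileT.IH(1)[of c1] big_WhileT.prems(1) cd(2) c1 by auto
  let ?c3 = "c2\<lparr>pc := pc cf\<rparr>"
  have j: "reach w P sp 1 c2 ?c3" using cd(3) c1 c2 by (intro reach_Jump) auto
  obtain t4 c4 where c4: "t4 \<le> clen ?W * n" "reach w P sp t4 ?c3 c4"
      "pc c4 = pc cf + clen ?W" "match p (2 ^ w) s'' a'' c4"
    using big_WhileT.IH(2)[of ?c3] big_WhileT.prems match_pc[OF c2(4)] by auto
  have "clen c * m \<le> clen ?W * m" by (intro mult_le_mono1) simp
  then have "bsize b + t2 + 1 + t4 \<le> clen ?W * Suc (m + n)"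
    using c2(1) c4(1) by (simp add: algebra_simps)
  then show ?case using reach_trans[OF reach_trans[OF reach_trans[OF c1(1) c2(2)] j] c4(2)] c4
    by (intro exI[of _ "bsize b + t2 + 1 + t4"] exI[of _ c4]) auto
next
  case (big_WhileF b s a c)
  let ?W = "While b c"
  have cd: "code_at P (pc cf) (cbexp b (pc cf + bsize b + 1))"
      "code_at P (pc cf + bsize b) [Jump (pc cf + clen ?W)]"
    using big_WhileF.prems by (auto simp: code_at_append code_at_Cons add.assoc)
  obtain c1 where c1: "reach w P sp (bsize b) cf c1" "match p (2 ^ w) s a c1"
      "pc c1 = pc cf + bsize b"
    using cbexp_correct[OF cd(1) big_WhileF.prems(2) _ _ sp] big_WhileF by auto
  have j: "reach w P sp 1 c1 (c1\<lparr>pc := pc cf + clen ?W\<rparr>)"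
    using cd(2) c1 by (intro reach_Jump) auto
  show ?case using reach_trans[OF c1(1) j] match_pc[OF c1(2)]
    by (intro exI[of _ "bsize b + 1"] exI[of _ "c1\<lparr>pc := pc cf + clen ?W\<rparr>"]) auto
qed

section \<open>A program logic with a step counter\<close>

definition run :: "nat \<Rightarrow> com \<Rightarrow> vars \<Rightarrow> arrays \<Rightarrow> nat \<Rightarrow> (vars \<Rightarrow> arrays \<Rightarrow> nat \<Rightarrow> bool) \<Rightarrow> bool" where
  "run B c s a t Q \<longleftrightarrow> (\<exists>n s' a'. big B c s a n s' a' \<and> Q s' a' (t + n))"

inductive_cases big_SkipE: "big B Skip s a n s' a'"
inductive_cases big_AssignE: "big B (Assign x e) s a n s' a'"
inductive_cases big_UpdE: "big B (Upd k e f) s a n s' a'"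
inductive_cases big_SeqE: "big B (c ;; d) s a n s' a'"
inductive_cases big_IfE: "big B (If b c d) s a n s' a'"

text \<open>With the following equations as rewrite rules the simplifier executes loop-free code
  symbolically, so only loops need invariants.\<close>

lemma run_Skip [simp]: "run B Skip s a t Q \<longleftrightarrow> Q s a t"
  unfolding run_def by (auto elim!: big_SkipE intro: big_Skip) (metis add_0_right big_Skip)

lemma run_Assign [simp]:
  "run B (Assign x e) s a t Q \<longleftrightarrow> eok B e s a \<and> Q (s(x := aval e s a)) a (t + 1)"
  unfolding run_def by (auto elim!: big_AssignE) (metis One_nat_def add.commute big_Assign plus_1_eq_Suc)

lemma run_Upd [simp]:
  "run B (Upd k e f) s a t Q \<longleftrightarrow> eok B e s a \<and> eok B f s a \<and> aval e s a < 2 * s 0 \<and>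
     Q s (a(k := (a k)(aval e s a := aval f s a))) (t + 1)"
  unfolding run_def by (auto elim!: big_UpdE) (metis One_nat_def add.commute big_Upd plus_1_eq_Suc)

lemma run_Seq [simp]: "run B (c ;; d) s a t Q \<longleftrightarrow> run B c s a t (\<lambda>s a t. run B d s a t Q)"
  unfolding run_def by (auto elim!: big_SeqE simp: add.assoc) (metis add.assoc big_Seq)+

lemma run_If [simp]:
  "run B (If b c d) s a t Q \<longleftrightarrow> bok B b s a \<and>
    (bval b s a \<longrightarrow> run B c s a (t + 1) Q) \<and> (\<not> bval b s a \<longrightarrow> run B d s a (t + 1) Q)"
  unfolding run_def by (auto elim!: big_IfE) (metis add_Suc_right big_IfT big_IfF)+

lemma run_mono:
  "run B c s a t Q \<Longrightarrow> (\<And>s a t. Q s a t \<Longrightarrow> Q' s a t) \<Longrightarrow> run B c s a t Q'"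
  unfolding run_def by blast

text \<open>The invariant may speak of the clock \<open>t\<close>, so a time bound that is linear in
  a loop variable is proved together with correctness; \<open>M\<close> only has to ensure
  termination.\<close>

lemma run_While:
  fixes M :: "vars \<Rightarrow> arrays \<Rightarrow> nat"
  assumes "I s a t"
    and step: "\<And>s a t. I s a t \<Longrightarrow> bok B b s a \<and> (bval b s a \<longrightarrow>
      run B c s a (t + 1) (\<lambda>s' a' t'. I s' a' t' \<and> M s' a' < M s a))"
    and post: "\<And>s a t. I s a t \<Longrightarrow> \<not> bval b s a \<Longrightarrow> Q s a (t + 1)"
  shows "run B (While b c) s a t Q"
  using assms(1)
proof (induction "M s a" arbitrary: s a t rule: less_induct)
  case less
  show ?case
  proof (cases "bval b s a")
    case True
    then obtain n s' a' where 1: "big B c s a n s' a'" "I s' a' (t + 1 + n)" "M s' a' < M s a"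
      using step[OF less.prems] by (auto simp: run_def)
    obtain m s'' a'' where 2: "big B (While b c) s' a' m s'' a''" "Q s'' a'' (t + 1 + n + m)"
      using less.hyps[OF 1(3,2)] by (auto simp: run_def)
    have "big B (While b c) s a (Suc (n + m)) s'' a''"
      using big_WhileT[OF _ True 1(1) 2(1)] step[OF less.prems] by blast
    then show ?thesis unfolding run_def using 2(2)
      by (intro exI[of _ "Suc (n + m)"] exI[of _ s''] exI[of _ a'']) (simp add: add_ac)
  next
    case False
    then show ?thesis unfolding run_def
      using big_WhileF[of B b s a c] step[OF less.prems] post[OF less.prems] by blast
  qed
qed

section \<open>Program fragments\<close>

text \<open>
  Variable \<open>0\<close> is \<open>p\<close>, \<open>1\<close> is \<open>\<tau>\<close>, \<open>22\<close> the current target, \<open>3\<close> is \<open>mu\<close>, \<open>6\<close> the next free node, \<open>12\<close> and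
  \<open>13\<close> are the window length \<open>W\<close> and the least difference \<open>q\<close> of a pairing. Array \<open>0\<close> holds the input and
  later the output bits, \<open>15\<close> the keys. Indices \<open>1, \<dots>, p - 1\<close> denote the elements and indices from \<open>p\<close> on
  denote pairs, whose two parts are stored in arrays \<open>2\<close> (smaller key) and \<open>3\<close> (larger key).
\<close>

definition same_except :: "nat set \<Rightarrow> (nat \<Rightarrow> 'a) \<Rightarrow> (nat \<Rightarrow> 'a) \<Rightarrow> bool" where
  "same_except X f g \<longleftrightarrow> (\<forall>x. x \<notin> X \<longrightarrow> g x = f x)"

lemma same_except_refl [simp]: "same_except X f f"
  by (simp add: same_except_def)

lemma same_except_upd [simp]: "x \<in> X \<Longrightarrow> same_except X f (g(x := v)) \<longleftrightarrow> same_except X f g"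
  by (auto simp: same_except_def)

section \<open>Counting frequencies and rescaling keys\<close>

definition occ :: "(nat \<Rightarrow> nat) \<Rightarrow> nat \<Rightarrow> nat \<Rightarrow> nat \<Rightarrow> nat" where
  "occ f l h v = card {j \<in> {l..<h}. f j = v}"

lemma occ_Suc: "l \<le> h \<Longrightarrow> occ f l (Suc h) v = occ f l h v + (if f h = v then 1 else 0)"
proof -
  assume "l \<le> h"
  then have "{j \<in> {l..<Suc h}. f j = v} =
      (if f h = v then insert h {j \<in> {l..<h}. f j = v} else {j \<in> {l..<h}. f j = v})"
    by (auto simp: less_Suc_eq)
  then show ?thesis by (simp add: occ_def)
qed

lemma occ_self [simp]: "occ f l l v = 0"
  by (simp add: occ_def)

lemma occ_le: "occ f l h v \<le> h - l"
proof -
  have "{j \<in> {l..<h}. f j = v} \<subseteq> {l..<h}" by auto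
  then show ?thesis unfolding occ_def using card_mono[of "{l..<h}"] by fastforce
qed

text \<open>Variable \<open>14\<close> holds the largest count met so far and \<open>4\<close> a
  value attaining it, so one pass finds a most frequent value.\<close>

definition count_code :: "nat \<Rightarrow> nat \<Rightarrow> com" where
  "count_code src cnt = While (Less (V 2) (V 11))
     (Assign 5 (Plus (Arr cnt (Arr src (V 2))) (N 1)) ;;
      Upd cnt (Arr src (V 2)) (V 5) ;;
      If (Less (V 14) (V 5)) (Assign 14 (V 5) ;; Assign 4 (Arr src (V 2))) Skip ;;
      Assign 2 (Plus (V 2) (N 1)))"

lemma run_count_code:
  assumes "s 2 \<le> s 11" "s 11 \<le> 2 * s 0" "s 14 = 0" "src \<noteq> cnt" "2 * s 0 + 1 < B"
    and "\<And>i. s 2 \<le> i \<Longrightarrow> i < s 11 \<Longrightarrow> a src i < 2 * s 0"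
    and "\<And>i. i < 2 * s 0 \<Longrightarrow> a cnt i = 0"
  shows "run B (count_code src cnt) s a t (\<lambda>s' a' t'.
     same_except {2, 4, 5, 14} s s' \<and> same_except {cnt} a a' \<and> t' \<le> t + 7 * (s 11 - s 2) + 1 \<and>
     (\<forall>v < 2 * s 0. occ (a src) (s 2) (s 11) v \<le> s' 14) \<and> s' 14 \<le> s 11 - s 2 \<and>
     (s 2 < s 11 \<longrightarrow> s' 4 \<in> a src ` {s 2..<s 11} \<and> occ (a src) (s 2) (s 11) (s' 4) = s' 14 \<and> s' 14 > 0))"
proof -
  let ?o = "\<lambda>h v. occ (a src) (s 2) h v"
  define I where "I = (\<lambda>(s'::vars) (a'::arrays) (t'::nat).
    same_except {2, 4, 5, 14} s s' \<and> same_except {cnt} a a' \<and>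
    s 2 \<le> s' 2 \<and> s' 2 \<le> s 11 \<and> t' \<le> t + 7 * (s' 2 - s 2) \<and>
    (\<forall>v < 2 * s 0. a' cnt v = ?o (s' 2) v \<and> ?o (s' 2) v \<le> s' 14) \<and> s' 14 \<le> s' 2 - s 2 \<and>
    (s 2 < s' 2 \<longrightarrow> s' 4 \<in> a src ` {s 2..<s' 2} \<and> ?o (s' 2) (s' 4) = s' 14 \<and> s' 14 > 0))"
  show ?thesis unfolding count_code_def
  proof (rule run_While[where M = "\<lambda>s' a'. s 11 - s' 2" and I = I], goal_cases)
    case 1
    show ?case using assms by (auto simp: I_def)
  next
    case (2 s' a' t')
    then have I: "same_except {2, 4, 5, 14} s s'" "same_except {cnt} a a'"
      "s 2 \<le> s' 2" "s' 2 \<le> s 11" "t' \<le> t + 7 * (s' 2 - s 2)"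
      "\<forall>v < 2 * s 0. a' cnt v = ?o (s' 2) v \<and> ?o (s' 2) v \<le> s' 14" "s' 14 \<le> s' 2 - s 2"
      "s 2 < s' 2 \<longrightarrow> s' 4 \<in> a src ` {s 2..<s' 2} \<and> ?o (s' 2) (s' 4) = s' 14 \<and> s' 14 > 0"
      by (simp_all add: I_def)
    have eqs: "s' 11 = s 11" "s' 0 = s 0" "a' src = a src"
      using I(1,2) assms(4) by (auto simp: same_except_def)
    show ?case
    proof (cases "s' 2 < s 11")
      case True
      let ?v = "a src (s' 2)"
      have 1: "?v < 2 * s 0" "s' 2 < 2 * s 0" using assms(2,6) I True by auto
      have 2: "a' cnt ?v = ?o (s' 2) ?v" "?o (s' 2) ?v \<le> s' 14" using I 1 by blast+
      have 3: "?o (Suc (s' 2)) v = ?o (s' 2) v + (if ?v = v then 1 else 0)" for v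
        using I(3) by (rule occ_Suc)
      have ob: "?o (s' 2) v \<le> s' 2 - s 2" for v by (rule occ_le)
      have mv: "?o (s' 2) v \<le> s' 14" if "v < 2 * s 0" for v using I(6) that by blast
      have 4: "Suc (s' 2) - s 2 = Suc (s' 2 - s 2)" using I(3) by simp
      have 5: "a src ` {s 2..<Suc (s' 2)} = insert ?v (a src ` {s 2..<s' 2})"
        using I(3) by (simp add: atLeastLessThanSuc)
      show ?thesis
        using True 1 2 I assms(4,5)
        apply (simp add: eqs I_def 3 4 5)
        apply (intro conjI impI allI; (simp; fail)?)
        subgoal using ob[of "s' 4"] by linarith
        subgoal for v using mv[of v] by linarith
        subgoal using ob[of "s' 4"] by linarith
        subgoal by (cases "s 2 = s' 2") auto
        subgoal using ob[of ?v] by linarith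
        subgoal for v using mv[of v] by linarith
        subgoal using ob[of ?v] by linarith
        done
    qed (simp add: eqs)
  next
    case (3 s' a' t')
    then have "s' 2 = s 11" by (auto simp: I_def same_except_def)
    then show ?case using 3(1) by (simp add: I_def)
  qed
qed

text \<open>Each cell of array \<open>0\<close> is cleared after its value has been read: from here
  on this array no longer holds the input but the output bits, which have to start as zero.\<close>

definition scale_code :: "nat \<Rightarrow> com" where
  "scale_code src = While (Less (V 2) (V 0))
     (Upd 15 (V 2) (Modulo (Times (Arr src (V 2)) (V 4)) (V 0)) ;;
      Upd 0 (V 2) (N 0) ;;
      Assign 2 (Plus (V 2) (N 1)))"

lemma run_scale_code:
  assumes "s 2 = 1" "0 < s 0" "src \<in> {0, 15}" "2 * s 0 + 1 < B"
    and bnd: "\<And>i. 1 \<le> i \<Longrightarrow> i < s 0 \<Longrightarrow> a src i * s 4 < B"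
  shows "run B (scale_code src) s a t (\<lambda>s' a' t'.
     same_except {2} s s' \<and> same_except {0, 15} a a' \<and> t' \<le> t + 4 * s 0 + 1 \<and>
     (\<forall>i. a' 15 i = (if 1 \<le> i \<and> i < s 0 then a src i * s 4 mod s 0 else a 15 i)) \<and>
     (\<forall>i. a' 0 i = (if 1 \<le> i \<and> i < s 0 then 0 else a 0 i)))"
proof -
  define I where "I = (\<lambda>(s'::vars) (a'::arrays) (t'::nat).
    same_except {2} s s' \<and> same_except {0, 15} a a' \<and> 1 \<le> s' 2 \<and> s' 2 \<le> s 0 \<and> t' \<le> t + 4 * (s' 2 - 1) \<and>
     (\<forall>i. a' 15 i = (if 1 \<le> i \<and> i < s' 2 then a src i * s 4 mod s 0 else a 15 i)) \<and>
     (\<forall>i. a' 0 i = (if 1 \<le> i \<and> i < s' 2 then 0 else a 0 i)))"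
  show ?thesis unfolding scale_code_def
  proof (rule run_While[where M = "\<lambda>s' a'. s 0 - s' 2" and I = I], goal_cases)
    case 1
    show ?case using assms by (auto simp: I_def)
  next
    case (2 s' a' t')
    then have I: "same_except {2} s s'" "same_except {0, 15} a a'" "1 \<le> s' 2" "s' 2 \<le> s 0" "t' \<le> t + 4 * (s' 2 - 1)"
     "\<forall>i. a' 15 i = (if 1 \<le> i \<and> i < s' 2 then a src i * s 4 mod s 0 else a 15 i)"
     "\<forall>i. a' 0 i = (if 1 \<le> i \<and> i < s' 2 then 0 else a 0 i)"
      by (simp_all add: I_def)
    have eqs: "s' 0 = s 0" "s' 4 = s 4"
      using I(1) by (auto simp: same_except_def)
    have src: "a' src (s' 2) = a src (s' 2)" using assms(3) I(6,7) by auto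
    show ?case
    proof (cases "s' 2 < s 0")
      case True
      have "a src (s' 2) * s 4 < B" using bnd True I by simp
      moreover have "t' + 4 \<le> t + 4 * s' 2" using I(3,5) by linarith
      ultimately show ?thesis
        using True I(1-4) assms(4)
        by (auto simp add: eqs I_def src I(6,7) less_Suc_eq)
    qed (simp add: eqs)
  next
    case (3 s' a' t')
    then have "s' 2 = s 0" by (auto simp: I_def same_except_def)
    then show ?case using 3(1) by (auto simp: I_def)
  qed
qed

section \<open>Choosing elements for a reachable target\<close>

definition base_code :: com where
  "base_code = While (Less (V 2) (V 9))
     (If (Eq (Arr 15 (V 2)) (N 1))
        (If (Less (N 0) (V 22)) (Upd 0 (V 2) (N 1) ;; Assign 22 (Minus (V 22) (N 1))) Skip) Skip ;;
      Assign 2 (Plus (V 2) (N 1)))"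

lemma run_base_code:
  assumes "s 2 \<le> s 9" "s 9 \<le> 2 * s 0" "2 * s 0 + 1 < B" "s 22 \<le> occ (a 15) (s 2) (s 9) 1"
  shows "run B base_code s a t (\<lambda>s' a' t'.
     same_except {2, 22} s s' \<and> same_except {0} a a' \<and> t' \<le> t + 6 * (s 9 - s 2) + 1 \<and>
     (\<exists>T. T \<subseteq> {i \<in> {s 2..<s 9}. a 15 i = 1} \<and> card T = s 22 \<and> a' 0 = (\<lambda>i. if i \<in> T then 1 else a 0 i)))"
proof -
  \<comment> \<open>As long as part of the target remains, every \<open>1\<close> seen so far has
    been used; therefore the target cannot outlast a supply of at least \<open>s 22\<close>
    ones.\<close>
  define I where "I = (\<lambda>(s'::vars) (a'::arrays) (t'::nat).
    same_except {2, 22} s s' \<and> same_except {0} a a' \<and> s 2 \<le> s' 2 \<and> s' 2 \<le> s 9 \<and> t' \<le> t + 6 * (s' 2 - s 2) \<and>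
     (\<exists>T. T \<subseteq> {i \<in> {s 2..<s' 2}. a 15 i = 1} \<and> card T + s' 22 = s 22 \<and>
       (0 < s' 22 \<longrightarrow> T = {i \<in> {s 2..<s' 2}. a 15 i = 1}) \<and> a' 0 = (\<lambda>i. if i \<in> T then 1 else a 0 i)))"
  show ?thesis unfolding base_code_def
  proof (rule run_While[where M = "\<lambda>s' a'. s 9 - s' 2" and I = I], goal_cases)
    case 1
    show ?case unfolding I_def using assms by (intro conjI exI[of _ "{}"]) auto
  next
    case (2 s' a' t')
    obtain T where I: "same_except {2, 22} s s'" "same_except {0} a a'" "s 2 \<le> s' 2" "s' 2 \<le> s 9"
      "t' \<le> t + 6 * (s' 2 - s 2)"
      and T: "T \<subseteq> {i \<in> {s 2..<s' 2}. a 15 i = 1}" "card T + s' 22 = s 22"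
       "0 < s' 22 \<longrightarrow> T = {i \<in> {s 2..<s' 2}. a 15 i = 1}" "a' 0 = (\<lambda>i. if i \<in> T then 1 else a 0 i)"
      using 2 unfolding I_def by (elim exE conjE) (rule that)
    have eqs: "s' 0 = s 0" "s' 9 = s 9" "a' 15 = a 15"
      using I(1,2) by (auto simp: same_except_def)
    show ?case
    proof (cases "s' 2 < s 9")
      case True
      have ix: "s' 2 < 2 * s 0" "Suc (s' 2) < B" using True assms by linarith+
      have tt: "t' + 6 \<le> t + 6 * (Suc (s' 2) - s 2)" using I by linarith
      have ms: "s 9 - Suc (s' 2) < s 9 - s' 2" using True by simp
      have fin: "finite T" using T(1) finite_subset by fastforce
      have ins: "{i \<in> {s 2..<Suc (s' 2)}. a 15 i = 1} = (if a 15 (s' 2) = 1 then insert (s' 2) {i \<in> {s 2..<s' 2}. a 15 i = 1}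
        else {i \<in> {s 2..<s' 2}. a 15 i = 1})" using I(3) by (auto simp: less_Suc_eq)
      show ?thesis
      proof (cases "a 15 (s' 2) = 1 \<and> 0 < s' 22")
        case c: True
        have "s' 2 \<notin> T" using T(1) by auto
        then have "\<exists>T. T \<subseteq> {i \<in> {s 2..<Suc (s' 2)}. a 15 i = 1} \<and> card T + (s' 22 - 1) = s 22 \<and>
          (0 < s' 22 - 1 \<longrightarrow> T = {i \<in> {s 2..<Suc (s' 2)}. a 15 i = 1}) \<and>
          (a' 0)(s' 2 := 1) = (\<lambda>i. if i \<in> T then 1 else a 0 i)"
          using T c fin unfolding ins by (intro exI[of _ "insert (s' 2) T"]) auto
        then show ?thesis using True c ix tt I by (simp add: eqs I_def)
      next
        case c: False
        have "\<exists>T. T \<subseteq> {i \<in> {s 2..<Suc (s' 2)}. a 15 i = 1} \<and> card T + s' 22 = s 22 \<and>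
          (0 < s' 22 \<longrightarrow> T = {i \<in> {s 2..<Suc (s' 2)}. a 15 i = 1}) \<and>
          a' 0 = (\<lambda>i. if i \<in> T then 1 else a 0 i)"
          using T c unfolding ins by (intro exI[of _ T]) auto
        then show ?thesis using True c ix tt I ms by (cases "s' 22 = 0") (simp_all add: eqs I_def)
      qed
    qed (simp add: eqs)
  next
    case (3 s' a' t')
    then have e: "s' 2 = s 9" by (auto simp: I_def same_except_def)
    obtain T where T: "T \<subseteq> {i \<in> {s 2..<s 9}. a 15 i = 1}" "card T + s' 22 = s 22"
       "0 < s' 22 \<longrightarrow> T = {i \<in> {s 2..<s 9}. a 15 i = 1}" "a' 0 = (\<lambda>i. if i \<in> T then 1 else a 0 i)"
      using 3(1) unfolding I_def e by (elim exE conjE) (rule that)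
    have "s' 22 = 0"
      using T(2,3) assms(4) unfolding occ_def by (cases "s' 22 = 0") auto
    then show ?case using 3(1) T(1,2,4) unfolding I_def e by (intro conjI exI[of _ T]) auto
  qed
qed

text \<open>The elements recorded along a chain of predecessors strictly decrease, so one downward
  pass over the indices meets all of them in turn, and none is used twice.\<close>

definition read_code :: com where
  "read_code = While (Less (N 1) (V 20))
     (Assign 20 (Minus (V 20) (N 1)) ;;
      If (Eq (Arr 11 (V 22)) (V 20))
        (Upd 0 (V 20) (N 1) ;; Assign 22 (Modulo (Minus (Plus (V 22) (V 0)) (Arr 15 (V 20))) (V 0))) Skip)"

lemma cong_sub_key:
  assumes "x < p" "k < (p::nat)"
  shows "[k + (x + p - k) mod p = x] (mod p)"
proof -
  have "[k + (x + p - k) mod p = k + (x + p - k)] (mod p)" by (simp add: cong_def mod_simps)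
  also have "k + (x + p - k) = x + p" using assms by simp
  also have "[x + p = x] (mod p)" by (simp add: cong_def)
  finally show ?thesis .
qed

lemma run_read_code:
  assumes "s 22 < s 0" "s 20 = s 0" "2 * s 0 + 1 < B"
    and par: "\<And>y. y < s 0 \<Longrightarrow> a 11 y \<noteq> s 0 \<Longrightarrow> 1 \<le> a 11 y \<and> a 11 y < s 0 \<and> a 15 (a 11 y) \<noteq> 1 \<and>
       a 15 (a 11 y) < s 0 \<and> (a 11 ((y + s 0 - a 15 (a 11 y)) mod s 0) = s 0 \<or>
         a 11 ((y + s 0 - a 15 (a 11 y)) mod s 0) < a 11 y)"
  shows "run B read_code s a t (\<lambda>s' a' t'.
     same_except {20, 22} s s' \<and> same_except {0} a a' \<and> t' \<le> t + 5 * s 0 + 1 \<and> s' 22 < s 0 \<and> a 11 (s' 22) = s 0 \<and>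
     (\<exists>T. T \<subseteq> {i \<in> {1..<s 0}. a 15 i \<noteq> 1} \<and> [(\<Sum>i\<in>T. a 15 i) + s' 22 = s 22] (mod s 0) \<and>
        a' 0 = (\<lambda>i. if i \<in> T then 1 else a 0 i)))"
proof -
  define I where "I = (\<lambda>(s'::vars) (a'::arrays) (t'::nat).
     same_except {20, 22} s s' \<and> same_except {0} a a' \<and> 1 \<le> s' 20 \<and> s' 20 \<le> s 0 \<and>
     t' + 5 * s' 20 \<le> t + 5 * s 0 \<and> s' 22 < s 0 \<and>
     (a 11 (s' 22) = s 0 \<or> a 11 (s' 22) < s' 20) \<and>
     (\<exists>T. T \<subseteq> {i \<in> {s' 20..<s 0}. a 15 i \<noteq> 1} \<and> [(\<Sum>i\<in>T. a 15 i) + s' 22 = s 22] (mod s 0) \<and>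
        a' 0 = (\<lambda>i. if i \<in> T then 1 else a 0 i)))"
  show ?thesis unfolding read_code_def
  proof (rule run_While[where M = "\<lambda>s' a'. s' 20" and I = I], goal_cases)
    case 1
    show ?case unfolding I_def using assms par[of "s 22"] by (intro conjI exI[of _ "{}"]) auto
  next
    case (2 s' a' t')
    obtain T where I: "same_except {20, 22} s s'" "same_except {0} a a'" "1 \<le> s' 20" "s' 20 \<le> s 0"
     "t' + 5 * s' 20 \<le> t + 5 * s 0" "s' 22 < s 0" "a 11 (s' 22) = s 0 \<or> a 11 (s' 22) < s' 20"
     and T: "T \<subseteq> {i \<in> {s' 20..<s 0}. a 15 i \<noteq> 1}" "[(\<Sum>i\<in>T. a 15 i) + s' 22 = s 22] (mod s 0)"
        "a' 0 = (\<lambda>i. if i \<in> T then 1 else a 0 i)"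
      using 2 unfolding I_def by (elim exE conjE) (rule that)
    have eqs: "s' 0 = s 0" "a' 15 = a 15" "a' 11 = a 11"
      using I(1,2) by (auto simp: same_except_def)
    show ?case
    proof (cases "1 < s' 20")
      case True
      define j where "j = s' 20 - 1"
      have j: "s' 20 = Suc j" "1 \<le> j" "j < s 0" using True I(4) by (auto simp: j_def)
      have fin: "finite T" using T(1) finite_subset by fastforce
      have nj: "j \<notin> T" using T(1) j by auto
      show ?thesis
      proof (cases "a 11 (s' 22) = j")
        case c: True
        let ?x = "(s' 22 + s 0 - a 15 j) mod s 0"
        have pj: "a 15 j \<noteq> 1" "a 15 j < s 0" "a 11 ?x = s 0 \<or> a 11 ?x < j"
          using par[of "s' 22"] c j I(6) by auto
        have "[(\<Sum>i\<in>insert j T. a 15 i) + ?x = (\<Sum>i\<in>T. a 15 i) + (a 15 j + ?x)] (mod s 0)"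
          using fin nj by (simp add: ac_simps)
        also have "[(\<Sum>i\<in>T. a 15 i) + (a 15 j + ?x) = (\<Sum>i\<in>T. a 15 i) + s' 22] (mod s 0)"
          using cong_sub_key[OF I(6) pj(2)] by (rule cong_add[OF cong_refl])
        also note T(2)
        finally have "\<exists>T. T \<subseteq> {i \<in> {j..<s 0}. a 15 i \<noteq> 1} \<and> [(\<Sum>i\<in>T. a 15 i) + ?x = s 22] (mod s 0) \<and>
          (a' 0)(j := 1) = (\<lambda>i. if i \<in> T then 1 else a 0 i)"
          using T(1,3) j pj by (intro exI[of _ "insert j T"]) (auto simp: subset_iff)
        then show ?thesis using c j I pj assms(3) by (simp add: eqs I_def)
      next
        case c: False
        have "\<exists>T. T \<subseteq> {i \<in> {j..<s 0}. a 15 i \<noteq> 1} \<and> [(\<Sum>i\<in>T. a 15 i) + s' 22 = s 22] (mod s 0) \<and>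
          a' 0 = (\<lambda>i. if i \<in> T then 1 else a 0 i)"
          using T j by (intro exI[of _ T]) (auto simp: subset_iff)
        then show ?thesis using c j I assms(3) by (auto simp add: eqs I_def)
      qed
    qed (use assms(3) in \<open>simp add: eqs\<close>)
  next
    case (3 s' a' t')
    then have e: "s' 20 = 1" by (auto simp: I_def same_except_def)
    have "a 11 (s' 22) = s 0"
      using 3(1) par[of "s' 22"] by (auto simp: I_def e)
    then show ?case using 3(1) by (auto simp: I_def e)
  qed
qed

text \<open>Whichever part of a pair is used, it contributes at least the smaller key. These keys
  are taken off the target once and for all, after which a node offers the choice between
  \<open>0\<close> and its difference.\<close>

definition off_code :: com where
  "off_code = While (Less (V 2) (V 6))
     (Assign 22 (Modulo (Minus (Plus (V 22) (V 0)) (Arr 15 (Arr 2 (V 2)))) (V 0)) ;;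
      Assign 2 (Plus (V 2) (N 1)))"

lemma run_off_code:
  assumes "s 2 \<le> s 6" "s 6 \<le> 2 * s 0" "2 * s 0 + 1 < B" "s 22 < s 0"
    and lo: "\<And>i. s 2 \<le> i \<Longrightarrow> i < s 6 \<Longrightarrow> a 2 i < 2 * s 0 \<and> a 15 (a 2 i) < s 0"
  shows "run B off_code s a t (\<lambda>s' a' t'.
     same_except {2, 22} s s' \<and> a' = a \<and> t' \<le> t + 3 * (s 6 - s 2) + 1 \<and> s' 22 < s 0 \<and>
     [(\<Sum>i\<in>{s 2..<s 6}. a 15 (a 2 i)) + s' 22 = s 22] (mod s 0))"
proof -
  define I where "I = (\<lambda>(s'::vars) (a'::arrays) (t'::nat).
     same_except {2, 22} s s' \<and> a' = a \<and> s 2 \<le> s' 2 \<and> s' 2 \<le> s 6 \<and> t' \<le> t + 3 * (s' 2 - s 2) \<and> s' 22 < s 0 \<and>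
     [(\<Sum>i\<in>{s 2..<s' 2}. a 15 (a 2 i)) + s' 22 = s 22] (mod s 0))"
  show ?thesis unfolding off_code_def
  proof (rule run_While[where M = "\<lambda>s' a'. s 6 - s' 2" and I = I], goal_cases)
    case 1
    show ?case using assms by (auto simp: I_def)
  next
    case (2 s' a' t')
    then have I: "same_except {2, 22} s s'" "a' = a" "s 2 \<le> s' 2" "s' 2 \<le> s 6" "t' \<le> t + 3 * (s' 2 - s 2)" "s' 22 < s 0"
     "[(\<Sum>i\<in>{s 2..<s' 2}. a 15 (a 2 i)) + s' 22 = s 22] (mod s 0)"
      by (auto simp: I_def)
    have eqs: "s' 0 = s 0" "s' 6 = s 6"
      using I(1) by (auto simp: same_except_def)
    show ?case
    proof (cases "s' 2 < s 6")
      case True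
      let ?k = "a 15 (a 2 (s' 2))"
      let ?x = "(s' 22 + s 0 - ?k) mod s 0"
      have l: "a 2 (s' 2) < 2 * s 0" "?k < s 0" using lo True I by auto
      have ix: "s' 2 < 2 * s 0" "Suc (s' 2) < B" using True assms by linarith+
      have tt: "t' + 3 \<le> t + 3 * (Suc (s' 2) - s 2)" using I by linarith
      have "[(\<Sum>i\<in>{s 2..<Suc (s' 2)}. a 15 (a 2 i)) + ?x = (\<Sum>i\<in>{s 2..<s' 2}. a 15 (a 2 i)) + (?k + ?x)] (mod s 0)"
        using I(3) by (simp add: atLeastLessThanSuc ac_simps)
      also have "[(\<Sum>i\<in>{s 2..<s' 2}. a 15 (a 2 i)) + (?k + ?x) = (\<Sum>i\<in>{s 2..<s' 2}. a 15 (a 2 i)) + s' 22] (mod s 0)"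
        using cong_sub_key[OF I(6) l(2)] by (rule cong_add[OF cong_refl])
      also note I(7)
      finally show ?thesis using True l ix tt I assms(3) by (simp add: eqs I_def del: sum.op_ivl_Suc)
    qed (simp add: eqs)
  next
    case (3 s' a' t')
    then have e: "s' 2 = s 6" by (auto simp: I_def same_except_def)
    then show ?case using 3(1) by (auto simp: I_def)
  qed
qed

text \<open>Works for keys in any order: a node is skipped only if the target is below its key,
  hence below the length of the interval, and then the interval alone covers the rest.\<close>

definition greedy_code :: com where
  "greedy_code = While (Less (V 23) (V 2))
     (Assign 2 (Minus (V 2) (N 1)) ;;
      If (Less (V 22) (Arr 15 (V 2))) Skip
        (Upd 0 (V 2) (N 1) ;; Assign 22 (Minus (V 22) (Arr 15 (V 2)))))"

lemma run_greedy_code: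
  assumes "s 23 \<le> s 2" "s 2 \<le> 2 * s 0" "2 * s 0 + 1 < B"
    and key: "\<And>i. s 23 \<le> i \<Longrightarrow> i < s 2 \<Longrightarrow> a 15 i \<le> base"
    and tot: "s 22 \<le> base + (\<Sum>i\<in>{s 23..<s 2}. a 15 i)"
  shows "run B greedy_code s a t (\<lambda>s' a' t'.
     same_except {2, 22} s s' \<and> same_except {0} a a' \<and> t' \<le> t + 5 * (s 2 - s 23) + 1 \<and> s' 22 \<le> base \<and>
     (\<exists>T. T \<subseteq> {s 23..<s 2} \<and> (\<Sum>i\<in>T. a 15 i) + s' 22 = s 22 \<and> a' 0 = (\<lambda>i. if i \<in> T then 1 else a 0 i)))"
proof -
  define I where "I = (\<lambda>(s'::vars) (a'::arrays) (t'::nat).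
     same_except {2, 22} s s' \<and> same_except {0} a a' \<and> s 23 \<le> s' 2 \<and> s' 2 \<le> s 2 \<and>
     t' + 5 * s' 2 \<le> t + 5 * s 2 \<and> s' 22 \<le> base + (\<Sum>i\<in>{s 23..<s' 2}. a 15 i) \<and>
     (\<exists>T. T \<subseteq> {s' 2..<s 2} \<and> (\<Sum>i\<in>T. a 15 i) + s' 22 = s 22 \<and> a' 0 = (\<lambda>i. if i \<in> T then 1 else a 0 i)))"
  show ?thesis unfolding greedy_code_def
  proof (rule run_While[where M = "\<lambda>s' a'. s' 2" and I = I], goal_cases)
    case 1
    show ?case unfolding I_def using assms by (intro conjI exI[of _ "{}"]) auto
  next
    case (2 s' a' t')
    obtain T where I: "same_except {2, 22} s s'" "same_except {0} a a'" "s 23 \<le> s' 2" "s' 2 \<le> s 2"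
     "t' + 5 * s' 2 \<le> t + 5 * s 2" "s' 22 \<le> base + (\<Sum>i\<in>{s 23..<s' 2}. a 15 i)"
     and T: "T \<subseteq> {s' 2..<s 2}" "(\<Sum>i\<in>T. a 15 i) + s' 22 = s 22" "a' 0 = (\<lambda>i. if i \<in> T then 1 else a 0 i)"
      using 2 unfolding I_def by (elim exE conjE) (rule that)
    have eqs: "s' 0 = s 0" "s' 23 = s 23" "a' 15 = a 15"
      using I(1,2) by (auto simp: same_except_def)
    show ?case
    proof (cases "s 23 < s' 2")
      case True
      define j where "j = s' 2 - 1"
      have j: "s' 2 = Suc j" "s 23 \<le> j" "j < s 2" using True I(4) by (auto simp: j_def)
      have fin: "finite T" using T(1) finite_subset by fastforce
      have nj: "j \<notin> T" using T(1) j by auto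
      have kb: "a 15 j \<le> base" using key j by simp
      have sm: "s' 22 \<le> base + (\<Sum>i\<in>{s 23..<j}. a 15 i) + a 15 j" using I(6) j by simp
      show ?thesis
      proof (cases "s' 22 < a 15 j")
        case c: False
        have "\<exists>T. T \<subseteq> {j..<s 2} \<and> (\<Sum>i\<in>T. a 15 i) + (s' 22 - a 15 j) = s 22 \<and>
          (a' 0)(j := 1) = (\<lambda>i. if i \<in> T then 1 else a 0 i)"
          using T j fin nj c by (intro exI[of _ "insert j T"]) (auto simp: subset_iff)
        then show ?thesis using c j I(1-5) sm assms(2,3) by (simp add: eqs I_def)
      next
        case c: True
        have "\<exists>T. T \<subseteq> {j..<s 2} \<and> (\<Sum>i\<in>T. a 15 i) + s' 22 = s 22 \<and>
          a' 0 = (\<lambda>i. if i \<in> T then 1 else a 0 i)"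
          using T j by (intro exI[of _ T]) (auto simp: subset_iff)
        then show ?thesis using c j I(1-5) kb assms(2,3) by (simp add: eqs I_def)
      qed
    qed (use assms(3) in \<open>simp add: eqs\<close>)
  next
    case (3 s' a' t')
    then have e: "s' 2 = s 23" by (auto simp: I_def same_except_def)
    then show ?case using 3(1) by (auto simp: I_def)
  qed
qed

section \<open>Pairing\<close>

text \<open>
  Node \<open>i\<close> with bit \<open>b\<close> passes the bit \<open>b\<close> to \<open>hi i\<close> and \<open>1 - b\<close> to \<open>lo i\<close>, hence contributes
  \<open>key (lo i) + b * key i\<close>.
\<close>

definition forest :: "nat \<Rightarrow> nat \<Rightarrow> (nat \<Rightarrow> nat) \<Rightarrow> (nat \<Rightarrow> nat) \<Rightarrow> (nat \<Rightarrow> nat) \<Rightarrow> bool" where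
  "forest p n lo hi key \<longleftrightarrow> (\<forall>i\<in>{p..<n}. 1 \<le> lo i \<and> lo i < i \<and> 1 \<le> hi i \<and> hi i < i \<and> lo i \<noteq> hi i \<and>
     [key i + key (lo i) = key (hi i)] (mod p) \<and>
     (\<forall>j\<in>{p..<n}. j \<noteq> i \<longrightarrow> lo i \<noteq> lo j \<and> lo i \<noteq> hi j \<and> hi i \<noteq> hi j))"

lemma sum_upd_mult:
  fixes b key :: "nat \<Rightarrow> nat"
  assumes "finite A" "x \<in> A" "b x = 0"
  shows "(\<Sum>i\<in>A. (b(x := v)) i * key i) = (\<Sum>i\<in>A. b i * key i) + v * key x"
proof -
  have "(\<Sum>i\<in>A - {x}. (b(x := v)) i * key i) = (\<Sum>i\<in>A - {x}. b i * key i)"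
    by (rule sum.cong) auto
  then show ?thesis using assms by (simp add: sum.remove[of A x])
qed

text \<open>Together with its offset a node is worth \<open>key (lo j) + b j * key j\<close>, which
  modulo \<open>p\<close> is the key of the part that receives the bit \<open>1\<close>. Hence
  replacing a node by its parts does not change the represented sum.\<close>

lemma push_step:
  fixes b key lo hi :: "nat \<Rightarrow> nat"
  assumes "1 \<le> lo j" "lo j < j" "1 \<le> hi j" "hi j < j" "lo j \<noteq> hi j" "p \<le> j" "1 \<le> j"
    and c: "[key j + key (lo j) = key (hi j)] (mod p)" and "b j \<le> 1" "b (lo j) = 0" "b (hi j) = 0"
  shows "[(\<Sum>i\<in>{1..<j}. (b(hi j := b j, lo j := 1 - b j)) i * key i) + (\<Sum>i\<in>{p..<j}. key (lo i)) =
     (\<Sum>i\<in>{1..<Suc j}. b i * key i) + (\<Sum>i\<in>{p..<Suc j}. key (lo i))] (mod p)"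
proof -
  have "(\<Sum>i\<in>{1..<j}. (b(hi j := b j, lo j := 1 - b j)) i * key i) =
     (\<Sum>i\<in>{1..<j}. (b(hi j := b j)) i * key i) + (1 - b j) * key (lo j)"
    using assms by (intro sum_upd_mult) auto
  also have "(\<Sum>i\<in>{1..<j}. (b(hi j := b j)) i * key i) = (\<Sum>i\<in>{1..<j}. b i * key i) + b j * key (hi j)"
    using assms by (intro sum_upd_mult) auto
  finally have e: "(\<Sum>i\<in>{1..<j}. (b(hi j := b j, lo j := 1 - b j)) i * key i) =
     (\<Sum>i\<in>{1..<j}. b i * key i) + (b j * key (hi j) + (1 - b j) * key (lo j))" by (simp only: add.assoc)
  have "[b j * key (hi j) + (1 - b j) * key (lo j) = b j * key j + key (lo j)] (mod p)"
  proof (cases "b j = 0")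
    case False
    then have "b j = 1" using assms by simp
    then show ?thesis using c by (simp add: cong_sym)
  qed simp
  then have "[(\<Sum>i\<in>{1..<j}. b i * key i) + (b j * key (hi j) + (1 - b j) * key (lo j)) + (\<Sum>i\<in>{p..<j}. key (lo i)) =
    (\<Sum>i\<in>{1..<j}. b i * key i) + (b j * key j + key (lo j)) + (\<Sum>i\<in>{p..<j}. key (lo i))] (mod p)"
    by (rule cong_add[OF cong_add[OF cong_refl] cong_refl])
  then show ?thesis unfolding e using assms by (simp add: add_ac)
qed

definition push_code :: com where
  "push_code = While (Less (V 0) (V 2))
     (Assign 2 (Minus (V 2) (N 1)) ;;
      Upd 0 (Arr 3 (V 2)) (Arr 0 (V 2)) ;;
      Upd 0 (Arr 2 (V 2)) (Minus (N 1) (Arr 0 (V 2))))"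

lemma run_push_code:
  assumes "s 0 \<le> s 2" "s 2 \<le> 2 * s 0" "2 * s 0 + 1 < B" "1 \<le> s 0"
    and forest: "forest (s 0) (s 2) (a 2) (a 3) (a 15)"
    and bits: "\<And>i. 1 \<le> i \<Longrightarrow> i < s 2 \<Longrightarrow> a 0 i \<le> 1"
      "\<And>i. s 0 \<le> i \<Longrightarrow> i < s 2 \<Longrightarrow> a 0 (a 2 i) = 0 \<and> a 0 (a 3 i) = 0"
  shows "run B push_code s a t (\<lambda>s' a' t'.
     same_except {2} s s' \<and> same_except {0} a a' \<and> t' \<le> t + 4 * (s 2 - s 0) + 1 \<and>
     (\<forall>i\<in>{1..<s 0}. a' 0 i \<le> 1) \<and>
     [(\<Sum>i\<in>{1..<s 0}. a' 0 i * a 15 i) =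
       (\<Sum>i\<in>{1..<s 2}. a 0 i * a 15 i) + (\<Sum>i\<in>{s 0..<s 2}. a 15 (a 2 i))] (mod s 0))"
proof -
  define Q where "Q = (\<lambda>b k. (\<Sum>i\<in>{1..<k}. b i * a 15 i) + (\<Sum>i\<in>{s 0..<k}. a 15 (a 2 i)))"
  define I where "I = (\<lambda>(s'::vars) (a'::arrays) (t'::nat).
     same_except {2} s s' \<and> same_except {0} a a' \<and> s 0 \<le> s' 2 \<and> s' 2 \<le> s 2 \<and> t' + 4 * s' 2 \<le> t + 4 * s 2 \<and>
     (\<forall>i\<in>{1..<s' 2}. a' 0 i \<le> 1) \<and> (\<forall>i\<in>{s 0..<s' 2}. a' 0 (a 2 i) = 0 \<and> a' 0 (a 3 i) = 0) \<and>
     [Q (a' 0) (s' 2) = Q (a 0) (s 2)] (mod s 0))"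
  show ?thesis unfolding push_code_def
  proof (rule run_While[where M = "\<lambda>s' a'. s' 2" and I = I], goal_cases)
    case 1
    show ?case unfolding I_def using assms by auto
  next
    case (2 s' a' t')
    then have I: "same_except {2} s s'" "same_except {0} a a'" "s 0 \<le> s' 2" "s' 2 \<le> s 2" "t' + 4 * s' 2 \<le> t + 4 * s 2"
     "\<forall>i\<in>{1..<s' 2}. a' 0 i \<le> 1" "\<forall>i\<in>{s 0..<s' 2}. a' 0 (a 2 i) = 0 \<and> a' 0 (a 3 i) = 0"
     "[Q (a' 0) (s' 2) = Q (a 0) (s 2)] (mod s 0)"
      by (simp_all add: I_def)
    have eqs: "s' 0 = s 0" "a' 2 = a 2" "a' 3 = a 3"
      using I(1,2) by (auto simp: same_except_def)
    show ?case
    proof (cases "s 0 < s' 2")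
      case True
      define j where "j = s' 2 - 1"
      have j: "s' 2 = Suc j" "s 0 \<le> j" "j < s 2" "1 \<le> j" using True I(4) assms(4) by (auto simp: j_def)
      let ?l = "a 2 j" and ?h = "a 3 j" and ?b = "a' 0 j"
      have f: "1 \<le> ?l" "?l < j" "1 \<le> ?h" "?h < j" "?l \<noteq> ?h" "[a 15 j + a 15 ?l = a 15 ?h] (mod s 0)"
        and fd: "\<And>i. s 0 \<le> i \<Longrightarrow> i < j \<Longrightarrow> ?l \<noteq> a 2 i \<and> ?l \<noteq> a 3 i \<and> ?h \<noteq> a 2 i \<and> ?h \<noteq> a 3 i"
      proof -
        have F: "1 \<le> a 2 i \<and> a 2 i < i \<and> 1 \<le> a 3 i \<and> a 3 i < i \<and> a 2 i \<noteq> a 3 i \<and>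
           [a 15 i + a 15 (a 2 i) = a 15 (a 3 i)] (mod s 0) \<and>
           (\<forall>j\<in>{s 0..<s 2}. j \<noteq> i \<longrightarrow> a 2 i \<noteq> a 2 j \<and> a 2 i \<noteq> a 3 j \<and> a 3 i \<noteq> a 3 j)"
          if "i \<in> {s 0..<s 2}" for i using forest that unfolding forest_def by (rule bspec)
        show "1 \<le> ?l" "?l < j" "1 \<le> ?h" "?h < j" "?l \<noteq> ?h" "[a 15 j + a 15 ?l = a 15 ?h] (mod s 0)"
          using F[of j] j by auto
        show "?l \<noteq> a 2 i \<and> ?l \<noteq> a 3 i \<and> ?h \<noteq> a 2 i \<and> ?h \<noteq> a 3 i" if "s 0 \<le> i" "i < j" for i
          using F[of j] F[of i] j that by fastforce
      qed
      have b: "?b \<le> 1" "a' 0 ?l = 0" "a' 0 ?h = 0" using I j by auto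
      let ?b' = "(a' 0)(?h := ?b, ?l := 1 - ?b)"
      have "[Q ?b' j = Q (a' 0) (Suc j)] (mod s 0)"
        unfolding Q_def using push_step[of "a 2" j "a 3" "s 0" "a 15" "a' 0"] f b j by blast
      then have "[Q ?b' j = Q (a 0) (s 2)] (mod s 0)" using I(8) j cong_trans by metis
      moreover have "\<forall>i\<in>{1..<j}. ?b' i \<le> 1" using I(6) j b by auto
      \<comment> \<open>Parts of different nodes are different, so the parts of the nodes still to
        be expanded keep their zero bits.\<close>
      moreover have "\<forall>i\<in>{s 0..<j}. ?b' (a 2 i) = 0 \<and> ?b' (a 3 i) = 0"
      proof
        fix i assume i: "i \<in> {s 0..<j}"
        then have "a' 0 (a 2 i) = 0 \<and> a' 0 (a 3 i) = 0" using I(7) j by auto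
        moreover have "a 2 i \<noteq> ?l \<and> a 3 i \<noteq> ?l \<and> a 2 i \<noteq> ?h \<and> a 3 i \<noteq> ?h"
          using fd[of i] i by auto
        ultimately show "?b' (a 2 i) = 0 \<and> ?b' (a 3 i) = 0" by simp
      qed
      moreover have "t' + 4 + 4 * j \<le> t + 4 * s 2" using I(5) j by simp
      ultimately have "I (s'(2 := j)) (a'(0 := ?b')) (Suc (Suc (Suc (Suc t'))))"
        using I(1,2) j unfolding I_def by simp
      moreover have "j \<noteq> ?h" "j < 2 * s 0" "?l < 2 * s 0" "?h < 2 * s 0" using f j assms by auto
      ultimately show ?thesis using j assms(3,4) b by (simp add: eqs)
    qed (simp add: eqs)
  next
    case (3 s' a' t')
    then have e: "s' 2 = s 0" by (auto simp: I_def same_except_def)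
    then show ?case using 3(1) by (auto simp: I_def Q_def)
  qed
qed

section \<open>Majority-vote pairing inside windows\<close>

fun chain :: "(nat \<Rightarrow> nat) \<Rightarrow> nat \<Rightarrow> nat list \<Rightarrow> bool" where
  "chain f h [] \<longleftrightarrow> h = 0"
| "chain f h (x # xs) \<longleftrightarrow> h = x \<and> x \<noteq> 0 \<and> chain f (f x) xs"

lemma chain_upd: "x \<notin> set xs \<Longrightarrow> chain (f(x := v)) h xs \<longleftrightarrow> chain f h xs"
  by (induction xs arbitrary: h) auto

text \<open>Numbers the classes of keys that share both a window of length \<open>W\<close> and a
  residue modulo \<open>q\<close>. Two different keys of one class differ by a multiple of
  \<open>q\<close> that is less than \<open>W\<close>.\<close>

definition stream :: "nat \<Rightarrow> nat \<Rightarrow> nat \<Rightarrow> nat" where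
  "stream q W k = q * (k div W) + k mod q"

lemma stream_diff:
  assumes "stream q W k = stream q W l" "k < l" "0 < q" "0 < W"
  shows "q \<le> l - k" "l - k < W"
proof -
  \<comment> \<open>Read in base \<open>q\<close>, the number of a stream gives back the window and
    the residue.\<close>
  have "stream q W m div q = m div W" "stream q W m mod q = m mod q" for m
    using assms(3) by (auto simp: stream_def)
  then have dw: "k div W = l div W" and mq: "k mod q = l mod q" using assms(1) by metis+
  have "q dvd l - k" using mq assms(2) mod_eq_dvd_iff_nat[of k l q] by simp
  then show "q \<le> l - k" using assms(2) by (simp add: dvd_imp_le)
  have "k = W * (l div W) + k mod W" "l = W * (l div W) + l mod W" "l mod W < W"
    using dw assms(4) mult_div_mod_eq[of W k] by auto
  then show "l - k < W" by linarith
qed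

text \<open>
  Majority-vote pairing: in every stream all pending items carry the same key, so a stream never
  holds more pending items than the largest multiplicity of a key.
\<close>

locale pinv =
  fixes It :: "nat set" and key :: "nat \<Rightarrow> nat" and q W n0 M i n :: nat
    and nxt head lo hi ky :: "nat \<Rightarrow> nat" and L :: "nat \<Rightarrow> nat list"
  assumes n: "n0 \<le> n"
    and ky: "x < n0 \<Longrightarrow> ky x = key x"
    and chain: "c < M \<Longrightarrow> chain nxt (head c) (L c)"
    and distinct: "distinct (L c)"
    and pending: "x \<in> set (L c) \<Longrightarrow> x \<in> It \<and> x < i \<and> stream q W (key x) = c"
    and same_key: "x \<in> set (L c) \<Longrightarrow> y \<in> set (L c) \<Longrightarrow> key y = key x"
    and fresh: "x \<in> set (L c) \<Longrightarrow> n0 \<le> m \<Longrightarrow> m < n \<Longrightarrow> x \<noteq> lo m \<and> x \<noteq> hi m"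
    and child: "n0 \<le> m \<Longrightarrow> m < n \<Longrightarrow> lo m \<in> It \<and> lo m < i \<and> hi m \<in> It \<and> hi m < i \<and> lo m \<noteq> hi m"
    and diff: "n0 \<le> m \<Longrightarrow> m < n \<Longrightarrow> ky m + key (lo m) = key (hi m) \<and> q \<le> ky m \<and> ky m < W"
    and disj: "n0 \<le> m \<Longrightarrow> m < n \<Longrightarrow> n0 \<le> m' \<Longrightarrow> m' < n \<Longrightarrow> m' \<noteq> m \<Longrightarrow>
      lo m \<noteq> lo m' \<and> lo m \<noteq> hi m' \<and> hi m \<noteq> hi m'"
    and card: "card {x \<in> It. x < i} = 2 * (n - n0) + (\<Sum>c<M. length (L c))"

lemma pinv_skip:
  assumes "pinv It key q W n0 M i n nxt head lo hi ky L" "i \<notin> It"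
  shows "pinv It key q W n0 M (Suc i) n nxt head lo hi ky L"
proof -
  interpret P: pinv It key q W n0 M i n nxt head lo hi ky L by fact
  have e: "{x \<in> It. x < Suc i} = {x \<in> It. x < i}" using assms(2) by (auto simp: less_Suc_eq)
  show ?thesis
  proof
    show "x \<in> It \<and> x < Suc i \<and> stream q W (key x) = c" if "x \<in> set (L c)" for x c
      using P.pending[OF that] by simp
    show "lo m \<in> It \<and> lo m < Suc i \<and> hi m \<in> It \<and> hi m < Suc i \<and> lo m \<noteq> hi m" if "n0 \<le> m" "m < n" for m
      using P.child[OF that] by simp
  qed (fact P.n P.ky P.chain P.distinct P.same_key P.fresh P.diff P.disj P.card[folded e])+
qed

lemma card_less_Suc_mem:
  fixes i :: nat
  assumes "i \<in> It"
  shows "card {x \<in> It. x < Suc i} = Suc (card {x \<in> It. x < i})"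
proof -
  have "{x \<in> It. x < Suc i} = insert i {x \<in> It. x < i}" using assms by (auto simp: less_Suc_eq)
  then show ?thesis by simp
qed

lemma sum_length_upd:
  fixes L :: "nat \<Rightarrow> nat list"
  assumes "c < M"
  shows "(\<Sum>d<M. length ((L(c := xs)) d)) + length (L c) = (\<Sum>d<M. length (L d)) + length xs"
proof -
  have "(\<Sum>d\<in>{..<M} - {c}. length ((L(c := xs)) d)) = (\<Sum>d\<in>{..<M} - {c}. length (L d))"
    by (rule sum.cong) auto
  then show ?thesis using assms by (simp add: sum.remove[of "{..<M}" c])
qed

lemma pinv_push:
  assumes "pinv It key q W n0 M i n nxt head lo hi ky L" and i: "i \<in> It" "0 < i"
    and c: "c = stream q W (key i)" "c < M" and h: "head c = 0 \<or> key (head c) = key i"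
  shows "pinv It key q W n0 M (Suc i) n (nxt(i := head c)) (head(c := i)) lo hi ky (L(c := i # L c))"
proof -
  interpret P: pinv It key q W n0 M i n nxt head lo hi ky L by fact
  have ni: "i \<notin> set (L d)" for d using P.pending[of i d] by blast
  \<comment> \<open>All pending keys of a stream agree, so the comparison with the head of the list
    settles them all.\<close>
  have top: "key y = key i" if y: "y \<in> set (L c)" for y
  proof -
    obtain x xs where x: "L c = x # xs" using y by (cases "L c") auto
    then have "head c = x" "x \<noteq> 0" using P.chain[OF c(2)] by auto
    then show ?thesis using h P.same_key[of x c y] y x by auto
  qed
  have mem: "x \<in> set (L d) \<or> x = i \<and> d = c" if "x \<in> set ((L(c := i # L c)) d)" for x d
    using that by (auto split: if_splits)
  show ?thesis
  proof
    show "chain (nxt(i := head c)) ((head(c := i)) d) ((L(c := i # L c)) d)" if "d < M" for d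
      using P.chain[OF that] P.chain[OF c(2)] ni i by (auto simp: chain_upd)
    show "distinct ((L(c := i # L c)) d)" for d
      using P.distinct[of d] P.distinct[of c] ni by auto
    show "x \<in> It \<and> x < Suc i \<and> stream q W (key x) = d" if "x \<in> set ((L(c := i # L c)) d)" for x d
      using mem[OF that] P.pending[of x d] i c(1) by auto
    show "key y = key x" if "x \<in> set ((L(c := i # L c)) d)" "y \<in> set ((L(c := i # L c)) d)" for x y d
      using mem[OF that(1)] mem[OF that(2)] P.same_key[of x d y] top by metis
    show "x \<noteq> lo m \<and> x \<noteq> hi m" if "x \<in> set ((L(c := i # L c)) d)" "n0 \<le> m" "m < n" for x d m
      using mem[OF that(1)] P.fresh[of x d m] that(2,3) P.child[of m] by auto
    show "lo m \<in> It \<and> lo m < Suc i \<and> hi m \<in> It \<and> hi m < Suc i \<and> lo m \<noteq> hi m" if "n0 \<le> m" "m < n" for m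
      using P.child[OF that] by simp
    show "card {x \<in> It. x < Suc i} = 2 * (n - n0) + (\<Sum>d<M. length ((L(c := i # L c)) d))"
      using P.card sum_length_upd[OF c(2), of L "i # L c"] card_less_Suc_mem[OF i(1)] by simp
  qed (fact P.n P.ky P.diff P.disj)+
qed

lemma pinv_pair:
  assumes "pinv It key q W n0 M i n nxt head lo hi ky L" and i: "i \<in> It"
    and c: "c = stream q W (key i)" "c < M" and h: "h = head c" "h \<noteq> 0" "key h \<noteq> key i"
    and qW: "0 < q" "0 < W"
    and l: "l = (if key i < key h then i else h)" and g: "g = (if key i < key h then h else i)"
  shows "pinv It key q W n0 M (Suc i) (Suc n) nxt (head(c := nxt h)) (lo(n := l)) (hi(n := g))
     (ky(n := key g - key l)) (L(c := tl (L c)))"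
proof -
  interpret P: pinv It key q W n0 M i n nxt head lo hi ky L by fact
  obtain xs where L: "L c = h # xs" using P.chain[OF c(2)] h by (cases "L c") auto
  have hx: "h \<in> It" "h < i" "stream q W (key h) = c" using P.pending[of h c] L by auto
  have lg: "l \<in> It" "g \<in> It" "l < Suc i" "g < Suc i" "l \<noteq> g" "key l < key g" "stream q W (key l) = stream q W (key g)"
    "l \<in> {i, h}" "g \<in> {i, h}"
    using hx i h(3) l g c(1) by (auto split: if_splits)
  have qw: "q \<le> key g - key l" "key g - key l < W"
    using stream_diff[OF lg(7,6) qW] .
  \<comment> \<open>Neither partner belongs to an earlier pair: item \<open>i\<close> lies beyond
    all parts so far, and the popped head was pending.\<close>
  have dj: "x \<noteq> lo m \<and> x \<noteq> hi m" if "n0 \<le> m" "m < n" "x \<in> {i, h}" for x m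
    using that P.fresh[of h c m] L P.child[OF that(1,2)] by auto
  have mem: "x \<in> set (L d) \<and> x \<noteq> i \<and> x \<noteq> h" if "x \<in> set ((L(c := tl (L c))) d)" for x d
  proof (cases "d = c")
    case True
    then show ?thesis using that L P.distinct[of c] P.pending[of x c] by auto
  next
    case False
    then have "x \<in> set (L d)" using that by simp
    then show ?thesis using P.pending[of x d] hx(3) False by auto
  qed
  show ?thesis
  proof
    show "n0 \<le> Suc n" using P.n by simp
    show "(ky(n := key g - key l)) x = key x" if "x < n0" for x using that P.ky[OF that] P.n by auto
    show "chain nxt ((head(c := nxt h)) d) ((L(c := tl (L c))) d)" if "d < M" for d
      using P.chain[OF that] P.chain[OF c(2)] L by auto
    show "distinct ((L(c := tl (L c))) d)" for d using P.distinct[of d] P.distinct[of c] L by auto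
    show "x \<in> It \<and> x < Suc i \<and> stream q W (key x) = d" if "x \<in> set ((L(c := tl (L c))) d)" for x d
      using mem[OF that] P.pending[of x d] by auto
    show "key y = key x" if "x \<in> set ((L(c := tl (L c))) d)" "y \<in> set ((L(c := tl (L c))) d)" for x y d
      using mem[OF that(1)] mem[OF that(2)] P.same_key[of x d y] by blast
    show "x \<noteq> (lo(n := l)) m \<and> x \<noteq> (hi(n := g)) m" if "x \<in> set ((L(c := tl (L c))) d)" "n0 \<le> m" "m < Suc n" for x d m
      using mem[OF that(1)] P.fresh[of x d m] that(2,3) lg by (cases "m = n") auto
    show "(lo(n := l)) m \<in> It \<and> (lo(n := l)) m < Suc i \<and> (hi(n := g)) m \<in> It \<and> (hi(n := g)) m < Suc i \<and>
        (lo(n := l)) m \<noteq> (hi(n := g)) m" if "n0 \<le> m" "m < Suc n" for m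
      using that lg P.child[of m] by (cases "m = n") auto
    show "(ky(n := key g - key l)) m + key ((lo(n := l)) m) = key ((hi(n := g)) m) \<and>
        q \<le> (ky(n := key g - key l)) m \<and> (ky(n := key g - key l)) m < W" if "n0 \<le> m" "m < Suc n" for m
      using that lg qw P.diff[of m] by (cases "m = n") auto
    show "(lo(n := l)) m \<noteq> (lo(n := l)) m' \<and> (lo(n := l)) m \<noteq> (hi(n := g)) m' \<and>
          (hi(n := g)) m \<noteq> (hi(n := g)) m'" if mm: "n0 \<le> m" "m < Suc n" "n0 \<le> m'" "m' < Suc n" "m' \<noteq> m" for m m'
    proof -
      consider "m = n" "m' < n" | "m' = n" "m < n" | "m < n" "m' < n" using mm by linarith
      then show ?thesis
      proof cases
        case 1
        then show ?thesis using dj[of m' l] dj[of m' g] mm lg by auto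
      next
        case 2
        then show ?thesis using dj[of m l] dj[of m g] mm lg by auto
      next
        case 3
        then show ?thesis using P.disj[of m m'] mm by auto
      qed
    qed
    show "card {x \<in> It. x < Suc i} = 2 * (Suc n - n0) + (\<Sum>d<M. length ((L(c := tl (L c))) d))"
      using P.card sum_length_upd[OF c(2), of L "tl (L c)"] card_less_Suc_mem[OF i(1)] P.n L by simp
  qed
qed

lemma pinv_top:
  assumes "pinv It key q W n0 M i n nxt head lo hi ky L" "c < M" "head c \<noteq> 0"
  shows "head c \<in> It \<and> head c < i"
proof -
  interpret P: pinv It key q W n0 M i n nxt head lo hi ky L by fact
  have "head c \<in> set (L c)" using P.chain[OF assms(2)] assms(3) by (cases "L c") auto
  then show ?thesis using P.pending by blast
qed

text \<open>An item that is not paired is pending, and the pending items of one stream share a key;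
  so each of the \<open>S\<close> streams wastes at most \<open>m\<close> items.\<close>

lemma pinv_card:
  assumes "pinv It key q W n0 M i n nxt head lo hi ky L" "finite It"
    and "\<And>x. x \<in> It \<Longrightarrow> x < i \<and> stream q W (key x) < S" and mult: "\<And>k. card {x \<in> It. key x = k} \<le> m"
  shows "card It \<le> 2 * (n - n0) + S * m"
proof -
  interpret P: pinv It key q W n0 M i n nxt head lo hi ky L by fact
  have len: "length (L c) \<le> m" for c
  proof (cases "L c")
    case (Cons x xs)
    have "set (L c) \<subseteq> {y \<in> It. key y = key x}"
    proof
      fix y assume "y \<in> set (L c)"
      moreover have "x \<in> set (L c)" using Cons by simp
      ultimately show "y \<in> {y \<in> It. key y = key x}" using P.pending[of y c] P.same_key[of x c y] by blast
    qed
    then have "card (set (L c)) \<le> card {y \<in> It. key y = key x}" using assms(2) by (intro card_mono) auto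
    then show ?thesis using mult[of "key x"] distinct_card[OF P.distinct[of c]] by simp
  qed simp
  have nil: "L c = []" if "\<not> c < S" for c
  proof (rule ccontr)
    assume "L c \<noteq> []"
    then have "hd (L c) \<in> set (L c)" by simp
    then show False using that P.pending[of "hd (L c)" c] assms(3)[of "hd (L c)"] by auto
  qed
  have "(\<Sum>c<M. length (L c)) = (\<Sum>c\<in>{..<M} \<inter> {..<S}. length (L c))"
    by (rule sum.mono_neutral_right) (auto simp: nil)
  also have "\<dots> \<le> (\<Sum>c\<in>{..<S}. length (L c))" by (rule sum_mono2) auto
  also have "\<dots> \<le> (\<Sum>c\<in>{..<S}. m)" by (rule sum_mono) (rule len)
  also have "\<dots> = S * m" by simp
  finally have "(\<Sum>c<M. length (L c)) \<le> S * m" .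
  moreover have "{x \<in> It. x < i} = It" using assms(3) by auto
  ultimately show ?thesis using P.card by simp
qed

definition join_code :: "nat \<Rightarrow> com" where
  "join_code hh =
     Upd hh (V 21) (Arr 8 (V 24)) ;;
     If (Less (V 5) (V 25))
       (Upd 2 (V 6) (V 2) ;; Upd 3 (V 6) (V 24) ;; Upd 15 (V 6) (Minus (V 25) (V 5)))
       (Upd 2 (V 6) (V 24) ;; Upd 3 (V 6) (V 2) ;; Upd 15 (V 6) (Minus (V 5) (V 25))) ;;
     Assign 6 (Plus (V 6) (N 1))"

lemma run_join_code:
  assumes "hh \<notin> {2, 3, 15}" "s 21 < 2 * s 0" "s 24 < 2 * s 0" "s 6 < 2 * s 0" "2 * s 0 + 1 < B"
    and "Q (s(6 := Suc (s 6))) (a(hh := (a hh)(s 21 := a 8 (s 24)),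
       2 := (a 2)(s 6 := if s 5 < s 25 then s 2 else s 24),
       3 := (a 3)(s 6 := if s 5 < s 25 then s 24 else s 2),
       15 := (a 15)(s 6 := if s 5 < s 25 then s 25 - s 5 else s 5 - s 25))) (Suc (Suc (Suc (Suc (Suc (Suc t))))))"
  shows "run B (join_code hh) s a t Q"
proof (cases "s 5 < s 25")
  case True
  then show ?thesis using assms by (simp add: join_code_def)
next
  case False
  then show ?thesis using assms by (simp add: join_code_def)
qed

text \<open>The pending items of a stream form a linked list with its head in array
  \<open>hh\<close> and its links in array \<open>8\<close>; index \<open>0\<close> is the null
  pointer, which is possible because items are numbered from \<open>1\<close>. Items flagged in
  \<open>fl\<close> are passed over.\<close>

definition pair_code :: "nat \<Rightarrow> nat \<Rightarrow> com" where
  "pair_code hh fl = While (Less (V 2) (V 11))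
    (If (Eq (Arr fl (V 2)) (N 0))
      (Assign 5 (Arr 15 (V 2)) ;;
       Assign 21 (Plus (Times (V 13) (Quot (V 5) (V 12))) (Modulo (V 5) (V 13))) ;;
       Assign 24 (Arr hh (V 21)) ;;
       Assign 25 (Arr 15 (V 24)) ;;
       If (Eq (V 24) (N 0))
        (Upd 8 (V 2) (V 24) ;; Upd hh (V 21) (V 2))
        (If (Eq (V 25) (V 5))
          (Upd 8 (V 2) (V 24) ;; Upd hh (V 21) (V 2))
          (join_code hh)))
      Skip ;;
     Assign 2 (Plus (V 2) (N 1)))"

lemma run_pair_code:
  assumes hh: "hh \<notin> {2, 3, 8, 15, fl}" and fl: "fl \<notin> {2, 3, 8, 15}"
    and It: "It = {x \<in> {s 2..<s 11}. a fl x = 0}"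
    and i0: "0 < s 2" "s 2 \<le> s 11" "s 11 \<le> s 6" and n0: "s 6 + card It \<le> 2 * s 0" and p: "0 < s 0"
    and qW: "0 < s 13" "0 < s 12" and B: "2 * s 0 + 1 < B"
    and str: "\<And>x. x \<in> It \<Longrightarrow> stream (s 13) (s 12) (a 15 x) < 2 * s 0"
    and h0: "\<And>c. c < 2 * s 0 \<Longrightarrow> a hh c = 0"
  shows "run B (pair_code hh fl) s a t (\<lambda>s' a' t'.
     same_except {2, 5, 6, 21, 24, 25} s s' \<and> same_except {2, 3, 8, 15, hh} a a' \<and>
     t' \<le> t + 20 * (s 11 - s 2) + 1 \<and> s' 6 \<le> s 6 + card It \<and>
     (\<forall>x<s 6. a' 2 x = a 2 x \<and> a' 3 x = a 3 x) \<and>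
     (\<exists>nxt head L. pinv It (a 15) (s 13) (s 12) (s 6) (2 * s 0) (s 11) (s' 6) nxt head (a' 2) (a' 3) (a' 15) L))"
proof -
  define I where "I = (\<lambda>(s'::vars) (a'::arrays) (t'::nat).
     same_except {2, 5, 6, 21, 24, 25} s s' \<and> same_except {2, 3, 8, 15, hh} a a' \<and>
     s 2 \<le> s' 2 \<and> s' 2 \<le> s 11 \<and> t' \<le> t + 20 * (s' 2 - s 2) \<and>
     (\<forall>x<s 6. a' 2 x = a 2 x \<and> a' 3 x = a 3 x) \<and>
     (\<exists>L. pinv It (a 15) (s 13) (s 12) (s 6) (2 * s 0) (s' 2) (s' 6) (a' 8) (a' hh) (a' 2) (a' 3) (a' 15) L))"
  have fin: "finite It" unfolding It by simp
  show ?thesis unfolding pair_code_def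
  proof (rule run_While[where M = "\<lambda>s' a'. s 11 - s' 2" and I = I], goal_cases)
    case 1
    have "pinv It (a 15) (s 13) (s 12) (s 6) (2 * s 0) (s 2) (s 6) (a 8) (a hh) (a 2) (a 3) (a 15) (\<lambda>_. [])"
    proof -
      have "{x \<in> It. x < s 2} = {}" unfolding It by auto
      then show ?thesis using h0 by unfold_locales auto
    qed
    then show ?case unfolding I_def using i0 by auto
  next
    case (2 s' a' t')
    then obtain L where I: "same_except {2, 5, 6, 21, 24, 25} s s'" "same_except {2, 3, 8, 15, hh} a a'"
     "s 2 \<le> s' 2" "s' 2 \<le> s 11" "t' \<le> t + 20 * (s' 2 - s 2)"
     "\<forall>x<s 6. a' 2 x = a 2 x \<and> a' 3 x = a 3 x"
     and P: "pinv It (a 15) (s 13) (s 12) (s 6) (2 * s 0) (s' 2) (s' 6) (a' 8) (a' hh) (a' 2) (a' 3) (a' 15) L"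
      unfolding I_def by (elim exE conjE) (rule that)
    interpret P: pinv It "a 15" "s 13" "s 12" "s 6" "2 * s 0" "s' 2" "s' 6" "a' 8" "a' hh" "a' 2" "a' 3" "a' 15" L
      by (rule P)
    have eqs: "s' 0 = s 0" "s' 11 = s 11" "s' 12 = s 12" "s' 13 = s 13" "a' fl = a fl"
      using I(1,2) fl hh by (auto simp: same_except_def)
    show ?case
    proof (cases "s' 2 < s 11")
      case True
      have i2: "s' 2 < 2 * s 0" "Suc (s' 2) < B" using True i0 n0 B by linarith+
      have tt: "t' + 20 \<le> t + 20 * (Suc (s' 2) - s 2)" using I(3,5) by linarith
      have ms: "s 11 - Suc (s' 2) < s 11 - s' 2" using True by simp
      show ?thesis
      proof (cases "a fl (s' 2) = 0")
        case False
        then have "s' 2 \<notin> It" by (simp add: It)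
        then have "I (s'(2 := Suc (s' 2))) a' (Suc (Suc (Suc t')))"
          unfolding I_def using I True tt pinv_skip[OF P] by auto
        then show ?thesis using True False i2 ms B by (simp add: eqs)
      next
        case fl0: True
        have mem: "s' 2 \<in> It" using True I(3) fl0 by (simp add: It)
        let ?k = "a 15 (s' 2)"
        let ?c = "stream (s 13) (s 12) ?k"
        let ?h = "a' hh ?c"
        have k: "a' 15 (s' 2) = ?k" using P.ky[of "s' 2"] True i0 by simp
        have c: "?c < 2 * s 0" using str mem by simp
        have c': "s 13 * (?k div s 12) + ?k mod s 13 = ?c" by (simp add: stream_def)
        have cB: "s 13 * (?k div s 12) < B" "?c < B" using c c' B by linarith+
        have top: "?h < s' 2" "a' 15 ?h = a 15 ?h"  if "?h \<noteq> 0"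
          using pinv_top[OF P c that] P.ky[of ?h] True i0 by auto
        \<comment> \<open>The key of the head is loaded even when the list is empty, so the null
          index has to be a legal address as well.\<close>
        have h2: "?h < 2 * s 0" using top i2 p by (cases "?h = 0") auto
        define s1 where "s1 = s'(5 := ?k, 21 := ?c, 24 := ?h, 25 := a' 15 ?h)"
        show ?thesis
        proof (cases "?h = 0 \<or> a 15 ?h = ?k")
          case c1: True
          let ?a1 = "a'(8 := (a' 8)(s' 2 := ?h), hh := (a' hh)(?c := s' 2))"
          have P1: "pinv It (a 15) (s 13) (s 12) (s 6) (2 * s 0) (Suc (s' 2)) (s' 6) ((a' 8)(s' 2 := ?h))
            ((a' hh)(?c := s' 2)) (a' 2) (a' 3) (a' 15) (L(?c := s' 2 # L ?c))"
            using c1 mem c i0 I(3) by (intro pinv_push[OF P]) auto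
          have "I (s1(2 := Suc (s' 2))) ?a1 t''" if "t'' \<le> t' + 20" for t''
            unfolding I_def s1_def using I True tt that hh exI[where P = "pinv It (a 15) (s 13) (s 12) (s 6) (2 * s 0) (Suc (s' 2)) (s' 6) ((a' 8)(s' 2 := ?h))
            ((a' hh)(?c := s' 2)) (a' 2) (a' 3) (a' 15)", OF P1] by auto
          then show ?thesis using True fl0 i2 ms B c1 c c' cB h2 k top hh
            by (auto simp: eqs s1_def)
        next
          case c2: False
          define l where "l = (if ?k < a 15 ?h then s' 2 else ?h)"
          define g where "g = (if ?k < a 15 ?h then ?h else s' 2)"
          have P1: "pinv It (a 15) (s 13) (s 12) (s 6) (2 * s 0) (Suc (s' 2)) (Suc (s' 6)) (a' 8)
            ((a' hh)(?c := a' 8 ?h)) ((a' 2)(s' 6 := l)) ((a' 3)(s' 6 := g)) ((a' 15)(s' 6 := a 15 g - a 15 l)) (L(?c := tl (L ?c)))"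
            using c2 mem c qW by (intro pinv_pair[OF P]) (auto simp: l_def g_def)
          interpret P1: pinv It "a 15" "s 13" "s 12" "s 6" "2 * s 0" "Suc (s' 2)" "Suc (s' 6)" "a' 8"
            "(a' hh)(?c := a' 8 ?h)" "(a' 2)(s' 6 := l)" "(a' 3)(s' 6 := g)" "(a' 15)(s' 6 := a 15 g - a 15 l)" "L(?c := tl (L ?c))"
            by (rule P1)
          \<comment> \<open>A pair uses up two items, so the number of items bounds the number of
            nodes and the next one still fits into the arrays.\<close>
          have "card {x \<in> It. x < Suc (s' 2)} \<le> card It" using fin by (intro card_mono) auto
          then have n6: "s' 6 < 2 * s 0" using P1.card P1.n P.n n0 by linarith
          let ?a1 = "a'(hh := (a' hh)(?c := a' 8 ?h), 2 := (a' 2)(s' 6 := l), 3 := (a' 3)(s' 6 := g),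
             15 := (a' 15)(s' 6 := a 15 g - a 15 l))"
          have "I (s1(6 := Suc (s' 6), 2 := Suc (s' 2))) ?a1 t''" if "t'' \<le> t' + 20" for t''
            unfolding I_def s1_def using I True tt that hh P.n exI[where P = "pinv It (a 15) (s 13) (s 12) (s 6) (2 * s 0) (Suc (s' 2)) (Suc (s' 6)) (a' 8)
            ((a' hh)(?c := a' 8 ?h)) ((a' 2)(s' 6 := l)) ((a' 3)(s' 6 := g)) ((a' 15)(s' 6 := a 15 g - a 15 l))", OF P1] by auto
          then have fin: "t'' \<le> t' + 20 \<Longrightarrow> I (s1(6 := Suc (s' 6), 2 := Suc (s' 2))) ?a1 t''" for t''
            by simp
          have hk: "?h \<noteq> 0" "a' 15 ?h = a 15 ?h" "a 15 ?h \<noteq> ?k" using c2 top by auto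
          have hs: "hh \<noteq> 2" "hh \<noteq> 3" "hh \<noteq> 8" "hh \<noteq> 15" "hh \<noteq> fl" using hh by auto
          have nB: "Suc (s' 6) < B" using n6 B by linarith
          have j: "run B (join_code hh) s1 a' (Suc (Suc (Suc (Suc (Suc (Suc (Suc (Suc t')))))))) (\<lambda>u v w. run B (Assign 2 (Plus (V 2) (N 1))) u v w
             (\<lambda>s'' a'' t''. I s'' a'' t'' \<and> s 11 - s'' 2 < s 11 - s' 2))"
            apply (rule run_join_code)
            subgoal using hh by simp
            subgoal using c by (simp add: s1_def eqs)
            subgoal using h2 by (simp add: s1_def eqs)
            subgoal using n6 by (simp add: s1_def eqs)
            subgoal using B by (simp add: s1_def eqs)
            subgoal using fin[of "(Suc (Suc (Suc (Suc (Suc (Suc (Suc (Suc (Suc (Suc (Suc (Suc (Suc (Suc (Suc t')))))))))))))))"] hk i2 ms B by (cases "?k < a 15 ?h") (simp_all add: s1_def l_def g_def eqs)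
            done
          show ?thesis
            using j[unfolded s1_def] True fl0 i2 B hk hs c cB h2
            by (simp add: eqs k c')
        qed
      qed
    qed (simp add: eqs)
  next
    case (3 s' a' t')
    then have e: "s' 2 = s 11" by (auto simp: I_def same_except_def)
    obtain L where P: "pinv It (a 15) (s 13) (s 12) (s 6) (2 * s 0) (s 11) (s' 6) (a' 8) (a' hh) (a' 2) (a' 3) (a' 15) L"
      using 3(1) unfolding I_def e by (elim exE conjE) (rule that)
    interpret P: pinv It "a 15" "s 13" "s 12" "s 6" "2 * s 0" "s 11" "s' 6" "a' 8" "a' hh" "a' 2" "a' 3" "a' 15" L
      by (rule P)
    have "card {x \<in> It. x < s 11} \<le> card It" using fin by (intro card_mono) auto
    then have "s' 6 \<le> s 6 + card It" using P.card P.n by linarith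
    then show ?case using 3(1) P unfolding I_def e by auto
  qed
qed

text \<open>Elements with key \<open>1\<close> are reserved for the interval and must not take part
  in the first pairing.\<close>

definition flag_code :: com where
  "flag_code = While (Less (V 2) (V 0))
     (If (Eq (Arr 15 (V 2)) (N 1)) (Upd 9 (V 2) (N 1)) Skip ;; Assign 2 (Plus (V 2) (N 1)))"

lemma run_flag_code:
  assumes "s 2 = 1" "0 < s 0" "2 * s 0 + 1 < B" "\<And>i. i < 2 * s 0 \<Longrightarrow> a 9 i = 0"
  shows "run B flag_code s a t (\<lambda>s' a' t'.
     same_except {2} s s' \<and> same_except {9} a a' \<and> t' \<le> t + 4 * s 0 + 1 \<and>
     (\<forall>i. 1 \<le> i \<longrightarrow> i < s 0 \<longrightarrow> a' 9 i = (if a 15 i = 1 then 1 else 0)))"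
proof -
  define I where "I = (\<lambda>(s'::vars) (a'::arrays) (t'::nat).
     same_except {2} s s' \<and> same_except {9} a a' \<and> 1 \<le> s' 2 \<and> s' 2 \<le> s 0 \<and> t' \<le> t + 4 * (s' 2 - 1) \<and>
     (\<forall>i. 1 \<le> i \<longrightarrow> i < s 0 \<longrightarrow> a' 9 i = (if i < s' 2 \<and> a 15 i = 1 then 1 else 0)))"
  show ?thesis unfolding flag_code_def
  proof (rule run_While[where M = "\<lambda>s' a'. s 0 - s' 2" and I = I], goal_cases)
    case 1
    show ?case unfolding I_def using assms by auto
  next
    case (2 s' a' t')
    then have I: "same_except {2} s s'" "same_except {9} a a'" "1 \<le> s' 2" "s' 2 \<le> s 0" "t' \<le> t + 4 * (s' 2 - 1)"
     "\<And>i. 1 \<le> i \<Longrightarrow> i < s 0 \<Longrightarrow> a' 9 i = (if i < s' 2 \<and> a 15 i = 1 then 1 else 0)"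
      unfolding I_def by blast+
    have eqs: "s' 0 = s 0" "a' 15 = a 15"
      using I(1,2) by (auto simp: same_except_def)
    show ?case
    proof (cases "s' 2 < s 0")
      case True
      have tt: "t' + 4 \<le> t + 4 * (Suc (s' 2) - 1)" using I(3,5) by linarith
      have "I (s'(2 := Suc (s' 2))) (a'(9 := (a' 9)(s' 2 := 1))) (Suc (Suc (Suc (Suc t'))))" if "a 15 (s' 2) = 1"
        unfolding I_def using I(1-4) True tt that by (auto simp: I(6) less_Suc_eq)
      moreover have "I (s'(2 := Suc (s' 2))) a' (Suc (Suc (Suc t')))" if "a 15 (s' 2) \<noteq> 1"
        unfolding I_def using I(1-4) True tt that by (auto simp: I(6) less_Suc_eq)
      ultimately show ?thesis using True assms(3) by (simp add: eqs)
    qed (simp add: eqs)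
  next
    case (3 s' a' t')
    then have e: "s' 2 = s 0" by (auto simp: I_def same_except_def)
    then show ?case using 3(1) by (auto simp: I_def)
  qed
qed

text \<open>Compacts in place the nodes whose difference is the value in \<open>4\<close>, stopping
  at index \<open>26\<close>, and marks their parts in array \<open>10\<close>. Writing never
  overtakes reading. The key stored is already \<open>1\<close>, the value of the difference after
  the division by it that follows.\<close>

definition keep_code :: com where
  "keep_code = While (Less (V 2) (V 7))
    (If (Eq (Arr 15 (V 2)) (V 4))
      (If (Less (V 6) (V 26))
        (Upd 10 (Arr 2 (V 2)) (N 1) ;; Upd 10 (Arr 3 (V 2)) (N 1) ;;
         Upd 2 (V 6) (Arr 2 (V 2)) ;; Upd 3 (V 6) (Arr 3 (V 2)) ;; Upd 15 (V 6) (N 1) ;;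
         Assign 6 (Plus (V 6) (N 1)))
        Skip)
      Skip ;;
     Assign 2 (Plus (V 2) (N 1)))"

text \<open>\<open>f\<close> gives the node from which a kept one was copied; as it is injective,
  the kept nodes inherit the disjointness of their parts.\<close>

lemma run_keep_code:
  assumes "s 2 = s 0" "s 6 = s 0" "s 0 \<le> s 7" "s 7 \<le> 2 * s 0" "s 0 \<le> s 26" "2 * s 0 + 1 < B"
    and ch: "\<And>i. s 0 \<le> i \<Longrightarrow> i < s 7 \<Longrightarrow> a 2 i < 2 * s 0 \<and> a 3 i < 2 * s 0"
    and fl: "\<And>x. x < 2 * s 0 \<Longrightarrow> a 10 x = 0"
  shows "run B keep_code s a t (\<lambda>s' a' t'.
     same_except {2, 6} s s' \<and> same_except {2, 3, 10, 15} a a' \<and> t' \<le> t + 10 * s 0 + 1 \<and>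
     s' 6 = s 0 + min (s 26 - s 0) (occ (a 15) (s 0) (s 7) (s 4)) \<and> (\<forall>x<s 0. a' 15 x = a 15 x) \<and>
     (\<forall>x<2 * s 0. a' 10 x = (if \<exists>m. s 0 \<le> m \<and> m < s' 6 \<and> (x = a' 2 m \<or> x = a' 3 m) then 1 else 0)) \<and>
     (\<exists>f. \<forall>m. s 0 \<le> m \<longrightarrow> m < s' 6 \<longrightarrow> s 0 \<le> f m \<and> f m < s 7 \<and> a 15 (f m) = s 4 \<and> a' 15 m = 1 \<and>
        a' 2 m = a 2 (f m) \<and> a' 3 m = a 3 (f m) \<and> (\<forall>m'. s 0 \<le> m' \<longrightarrow> m' < s' 6 \<longrightarrow> m' \<noteq> m \<longrightarrow> f m' \<noteq> f m)))"
proof -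
  define I where "I = (\<lambda>(s'::vars) (a'::arrays) (t'::nat).
     same_except {2, 6} s s' \<and> same_except {2, 3, 10, 15} a a' \<and> s 0 \<le> s' 2 \<and> s' 2 \<le> s 7 \<and>
     t' \<le> t + 10 * (s' 2 - s 0) \<and> s' 6 \<le> s' 2 \<and> s 0 \<le> s' 6 \<and>
     s' 6 = s 0 + min (s 26 - s 0) (occ (a 15) (s 0) (s' 2) (s 4)) \<and> (\<forall>x<s 0. a' 15 x = a 15 x) \<and>
     (\<forall>x. s' 2 \<le> x \<longrightarrow> a' 15 x = a 15 x \<and> a' 2 x = a 2 x \<and> a' 3 x = a 3 x) \<and>
     (\<forall>x<2 * s 0. a' 10 x = (if \<exists>m. s 0 \<le> m \<and> m < s' 6 \<and> (x = a' 2 m \<or> x = a' 3 m) then 1 else 0)) \<and>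
     (\<exists>f. \<forall>m. s 0 \<le> m \<longrightarrow> m < s' 6 \<longrightarrow> s 0 \<le> f m \<and> f m < s' 2 \<and> a 15 (f m) = s 4 \<and> a' 15 m = 1 \<and>
        a' 2 m = a 2 (f m) \<and> a' 3 m = a 3 (f m) \<and> (\<forall>m'. s 0 \<le> m' \<longrightarrow> m' < s' 6 \<longrightarrow> m' \<noteq> m \<longrightarrow> f m' \<noteq> f m)))"
  show ?thesis unfolding keep_code_def
  proof (rule run_While[where M = "\<lambda>s' a'. s 7 - s' 2" and I = I], goal_cases)
    case 1
    show ?case unfolding I_def using assms by auto
  next
    case (2 s' a' t')
    then obtain f where I: "same_except {2, 6} s s'" "same_except {2, 3, 10, 15} a a'" "s 0 \<le> s' 2" "s' 2 \<le> s 7"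
     "t' \<le> t + 10 * (s' 2 - s 0)" "s' 6 \<le> s' 2" "s 0 \<le> s' 6"
     "s' 6 = s 0 + min (s 26 - s 0) (occ (a 15) (s 0) (s' 2) (s 4))" "\<forall>x<s 0. a' 15 x = a 15 x"
     "\<forall>x. s' 2 \<le> x \<longrightarrow> a' 15 x = a 15 x \<and> a' 2 x = a 2 x \<and> a' 3 x = a 3 x"
     "\<forall>x<2 * s 0. a' 10 x = (if \<exists>m. s 0 \<le> m \<and> m < s' 6 \<and> (x = a' 2 m \<or> x = a' 3 m) then 1 else 0)"
     and f: "\<forall>m. s 0 \<le> m \<longrightarrow> m < s' 6 \<longrightarrow> s 0 \<le> f m \<and> f m < s' 2 \<and> a 15 (f m) = s 4 \<and> a' 15 m = 1 \<and>
        a' 2 m = a 2 (f m) \<and> a' 3 m = a 3 (f m) \<and> (\<forall>m'. s 0 \<le> m' \<longrightarrow> m' < s' 6 \<longrightarrow> m' \<noteq> m \<longrightarrow> f m' \<noteq> f m)"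
      unfolding I_def by (elim exE conjE) (rule that)
    have eqs: "s' 0 = s 0" "s' 7 = s 7" "s' 4 = s 4" "s' 26 = s 26"
      using I(1) by (auto simp: same_except_def)
    let ?i = "s' 2" and ?n = "s' 6"
    have cur: "a' 15 ?i = a 15 ?i" "a' 2 ?i = a 2 ?i" "a' 3 ?i = a 3 ?i" using I(10) by auto
    have oc: "occ (a 15) (s 0) (Suc ?i) (s 4) = occ (a 15) (s 0) ?i (s 4) + (if a 15 ?i = s 4 then 1 else 0)"
      using I(3) by (rule occ_Suc)
    show ?case
    proof (cases "?i < s 7")
      case True
      have tt: "t' + 10 \<le> t + 10 * (Suc ?i - s 0)" using I(3,5) by linarith
      have ms: "s 7 - Suc ?i < s 7 - ?i" using True by simp
      have b: "?i < 2 * s 0" "?n < 2 * s 0" "Suc ?i < B" "Suc ?n < B" using True I(6) assms by linarith+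
      have chi: "a 2 ?i < 2 * s 0" "a 3 ?i < 2 * s 0" using ch[of ?i] True I by auto
      have f': "\<exists>f. \<forall>m. s 0 \<le> m \<longrightarrow> m < ?n \<longrightarrow> s 0 \<le> f m \<and> f m < Suc ?i \<and> a 15 (f m) = s 4 \<and> a' 15 m = 1 \<and>
        a' 2 m = a 2 (f m) \<and> a' 3 m = a 3 (f m) \<and> (\<forall>m'. s 0 \<le> m' \<longrightarrow> m' < ?n \<longrightarrow> m' \<noteq> m \<longrightarrow> f m' \<noteq> f m)"
        using f by (intro exI[of _ f]) (simp add: less_SucI)
      show ?thesis
      proof (cases "a 15 ?i = s 4 \<and> ?n < s 26")
        case False
        have "?n = s 0 + min (s 26 - s 0) (occ (a 15) (s 0) (Suc ?i) (s 4))"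
          using I(8) False unfolding oc by auto
        then have II: "I (s'(2 := Suc ?i)) a' t''" if "t'' \<le> t' + 10" for t''
          unfolding I_def using I(1-7,9-11) True tt that f' by auto
        show ?thesis
        proof (cases "a 15 ?i = s 4")
          case True
          then show ?thesis using II \<open>?i < s 7\<close> ms b False by (simp add: eqs cur)
        next
          case False
          then show ?thesis using II \<open>?i < s 7\<close> ms b by (simp add: eqs cur)
        qed
      next
        case c: True
        define fl' where "fl' = (a' 10)(a 2 ?i := 1, a 3 ?i := 1)"
        define lo' where "lo' = (a' 2)(?n := a 2 ?i)"
        define hi' where "hi' = (a' 3)(?n := a 3 ?i)"
        define ky' where "ky' = (a' 15)(?n := 1)"
        let ?a1 = "a'(10 := fl', 2 := lo', 3 := hi', 15 := ky')"
        have 1: "Suc ?n = s 0 + min (s 26 - s 0) (occ (a 15) (s 0) (Suc ?i) (s 4))"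
          using I(7,8) c unfolding oc by auto
        have 2: "\<forall>x<s 0. ky' x = a 15 x" using I(7,9) by (simp add: ky'_def)
        have 3: "\<forall>x. Suc ?i \<le> x \<longrightarrow> ky' x = a 15 x \<and> lo' x = a 2 x \<and> hi' x = a 3 x"
          using I(6,10) by (auto simp: ky'_def lo'_def hi'_def)
        have 4: "\<forall>x<2 * s 0. fl' x = (if \<exists>m. s 0 \<le> m \<and> m < Suc ?n \<and> (x = lo' m \<or> x = hi' m) then 1 else 0)"
        proof (intro allI impI)
          fix x assume x: "x < 2 * s 0"
          have "(\<exists>m. s 0 \<le> m \<and> m < Suc ?n \<and> (x = lo' m \<or> x = hi' m)) \<longleftrightarrow>
             x = a 2 ?i \<or> x = a 3 ?i \<or> (\<exists>m. s 0 \<le> m \<and> m < ?n \<and> (x = a' 2 m \<or> x = a' 3 m))"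
            (is "?L \<longleftrightarrow> ?R")
          proof
            assume ?L
            then obtain m where m: "s 0 \<le> m" "m < Suc ?n" "x = lo' m \<or> x = hi' m" by blast
            then show ?R by (cases "m = ?n") (auto simp: lo'_def hi'_def)
          next
            assume ?R
            then consider "x = a 2 ?i \<or> x = a 3 ?i" | m where "s 0 \<le> m" "m < ?n" "x = a' 2 m \<or> x = a' 3 m" by blast
            then show ?L
            proof cases
              case 1
              then show ?thesis using I(7) by (intro exI[of _ ?n]) (auto simp: lo'_def hi'_def)
            next
              case 2
              then show ?thesis by (intro exI[of _ m]) (auto simp: lo'_def hi'_def)
            qed
          qed
          moreover have "a' 10 x = (if \<exists>m. s 0 \<le> m \<and> m < ?n \<and> (x = a' 2 m \<or> x = a' 3 m) then 1 else 0)"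
            using I(11) x by blast
          ultimately show "fl' x = (if \<exists>m. s 0 \<le> m \<and> m < Suc ?n \<and> (x = lo' m \<or> x = hi' m) then 1 else 0)"
            unfolding fl'_def by (simp only: fun_upd_apply) auto
        qed
        have 5: "\<forall>m. s 0 \<le> m \<longrightarrow> m < Suc ?n \<longrightarrow> s 0 \<le> (f(?n := ?i)) m \<and> (f(?n := ?i)) m < Suc ?i \<and>
          a 15 ((f(?n := ?i)) m) = s 4 \<and> ky' m = 1 \<and> lo' m = a 2 ((f(?n := ?i)) m) \<and> hi' m = a 3 ((f(?n := ?i)) m) \<and>
          (\<forall>m'. s 0 \<le> m' \<longrightarrow> m' < Suc ?n \<longrightarrow> m' \<noteq> m \<longrightarrow> (f(?n := ?i)) m' \<noteq> (f(?n := ?i)) m)"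
        proof (intro allI impI)
          fix m assume m: "s 0 \<le> m" "m < Suc ?n"
          have lt: "f m' \<noteq> ?i" if "s 0 \<le> m'" "m' < ?n" for m' using f that by (metis less_irrefl)
          show "s 0 \<le> (f(?n := ?i)) m \<and> (f(?n := ?i)) m < Suc ?i \<and>
            a 15 ((f(?n := ?i)) m) = s 4 \<and> ky' m = 1 \<and> lo' m = a 2 ((f(?n := ?i)) m) \<and> hi' m = a 3 ((f(?n := ?i)) m) \<and>
            (\<forall>m'. s 0 \<le> m' \<longrightarrow> m' < Suc ?n \<longrightarrow> m' \<noteq> m \<longrightarrow> (f(?n := ?i)) m' \<noteq> (f(?n := ?i)) m)"
          proof (cases "m = ?n")
            case True
            then show ?thesis using c I(3) by (auto dest: lt simp: ky'_def lo'_def hi'_def less_Suc_eq)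
          next
            case False
            then have m': "m < ?n" using m by simp
            have F: "s 0 \<le> f m \<and> f m < s' 2 \<and> a 15 (f m) = s 4 \<and> a' 15 m = 1 \<and>
              a' 2 m = a 2 (f m) \<and> a' 3 m = a 3 (f m) \<and> (\<forall>m'. s 0 \<le> m' \<longrightarrow> m' < s' 6 \<longrightarrow> m' \<noteq> m \<longrightarrow> f m' \<noteq> f m)"
              using f m(1) m' by blast
            then show ?thesis using False by (auto simp: ky'_def lo'_def hi'_def less_Suc_eq)
          qed
        qed
        have II: "I (s'(6 := Suc ?n, 2 := Suc ?i)) ?a1 t''" if "t'' \<le> t' + 10" for t''
          unfolding I_def using I(1-7) True tt that 1 2 3 4 exI[where P = "\<lambda>f. \<forall>m. s 0 \<le> m \<longrightarrow> m < Suc ?n \<longrightarrow> s 0 \<le> f m \<and> f m < Suc ?i \<and> a 15 (f m) = s 4 \<and> ky' m = 1 \<and>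
        lo' m = a 2 (f m) \<and> hi' m = a 3 (f m) \<and> (\<forall>m'. s 0 \<le> m' \<longrightarrow> m' < Suc ?n \<longrightarrow> m' \<noteq> m \<longrightarrow> f m' \<noteq> f m)", OF 5]
          by simp
        have B1: "1 < B" using b by linarith
        show ?thesis using II[unfolded fl'_def lo'_def hi'_def ky'_def] c True ms b B1 chi by (simp add: eqs cur)
      qed
    qed (simp add: eqs)
  next
    case (3 s' a' t')
    then have e: "s' 2 = s 7" by (auto simp: I_def same_except_def)
    have "t' + 1 \<le> t + 10 * s 0 + 1" using 3(1) assms(4) unfolding I_def e by linarith
    then show ?case using 3(1) unfolding I_def e by (elim conjE; intro conjI; assumption?)
  qed
qed

section \<open>Reconstruction of a solution from a forest of pairs\<close>

definition finish_code :: com where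
  "finish_code =
     Assign 2 (V 0) ;; off_code ;;
     Assign 2 (V 6) ;; greedy_code ;;
     Assign 2 (V 8) ;; base_code ;;
     Assign 2 (V 6) ;; push_code"

lemma sum_indicator_mult:
  fixes key :: "nat \<Rightarrow> nat"
  assumes "finite A" "T \<subseteq> A" "\<And>i. i \<in> A \<Longrightarrow> i \<notin> T \<Longrightarrow> b i = 0" "\<And>i. i \<in> T \<Longrightarrow> b i = 1"
  shows "(\<Sum>i\<in>A. b i * key i) = (\<Sum>i\<in>T. key i)"
proof -
  have "(\<Sum>i\<in>A. b i * key i) = (\<Sum>i\<in>T. b i * key i)"
    using assms by (intro sum.mono_neutral_right) auto
  also have "\<dots> = (\<Sum>i\<in>T. key i)" using assms(4) by (intro sum.cong) auto
  finally show ?thesis .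
qed

text \<open>Nodes from \<open>s 23\<close> on serve the greedy choice, and indices of key
  \<open>1\<close> between \<open>s 8\<close> and \<open>s 9\<close> serve the interval. No node has
  a part of either kind, so every index gets its bit from one source. The four passes account for
  \<open>3 + 5 + 12 + 4 = 24\<close> steps per unit of \<open>p\<close>.\<close>

lemma run_finish_code:
  assumes p: "1 \<le> s 0" "2 * s 0 + 1 < B" and x: "s 22 < s 0"
    and n: "s 0 \<le> s 23" "s 23 \<le> s 6" "s 6 \<le> 2 * s 0"
    and forest: "forest (s 0) (s 6) (a 2) (a 3) (a 15)"
    and ch: "\<And>i. s 0 \<le> i \<Longrightarrow> i < s 6 \<Longrightarrow> a 15 (a 2 i) < s 0 \<and> a 2 i < s 23 \<and> a 3 i < s 23 \<and>
        \<not> (s 8 \<le> a 2 i \<and> a 2 i < s 9 \<and> a 15 (a 2 i) = 1) \<and> \<not> (s 8 \<le> a 3 i \<and> a 3 i < s 9 \<and> a 15 (a 3 i) = 1)"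
    and bits: "\<And>i. 1 \<le> i \<Longrightarrow> i < s 6 \<Longrightarrow> a 0 i = 0"
    and b: "1 \<le> s 8" "s 8 \<le> s 9" "s 9 \<le> s 23" and base: "base = occ (a 15) (s 8) (s 9) 1"
    and key: "\<And>i. s 23 \<le> i \<Longrightarrow> i < s 6 \<Longrightarrow> a 15 i \<le> base"
    and tot: "s 0 \<le> base + (\<Sum>i\<in>{s 23..<s 6}. a 15 i)"
  shows "run B finish_code s a t (\<lambda>s' a' t'.
     t' \<le> t + 24 * s 0 + 8 \<and> a' 15 = a 15 \<and> (\<forall>i\<in>{1..<s 0}. a' 0 i \<le> 1) \<and>
     [(\<Sum>i\<in>{1..<s 0}. a' 0 i * a 15 i) = s 22] (mod s 0))"
proof -
  let ?Q = "\<lambda>(s'::vars) (a'::arrays) (t'::nat). t' \<le> t + 24 * s 0 + 8 \<and> a' 15 = a 15 \<and> (\<forall>i\<in>{1..<s 0}. a' 0 i \<le> 1) \<and>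
     [(\<Sum>i\<in>{1..<s 0}. a' 0 i * a 15 i) = s 22] (mod s 0)"
  have "run B off_code (s(2 := s 0)) a (t + 1) (\<lambda>s a t. run B (Assign 2 (V 6) ;; greedy_code ;;
     Assign 2 (V 8) ;; base_code ;; Assign 2 (V 6) ;; push_code) s a t ?Q)"
  proof (rule run_mono, rule run_off_code, goal_cases)
    case (5 i)
    have "a 2 i < 2 * s 0" using ch[of i] 5 n by force
    then show ?case using ch[of i] 5 by simp
  next
    case (6 s1 a1 t1)
    then have 1: "same_except {2, 22} s s1" "a1 = a" "t1 \<le> t + 3 * (s 6 - s 0) + 2" "s1 22 < s 0"
      "[(\<Sum>i\<in>{s 0..<s 6}. a 15 (a 2 i)) + s1 22 = s 22] (mod s 0)"
      by (simp_all add: same_except_def)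
    have e1: "s1 0 = s 0" "s1 6 = s 6" "s1 8 = s 8" "s1 9 = s 9" "s1 23 = s 23"
      using 1(1) by (simp_all add: same_except_def)
    have "run B greedy_code (s1(2 := s 6)) a (t1 + 1) (\<lambda>s a t. run B
      (Assign 2 (V 8) ;; base_code ;; Assign 2 (V 6) ;; push_code) s a t ?Q)"
    proof (rule run_mono, rule run_greedy_code[where base = base], goal_cases)
      case 4 then show ?case using key by (simp add: e1)
    next
      case 5 then show ?case using tot 1(4) by (simp add: e1)
    next
      case (6 s2 a2 t2)
      then obtain T where 2: "same_except {2, 22} s1 s2" "same_except {0} a a2" "t2 \<le> t1 + 5 * (s 6 - s 23) + 2"
        "s2 22 \<le> base" and T: "T \<subseteq> {s 23..<s 6}" "(\<Sum>i\<in>T. a 15 i) + s2 22 = s1 22"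
        "a2 0 = (\<lambda>i. if i \<in> T then 1 else a 0 i)"
        by (auto simp: same_except_def e1)
      have e2: "s2 0 = s 0" "s2 6 = s 6" "s2 8 = s 8" "s2 9 = s 9" "a2 15 = a 15" "a2 2 = a 2" "a2 3 = a 3"
        using 2(1,2) e1 by (simp_all add: same_except_def)
      have "run B base_code (s2(2 := s 8)) a2 (t2 + 1) (\<lambda>s a t. run B
        (Assign 2 (V 6) ;; push_code) s a t ?Q)"
      proof (rule run_mono, rule run_base_code, goal_cases)
        case 4 then show ?case using 2(4) base by (simp add: e2)
      next
        case (5 s3 a3 t3)
        then obtain U where 3: "same_except {2, 22} s2 s3" "same_except {0} a2 a3" "t3 \<le> t2 + 6 * (s 9 - s 8) + 2"
          and U: "U \<subseteq> {i \<in> {s 8..<s 9}. a 15 i = 1}" "card U = s2 22" "a3 0 = (\<lambda>i. if i \<in> U then 1 else a2 0 i)"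
          by (auto simp: same_except_def e2)
        have e3: "s3 0 = s 0" "s3 6 = s 6" "a3 15 = a 15" "a3 2 = a 2" "a3 3 = a 3"
          using 3(1,2) e2 by (simp_all add: same_except_def)
        have fU: "finite U" using U(1) finite_subset by fastforce
        have fT: "finite T" using T(1) finite_subset by fastforce
        have TU: "T \<inter> U = {}" using T(1) U(1) b by fastforce
        have bit: "a3 0 i = (if i \<in> T \<union> U then 1 else 0)" if "1 \<le> i" "i < s 6" for i
          using T(3) U(3) bits[OF that] by auto
        have "(\<Sum>i\<in>{1..<s 6}. a3 0 i * a 15 i) = (\<Sum>i\<in>T \<union> U. a 15 i)"
        proof (rule sum_indicator_mult)
          show "T \<union> U \<subseteq> {1..<s 6}" using T(1) U(1) p n b by fastforce
        next
          show "a3 0 i = 0" if "i \<in> {1..<s 6}" "i \<notin> T \<union> U" for i using bit[of i] that by auto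
          show "a3 0 i = 1" if "i \<in> T \<union> U" for i using T(3) U(3) that by auto
        qed simp
        also have "\<dots> = (\<Sum>i\<in>T. a 15 i) + (\<Sum>i\<in>U. a 15 i)" using fT fU TU by (rule sum.union_disjoint)
        also have "(\<Sum>i\<in>U. a 15 i) = (\<Sum>i\<in>U. 1)" using U(1) by (intro sum.cong) auto
        also have "(\<Sum>i\<in>T. a 15 i) + (\<Sum>i\<in>U. 1) = s1 22" using T(2) U(2) by simp
        finally have sm: "(\<Sum>i\<in>{1..<s 6}. a3 0 i * a 15 i) = s1 22" .
        have "run B push_code (s3(2 := s 6)) a3 (t3 + 1) ?Q"
        proof (rule run_mono, rule run_push_code, goal_cases)
          case 5 then show ?case using forest by (simp add: e3)
        next
          case (6 i) then show ?case using bit[of i] by (simp add: e3)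
        next
          case (7 i)
          then have i: "s 0 \<le> i" "i < s 6" by (simp_all add: e3)
          have f: "1 \<le> a 2 i" "1 \<le> a 3 i" "a 2 i < i" "a 3 i < i"
            using forest i unfolding forest_def by auto
          have "a 2 i \<notin> T \<union> U" "a 3 i \<notin> T \<union> U" using T(1) U(1) ch[OF i] by auto
          then show ?case using bit[of "a 2 i"] bit[of "a 3 i"] f i by (simp add: e3)
        next
          case (8 s4 a4 t4)
          then have 4: "same_except {0} a3 a4" "t4 \<le> t3 + 4 * (s 6 - s 0) + 2" "\<forall>i\<in>{1..<s 0}. a4 0 i \<le> 1"
            "[(\<Sum>i\<in>{1..<s 0}. a4 0 i * a 15 i) = s1 22 + (\<Sum>i\<in>{s 0..<s 6}. a 15 (a 2 i))] (mod s 0)"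
            using sm by (simp_all add: e3)
          have "[(\<Sum>i\<in>{1..<s 0}. a4 0 i * a 15 i) = s 22] (mod s 0)"
            using cong_trans[OF 4(4)] 1(5) by (simp add: add.commute)
          moreover have "t4 \<le> t + 24 * s 0 + 8" using 4(2) 3(3) 2(3) 1(3) n b by linarith
          moreover have "a4 15 = a 15" using 4(1) e3 by (simp add: same_except_def)
          ultimately show ?case using 4(3) by blast
        qed (use p n in \<open>simp_all add: e3\<close>)
        then show ?case by (simp add: e3)
      qed (use p n b in \<open>simp_all add: e2\<close>)
      then show ?case by (simp add: e2)
    qed (use p n in \<open>simp_all add: e1\<close>)
    then show ?case using 1(2) by (simp add: e1)
  qed (use p n x in simp_all)
  then show ?thesis by (simp add: finish_code_def)
qed

text \<open>At least \<open>card It - S * m\<close> items get paired. A pair is worth at least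
  \<open>8\<close>, that is \<open>4\<close> per item, so \<open>big\<close> makes the differences
  add up to \<open>s 0\<close> or more. The window length is the number of ones in reserve, which
  keeps every difference within reach of the interval as the greedy choice demands.\<close>

lemma run_phase2:
  assumes p: "1 \<le> s 0" "2 * s 0 + 1 < B" and x: "s 22 < s 0" and q: "s 13 = 8" and n23: "s 23 = s 6"
    and It: "It = {x \<in> {s 2..<s 11}. a 10 x = 0}"
    and n: "s 0 \<le> s 6" "0 < s 2" "s 2 \<le> s 11" "s 11 \<le> s 6" "s 6 + card It \<le> 2 * s 0"
    and forest: "forest (s 0) (s 6) (a 2) (a 3) (a 15)"
    and ch: "\<And>i. s 0 \<le> i \<Longrightarrow> i < s 6 \<Longrightarrow> a 15 (a 2 i) < s 0 \<and> a 2 i \<notin> It \<and> a 3 i \<notin> It \<and>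
        \<not> (s 8 \<le> a 2 i \<and> a 2 i < s 9 \<and> a 15 (a 2 i) = 1) \<and> \<not> (s 8 \<le> a 3 i \<and> a 3 i < s 9 \<and> a 15 (a 3 i) = 1)"
    and items: "\<And>x. x \<in> It \<Longrightarrow> a 15 x < s 0 \<and> \<not> (s 8 \<le> x \<and> x < s 9 \<and> a 15 x = 1)"
    and bits: "\<And>i. 1 \<le> i \<Longrightarrow> i < 2 * s 0 \<Longrightarrow> a 0 i = 0"
    and b: "1 \<le> s 8" "s 8 \<le> s 9" "s 9 \<le> s 6" and base: "s 12 = occ (a 15) (s 8) (s 9) 1" "0 < s 12"
    and str: "\<And>x. x \<in> It \<Longrightarrow> stream 8 (s 12) (a 15 x) < S" "S \<le> 2 * s 0"
    and mult: "\<And>k. card {x \<in> It. a 15 x = k} \<le> m" and big: "s 0 + 4 * (S * m) \<le> 4 * card It"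
    and h0: "\<And>c. c < 2 * s 0 \<Longrightarrow> a 7 c = 0"
  shows "run B (pair_code 7 10 ;; finish_code) s a t (\<lambda>s' a' t'.
     t' \<le> t + 64 * s 0 + 9 \<and> (\<forall>i\<in>{1..<s 0}. a' 0 i \<le> 1) \<and> (\<forall>i\<in>{1..<s 0}. a' 15 i = a 15 i) \<and>
     [(\<Sum>i\<in>{1..<s 0}. a' 0 i * a 15 i) = s 22] (mod s 0))"
proof -
  let ?Q = "\<lambda>(s'::vars) (a'::arrays) (t'::nat).
     t' \<le> t + 64 * s 0 + 9 \<and> (\<forall>i\<in>{1..<s 0}. a' 0 i \<le> 1) \<and> (\<forall>i\<in>{1..<s 0}. a' 15 i = a 15 i) \<and>
     [(\<Sum>i\<in>{1..<s 0}. a' 0 i * a 15 i) = s 22] (mod s 0)"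
  have str': "stream 8 (s 12) (a 15 x) < 2 * s 0" if "x \<in> It" for x using str(1)[OF that] str(2) by linarith
  have "run B (pair_code 7 10) s a t (\<lambda>s a t. run B finish_code s a t ?Q)"
  proof (rule run_mono, rule run_pair_code[where It = It], goal_cases)
    case (12 x) then show ?case using str' q by simp
  next
    case (14 s1 a1 t1)
    then obtain nxt head L where 1: "same_except {2, 5, 6, 21, 24, 25} s s1" "same_except {2, 3, 8, 15, 7} a a1"
     "t1 \<le> t + 20 * (s 11 - s 2) + 1" "s1 6 \<le> s 6 + card It" "\<forall>x<s 6. a1 2 x = a 2 x \<and> a1 3 x = a 3 x"
     and P: "pinv It (a 15) (s 13) (s 12) (s 6) (2 * s 0) (s 11) (s1 6) nxt head (a1 2) (a1 3) (a1 15) L"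
      by (elim exE conjE) (rule that)
    interpret P: pinv It "a 15" "s 13" "s 12" "s 6" "2 * s 0" "s 11" "s1 6" nxt head "a1 2" "a1 3" "a1 15" L
      by (rule P)
    have e1: "s1 0 = s 0" "s1 8 = s 8" "s1 9 = s 9" "s1 22 = s 22" "s1 23 = s 6" "a1 0 = a 0"
      using 1(1,2) n23 by (simp_all add: same_except_def)
    have fin: "finite It" unfolding It by simp
    have itn: "x < s 11" "x < s 6" "0 < x" if "x \<in> It" for x using that n unfolding It by auto
    have "card It \<le> 2 * (s1 6 - s 6) + S * m"
    proof (rule pinv_card[OF P fin])
      show "x < s 11 \<and> stream (s 13) (s 12) (a 15 x) < S" if "x \<in> It" for x
        using itn[OF that] str(1)[OF that] q by simp
    qed (rule mult)
    then have cnt: "s 0 \<le> 8 * (s1 6 - s 6)" using big by linarith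
    have old: "a1 15 x = a 15 x" if "x < s 6" for x using P.ky[OF that] .
    have old2: "a1 2 i = a 2 i" "a1 3 i = a 3 i" if "i < s 6" for i using 1(5) that by auto
    have F: "1 \<le> a 2 i \<and> a 2 i < i \<and> 1 \<le> a 3 i \<and> a 3 i < i \<and> a 2 i \<noteq> a 3 i \<and>
           [a 15 i + a 15 (a 2 i) = a 15 (a 3 i)] (mod s 0) \<and>
           (\<forall>j\<in>{s 0..<s 6}. j \<noteq> i \<longrightarrow> a 2 i \<noteq> a 2 j \<and> a 2 i \<noteq> a 3 j \<and> a 3 i \<noteq> a 3 j)"
          if "i \<in> {s 0..<s 6}" for i using forest that unfolding forest_def by (rule bspec)
    have N: "a1 2 i \<in> It" "a1 3 i \<in> It" "a1 2 i \<noteq> a1 3 i" "a1 15 i + a 15 (a1 2 i) = a 15 (a1 3 i)"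
      "8 \<le> a1 15 i" "a1 15 i < s 12"
      if "s 6 \<le> i" "i < s1 6" for i
      using P.child[OF that] P.diff[OF that] q by auto
    \<comment> \<open>Old nodes have no part in \<open>It\<close> and new nodes have both parts
      there, so only the disjointness within each kind needs an argument of its own.\<close>
    have forest': "forest (s 0) (s1 6) (a1 2) (a1 3) (a1 15)"
      unfolding forest_def
    proof
      fix i assume i: "i \<in> {s 0..<s1 6}"
      show "1 \<le> a1 2 i \<and> a1 2 i < i \<and> 1 \<le> a1 3 i \<and> a1 3 i < i \<and> a1 2 i \<noteq> a1 3 i \<and>
           [a1 15 i + a1 15 (a1 2 i) = a1 15 (a1 3 i)] (mod s 0) \<and>
           (\<forall>j\<in>{s 0..<s1 6}. j \<noteq> i \<longrightarrow> a1 2 i \<noteq> a1 2 j \<and> a1 2 i \<noteq> a1 3 j \<and> a1 3 i \<noteq> a1 3 j)"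
      proof (cases "i < s 6")
        case True
        have Fi: "1 \<le> a 2 i" "a 2 i < i" "1 \<le> a 3 i" "a 3 i < i" "a 2 i \<noteq> a 3 i"
           "[a 15 i + a 15 (a 2 i) = a 15 (a 3 i)] (mod s 0)"
           and Fd: "\<And>j. j \<in> {s 0..<s 6} \<Longrightarrow> j \<noteq> i \<Longrightarrow> a 2 i \<noteq> a 2 j \<and> a 2 i \<noteq> a 3 j \<and> a 3 i \<noteq> a 3 j"
          using F[of i] i True by auto
        have "a1 2 i \<noteq> a1 2 j \<and> a1 2 i \<noteq> a1 3 j \<and> a1 3 i \<noteq> a1 3 j" if j: "j \<in> {s 0..<s1 6}" "j \<noteq> i" for j
        proof (cases "j < s 6")
          case True then show ?thesis using Fd[of j] j \<open>i < s 6\<close> by (simp add: old2)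
        next
          case False
          then have "a1 2 j \<in> It" "a1 3 j \<in> It" using N(1,2)[of j] j by auto
          then show ?thesis using ch[of i] True i by (auto simp: old2)
        qed
        then show ?thesis using True Fi by (simp add: old old2)
      next
        case False
        then have i6: "s 6 \<le> i" "i < s1 6" using i by auto
        have "a1 2 i \<noteq> a1 2 j \<and> a1 2 i \<noteq> a1 3 j \<and> a1 3 i \<noteq> a1 3 j" if j: "j \<in> {s 0..<s1 6}" "j \<noteq> i" for j
        proof (cases "j < s 6")
          case True
          then show ?thesis using N(1,2)[OF i6] ch[of j] j by (auto simp: old2)
        next
          case False
          then show ?thesis using P.disj[of i j] i6 j by auto
        qed
        then show ?thesis using N[OF i6] itn[of "a1 2 i"] itn[of "a1 3 i"] i6
          by (auto simp: old)
      qed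
    qed
    have occ': "occ (a1 15) (s 8) (s 9) 1 = s 12"
    proof -
      have "{j \<in> {s 8..<s 9}. a1 15 j = 1} = {j \<in> {s 8..<s 9}. a 15 j = 1}" using old b by auto
      then show ?thesis using base by (simp add: occ_def)
    qed
    have "8 * (s1 6 - s 6) = (\<Sum>i\<in>{s 6..<s1 6}. 8)" by simp
    also have "\<dots> \<le> (\<Sum>i\<in>{s 6..<s1 6}. a1 15 i)" using N(5) by (intro sum_mono) auto
    finally have tot: "s 0 \<le> s 12 + (\<Sum>i\<in>{s 6..<s1 6}. a1 15 i)" using cnt by linarith
    show ?case
    proof (rule run_mono, rule run_finish_code[where base = "s 12"], goal_cases)
      case (8 i)
      then have i: "s 0 \<le> i" "i < s1 6" by (simp_all add: e1)
      show ?case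
      proof (cases "i < s 6")
        case True
        have "a 2 i < s 6" "a 3 i < s 6" using F[of i] i True by auto
        then show ?thesis using ch[of i] True i by (simp add: e1 old old2)
      next
        case False
        then have i6: "s 6 \<le> i" using i by simp
        show ?thesis using items[OF N(1)[OF i6 i(2)]] items[OF N(2)[OF i6 i(2)]]
            itn(2)[OF N(1)[OF i6 i(2)]] itn(2)[OF N(2)[OF i6 i(2)]] by (simp add: e1 old)
      qed
    next
      case (9 i) then show ?case using bits[of i] 1(4) n by (simp add: e1)
    next
      case (14 i) then show ?case using N(6)[of i] by (simp add: e1)
    next
      case (16 s2 a2 t2)
      have o: "a1 15 i = a 15 i" if "i \<in> {1..<s 0}" for i using old[of i] that n by simp
      have "t2 \<le> t1 + 24 * s 0 + 8" using 16 by (simp add: e1)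
      then have "t2 \<le> t + 64 * s 0 + 9" using 1(3) n by linarith
      moreover have "(\<Sum>i\<in>{1..<s 0}. a2 0 i * a1 15 i) = (\<Sum>i\<in>{1..<s 0}. a2 0 i * a 15 i)"
        using o by (intro sum.cong) auto
      ultimately show ?case using 16 o by (simp add: e1)
    qed (use p x n b occ' tot forest' 1(4) P.n in \<open>simp_all add: e1\<close>)
  qed (use p q It n base h0 in simp_all)
  then show ?thesis by simp
qed

section \<open>Small multiplicities\<close>

lemma nat_modular_inverse:
  assumes "prime p" "0 < u" "u < p" "w = nat (modular_inverse (int p) (int u))"
  shows "w < p" "[u * w = 1] (mod p)"
proof -
  have p: "p > 0" using assms(1) prime_gt_0_nat by blast
  have "coprime u p" using assms(1-3)
    by (metis coprime_commute nat_dvd_not_less prime_imp_coprime)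
  then have "coprime (int u) (int p)" by simp
  then have "[int u * modular_inverse (int p) (int u) = 1] (mod int p)" by (rule cong_modular_inverse1)
  moreover have m: "0 \<le> modular_inverse (int p) (int u)" "modular_inverse (int p) (int u) < int p"
    using p by (simp_all add: modular_inverse_int_nonneg modular_inverse_int_less)
  ultimately have "[int (u * w) = int 1] (mod int p)" using assms(4) by simp
  then show "[u * w = 1] (mod p)" using cong_int_iff by blast
  show "w < p" using m assms(4) by linarith
qed

lemma scale_inj:
  assumes "[u * w = 1] (mod p)" "x < p" "y < p" "x * w mod p = y * w mod (p::nat)"
  shows "x = y"
proof -
  have "[x * w * u = y * w * u] (mod p)"
    by (rule cong_mult[OF _ cong_refl]) (simp add: cong_def assms(4))
  moreover have "[z * w * u = z] (mod p)" for z
    using cong_mult[OF cong_refl assms(1), of z] by (simp add: mult_ac)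
  ultimately have "[x = y] (mod p)" by (meson cong_sym cong_trans)
  then show ?thesis using assms(2,3) by (simp add: cong_def)
qed

text \<open>Keys and target are multiplied by the same unit \<open>w\<close>; multiplying by its
  inverse \<open>u\<close> turns a solution of the scaled instance into one of the original
  instance.\<close>

lemma unscale_sum:
  fixes b f :: "nat \<Rightarrow> nat"
  assumes "[u * w = 1] (mod p)" "\<And>i. i \<in> A \<Longrightarrow> g i = f i * w mod p"
    "[(\<Sum>i\<in>A. b i * g i) = x * w mod p] (mod p)"
  shows "[(\<Sum>i\<in>A. b i * f i) = x] (mod p)"
proof -
  have z: "[z * w mod p * u = z] (mod p)" for z
  proof -
    have "[z * w mod p * u = z * w * u] (mod p)" by (intro cong_mult cong_refl) (simp add: cong_def)
    also have "[z * w * u = z] (mod p)"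
      using cong_mult[OF cong_refl assms(1), of z] by (simp add: mult_ac)
    finally show ?thesis .
  qed
  have "[(\<Sum>i\<in>A. b i * f i) = (\<Sum>i\<in>A. b i * (f i * w mod p * u))] (mod p)"
    by (intro cong_sum cong_mult cong_refl cong_sym[OF z])
  also have "(\<Sum>i\<in>A. b i * (f i * w mod p * u)) = (\<Sum>i\<in>A. b i * g i) * u"
    unfolding sum_distrib_right using assms(2) by (intro sum.cong) (auto simp: mult.assoc)
  also have "[(\<Sum>i\<in>A. b i * g i) * u = x * w mod p * u] (mod p)"
    using assms(3) by (intro cong_mult cong_refl)
  also have "[x * w mod p * u = x] (mod p)" by (rule z)
  finally show ?thesis .
qed

lemma occ_scale:
  assumes "[u * w = 1] (mod p)" "\<And>i. i \<in> {1..<p} \<Longrightarrow> f i < p \<and> g i = f i * w mod p"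
    "\<And>v. occ f 1 p v \<le> mu"
  shows "card {i \<in> {1..<p}. g i = k} \<le> mu"
proof (cases "{i \<in> {1..<p}. g i = k} = {}")
  case False
  then obtain j where j: "j \<in> {1..<p}" "g j = k" by auto
  have "{i \<in> {1..<p}. g i = k} \<subseteq> {i \<in> {1..<p}. f i = f j}"
  proof
    fix i assume "i \<in> {i \<in> {1..<p}. g i = k}"
    then have i: "i \<in> {1..<p}" "g i = g j" using j by auto
    then show "i \<in> {i \<in> {1..<p}. f i = f j}"
      using scale_inj[OF assms(1), of "f i" "f j"] assms(2)[of i] assms(2)[of j] j by auto
  qed
  then have "card {i \<in> {1..<p}. g i = k} \<le> card {i \<in> {1..<p}. f i = f j}" by (intro card_mono) auto
  then show ?thesis using assms(3)[of "f j"] by (simp add: occ_def)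
next
  case True
  then show ?thesis by (simp only: card.empty)
qed

text \<open>The situation after the first pairing, with \<open>n1\<close> the next free node. The
  last bound in \<open>n1\<close> says that each of at most \<open>(p - 1) div (8 * mu) + 1\<close>
  windows leaves at most \<open>mu\<close> elements unpaired.\<close>

locale level1 =
  fixes p mu n1 :: nat and a :: arrays
  assumes prime: "prime p" and mu: "0 < mu" "16384 * mu < p"
    and key: "i \<in> {1..<p} \<Longrightarrow> 1 \<le> a 15 i \<and> a 15 i < p"
    and ones: "occ (a 15) 1 p 1 = mu" and mult: "occ (a 15) 1 p v \<le> mu"
    and n1: "p \<le> n1" "2 * (n1 - p) \<le> p - 1" "p - 1 - mu \<le> 2 * (n1 - p) + ((p - 1) div (8 * mu) + 1) * mu"
    and node: "p \<le> i \<Longrightarrow> i < n1 \<Longrightarrow> a 2 i \<in> {1..<p} \<and> a 3 i \<in> {1..<p} \<and> a 15 (a 2 i) \<noteq> 1 \<and> a 15 (a 3 i) \<noteq> 1 \<and>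
      a 2 i \<noteq> a 3 i \<and> a 15 i + a 15 (a 2 i) = a 15 (a 3 i) \<and> 1 \<le> a 15 i \<and> a 15 i < 8 * mu"
    and disj: "p \<le> i \<Longrightarrow> i < n1 \<Longrightarrow> p \<le> j \<Longrightarrow> j < n1 \<Longrightarrow> j \<noteq> i \<Longrightarrow>
      a 2 i \<noteq> a 2 j \<and> a 2 i \<noteq> a 3 j \<and> a 3 i \<noteq> a 3 j"
    and zero: "1 \<le> i \<Longrightarrow> i < 2 * p \<Longrightarrow> a 0 i = 0" "i < 2 * p \<Longrightarrow> a 7 i = 0" "i < 2 * p \<Longrightarrow> a 10 i = 0"

section \<open>The two ways to continue after the first pairing\<close>

definition tail_code :: com where
  "tail_code = Assign 23 (V 6) ;; pair_code 7 10 ;; finish_code"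

definition mode2_code :: com where
  "mode2_code = Assign 8 (N 1) ;; Assign 9 (V 0) ;; Assign 2 (V 0) ;; Assign 12 (V 3)"

text \<open>Differences below \<open>8 * mu\<close> fall into 8 windows of length \<open>mu\<close>
  with 8 residues each. These 64 streams waste at most \<open>32 * mu\<close> nodes each,
  \<open>2048 * mu\<close> in all, which is less than \<open>p / 8\<close>.\<close>

lemma run_mode2:
  assumes "level1 (s 0) (s 3) (s 6) a" and s: "s 13 = 8" "s 11 = s 6" "s 22 < s 0" "2 * s 0 + 1 < B"
    and cnt: "\<And>v. v < 2 * s 0 \<Longrightarrow> occ (a 15) (s 0) (s 6) v \<le> 32 * s 3"
  shows "run B (mode2_code ;; tail_code) s a t (\<lambda>s' a' t'.
     t' \<le> t + 64 * s 0 + 14 \<and> (\<forall>i\<in>{1..<s 0}. a' 0 i \<le> 1) \<and>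
     [(\<Sum>i\<in>{1..<s 0}. a' 0 i * a 15 i) = s 22] (mod s 0))"
proof -
  interpret L: level1 "s 0" "s 3" "s 6" a by fact
  let ?s = "s(8 := 1, 9 := s 0, 2 := s 0, 12 := s 3, 23 := s 6)"
  define It where "It = {x \<in> {s 0..<s 6}. a 10 x = 0}"
  have It': "It = {s 0..<s 6}" unfolding It_def using L.zero(3) L.n1(2) by auto
  have "run B (pair_code 7 10 ;; finish_code) ?s a (Suc (Suc (Suc (Suc (Suc t))))) (\<lambda>s' a' t'.
     t' \<le> t + 64 * s 0 + 14 \<and> (\<forall>i\<in>{1..<s 0}. a' 0 i \<le> 1) \<and>
     [(\<Sum>i\<in>{1..<s 0}. a' 0 i * a 15 i) = s 22] (mod s 0))"
  proof (rule run_mono, rule run_phase2[where It = It and S = 64 and m = "32 * s 3"], goal_cases)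
    case 6 show ?case by (simp add: It_def s)
  next
    case 11 show ?case using L.n1(1,2) by (simp add: It')
  next
    case 12
    have "1 \<le> a 2 i \<and> a 2 i < i \<and> 1 \<le> a 3 i \<and> a 3 i < i \<and> a 2 i \<noteq> a 3 i \<and>
         [a 15 i + a 15 (a 2 i) = a 15 (a 3 i)] (mod s 0) \<and>
         (\<forall>j\<in>{s 0..<s 6}. j \<noteq> i \<longrightarrow> a 2 i \<noteq> a 2 j \<and> a 2 i \<noteq> a 3 j \<and> a 3 i \<noteq> a 3 j)" if "i \<in> {s 0..<s 6}" for i
      using that L.node[of i] L.disj[of i] by auto
    then show ?case by (simp add: forest_def)
  next
    case (13 i)
    then show ?case using L.node[of i] L.key[of "a 2 i"] by (auto simp: It')
  next
    case (14 x)
    then show ?case using L.node[of x] L.mu by (auto simp: It')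
  next
    case (15 i) then show ?case using L.zero(1)[of i] by simp
  next
    case 19 then show ?case using L.ones by simp
  next
    case (21 x)
    then have "a 15 x < 8 * s 3" using L.node[of x] by (auto simp: It')
    then have "a 15 x div s 3 < 8" using L.mu by (simp add: div_less_iff_less_mult)
    moreover have "a 15 x mod 8 < 8" by simp
    ultimately have "8 * (a 15 x div s 3) + a 15 x mod 8 < 64" by linarith
    then show ?case by (simp add: stream_def)
  next
    case 22 then show ?case using L.mu by simp
  next
    case (23 k)
    show ?case
    proof (cases "k < 2 * s 0")
      case True then show ?thesis using cnt[OF True] by (simp add: It' occ_def)
    next
      case False
      then have "a 15 x \<noteq> k" if "x \<in> It" for x using L.node[of x] L.mu that by (auto simp: It')
      then have "{x \<in> It. a 15 x = k} = {}" by auto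
      then show ?thesis by (simp only: card.empty)
    qed
  next
    case 24
    \<comment> \<open>Up to one window, \<open>z\<close> is the waste of the first pairing; it is at
      most an eighth of \<open>p - 1\<close>. What remains to be shown is
      \<open>p + 8192 * mu \<le> 4 * (n1 - p)\<close>.\<close>
    define z where "z = (s 0 - 1) div (8 * s 3) * s 3"
    have "8 * z \<le> s 0 - 1" unfolding z_def using div_times_less_eq_dividend[of "s 0 - 1" "8 * s 3"] by (simp add: mult_ac)
    moreover have "s 0 - 1 - s 3 \<le> 2 * (s 6 - s 0) + z + s 3" using L.n1(3) by (simp add: z_def algebra_simps)
    ultimately have "s 0 + 4 * (64 * (32 * s 3)) \<le> 4 * (s 6 - s 0)" using L.mu by linarith
    then show ?case by (simp add: It')
  next
    case (25 c) then show ?case using L.zero(2)[of c] by simp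
  qed (use s L.n1 L.mu in \<open>simp_all add: It'\<close>)
  then show ?thesis using s by (simp add: mode2_code_def tail_code_def)
qed

text \<open>After division by the frequent difference every kept pair is worth \<open>1\<close>, so
  the kept nodes, between the indices in \<open>8\<close> and \<open>9\<close>, replace the elements
  of key \<open>1\<close> as the source of the interval. The former ones become ordinary items.
  Variable \<open>26\<close> turns from a number of pairs into an index bound.\<close>

definition mode1_code :: com where
  "mode1_code =
     Assign 12 (V 26) ;; Assign 26 (Plus (V 0) (V 26)) ;; Assign 2 (V 0) ;; Assign 6 (V 0) ;; keep_code ;;
     Assign 4 (Inv (V 0) (V 4)) ;; Assign 2 (N 1) ;; scale_code 15 ;;
     Assign 22 (Modulo (Times (V 22) (V 4)) (V 0)) ;;
     Assign 8 (V 0) ;; Assign 9 (V 6) ;; Assign 2 (N 1) ;; Assign 11 (V 0)"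

text \<open>Division by \<open>u\<close> does not increase multiplicities, so each of the
  \<open>S\<close> streams still wastes at most \<open>mu\<close> elements, which makes at most
  \<open>(p - 1) / 4 + 8 * mu\<close> in total. The kept pairs take another \<open>64 * mu\<close>
  elements, and at \<open>4\<close> per element the remaining ones suffice.\<close>

lemma run_mode1_tail:
  assumes "level1 p mu n1 a" and u: "1 \<le> u" "u < p" and w: "w < p" "[u * w = 1] (mod p)"
    and s: "s 0 = p" "s 12 = 32 * mu" "s 6 = p + 32 * mu" "s 8 = p" "s 9 = s 6" "s 2 = 1" "s 11 = p" "s 13 = 8"
      "s 22 = x * w mod p" "s 23 = s 6" and B: "2 * p + 1 < B"
    and old: "\<And>i. 1 \<le> i \<Longrightarrow> i < 2 * p \<Longrightarrow> b 0 i = 0" "b 7 = a 7"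
    and ky: "\<And>i. i \<in> {1..<p} \<Longrightarrow> b 15 i = a 15 i * w mod p"
    and fl: "\<And>x. x < 2 * p \<Longrightarrow> b 10 x = (if \<exists>m. p \<le> m \<and> m < p + 32 * mu \<and> (x = b 2 m \<or> x = b 3 m) then 1 else 0)"
    and f: "\<And>m. p \<le> m \<Longrightarrow> m < p + 32 * mu \<Longrightarrow> p \<le> f m \<and> f m < n1 \<and> a 15 (f m) = u \<and> b 15 m = 1 \<and>
        b 2 m = a 2 (f m) \<and> b 3 m = a 3 (f m)"
    and finj: "\<And>m m'. p \<le> m \<Longrightarrow> m < p + 32 * mu \<Longrightarrow> p \<le> m' \<Longrightarrow> m' < p + 32 * mu \<Longrightarrow> m' \<noteq> m \<Longrightarrow> f m' \<noteq> f m"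
  shows "run B (pair_code 7 10 ;; finish_code) s b t (\<lambda>s' a' t'.
     t' \<le> t + 64 * p + 9 \<and> (\<forall>i\<in>{1..<p}. a' 0 i \<le> 1) \<and> [(\<Sum>i\<in>{1..<p}. a' 0 i * a 15 i) = x] (mod p))"
proof -
  interpret L: level1 p mu n1 a by fact
  let ?n = "p + 32 * mu"
  define It where "It = {x \<in> {1..<p}. b 10 x = 0}"
  have p0: "0 < p" using L.mu by simp
  have ch: "b 2 m \<in> {1..<p}" "b 3 m \<in> {1..<p}" "b 2 m \<noteq> b 3 m" "u + a 15 (b 2 m) = a 15 (b 3 m)" if "p \<le> m" "m < ?n" for m
    using f[OF that] L.node[of "f m"] by auto
  have dj: "b 2 m \<noteq> b 2 m' \<and> b 2 m \<noteq> b 3 m' \<and> b 3 m \<noteq> b 3 m'" if "p \<le> m" "m < ?n" "p \<le> m'" "m' < ?n" "m' \<noteq> m" for m m'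
    using f[OF that(1,2)] f[OF that(3,4)] finj[OF that] L.disj[of "f m" "f m'"] by auto
  have key: "b 15 i < p" if "i \<in> {1..<p}" for i using ky[OF that] p0 by simp
  have ch1: "1 \<le> b 2 m \<and> b 2 m < m \<and> 1 \<le> b 3 m \<and> b 3 m < m" if "p \<le> m" "m < ?n" for m
    using ch(1,2)[OF that] that by auto
  have flag: "b 2 m \<notin> It \<and> b 3 m \<notin> It" if "p \<le> m" "m < ?n" for m
  proof -
    have "b 10 (b 2 m) = 1" "b 10 (b 3 m) = 1" using fl[of "b 2 m"] fl[of "b 3 m"] ch(1,2)[OF that] that by auto
    then show ?thesis by (simp add: It_def)
  qed
  have forest: "forest p ?n (b 2) (b 3) (b 15)"
    unfolding forest_def
  proof
    fix m assume m: "m \<in> {p..<?n}"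
    then have m': "p \<le> m" "m < ?n" by auto
    have "[b 15 m + b 15 (b 2 m) = 1 + a 15 (b 2 m) * w] (mod p)"
      using f[OF m'] ky[OF ch(1)[OF m']] by (simp add: cong_def mod_simps)
    also have "[1 + a 15 (b 2 m) * w = u * w + a 15 (b 2 m) * w] (mod p)"
      by (intro cong_add cong_refl cong_sym[OF w(2)])
    also have "u * w + a 15 (b 2 m) * w = a 15 (b 3 m) * w" using ch(4)[OF m'] by (metis add_mult_distrib)
    also have "[a 15 (b 3 m) * w = b 15 (b 3 m)] (mod p)" using ky[OF ch(2)[OF m']] by (simp add: cong_def)
    finally have "[b 15 m + b 15 (b 2 m) = b 15 (b 3 m)] (mod p)" .
    then show "1 \<le> b 2 m \<and> b 2 m < m \<and> 1 \<le> b 3 m \<and> b 3 m < m \<and> b 2 m \<noteq> b 3 m \<and>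
       [b 15 m + b 15 (b 2 m) = b 15 (b 3 m)] (mod p) \<and>
       (\<forall>j\<in>{p..<?n}. j \<noteq> m \<longrightarrow> b 2 m \<noteq> b 2 j \<and> b 2 m \<noteq> b 3 j \<and> b 3 m \<noteq> b 3 j)"
      using ch1[OF m'] ch(3)[OF m'] dj[OF m'] by auto
  qed
  have fin: "finite It" by (simp add: It_def)
  have Itsub: "It \<subseteq> {1..<p}" by (auto simp: It_def)
  \<comment> \<open>New nodes start at index \<open>p + 32 * mu\<close>; they fit below
    \<open>2 * p\<close> because the kept pairs have withdrawn at least \<open>32 * mu\<close>
    elements, as their smaller parts already show.\<close>
  have upper: "card It + 32 * mu \<le> p - 1"
  proof -
    have "inj_on (b 2) {p..<?n}"
    proof (rule inj_onI)
      fix x y assume "x \<in> {p..<?n}" "y \<in> {p..<?n}" "b 2 x = b 2 y"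
      then show "x = y" using dj[of x y] by auto
    qed
    then have c: "card (b 2 ` {p..<?n}) = 32 * mu" by (simp add: card_image)
    have "It \<union> b 2 ` {p..<?n} \<subseteq> {1..<p}" using Itsub ch(1) by auto
    then have "card (It \<union> b 2 ` {p..<?n}) \<le> card {1..<p}" by (intro card_mono) auto
    moreover have "It \<inter> b 2 ` {p..<?n} = {}" using flag by auto
    ultimately show ?thesis using c fin by (simp add: card_Un_disjoint)
  qed
  have lower: "p - 1 \<le> card It + 64 * mu"
  proof -
    have "{1..<p} \<subseteq> It \<union> (b 2 ` {p..<?n} \<union> b 3 ` {p..<?n})"
    proof
      fix x assume x: "x \<in> {1..<p}"
      show "x \<in> It \<union> (b 2 ` {p..<?n} \<union> b 3 ` {p..<?n})"
      proof (cases "b 10 x = 0")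
        case True then show ?thesis using x by (simp add: It_def)
      next
        case False
        have "b 10 x = (if \<exists>m. p \<le> m \<and> m < p + 32 * mu \<and> (x = b 2 m \<or> x = b 3 m) then 1 else 0)"
          using fl[of x] x by simp
        then have "\<exists>m. p \<le> m \<and> m < ?n \<and> (x = b 2 m \<or> x = b 3 m)" using False by presburger
        then show ?thesis by auto
      qed
    qed
    then have "card {1..<p} \<le> card (It \<union> (b 2 ` {p..<?n} \<union> b 3 ` {p..<?n}))" using fin by (intro card_mono) auto
    also have "\<dots> \<le> card It + (card (b 2 ` {p..<?n}) + card (b 3 ` {p..<?n}))"
      by (meson card_Un_le add_le_mono order_refl order_trans)
    also have "\<dots> \<le> card It + (card {p..<?n} + card {p..<?n})"
      by (intro add_mono order_refl card_image_le) auto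
    finally show ?thesis by simp
  qed
  define z where "z = (p - 1) div (32 * mu) * mu"
  have z: "32 * z \<le> p - 1" unfolding z_def using div_times_less_eq_dividend[of "p - 1" "32 * mu"] by (simp add: mult_ac)
  define S where "S = 8 * ((p - 1) div (32 * mu) + 1)"
  have Sm: "S * mu = 8 * z + 8 * mu" by (simp add: S_def z_def algebra_simps)
  have "run B (pair_code 7 10 ;; finish_code) s b t (\<lambda>s' a' t'.
     t' \<le> t + 64 * p + 9 \<and> (\<forall>i\<in>{1..<p}. a' 0 i \<le> 1) \<and> (\<forall>i\<in>{1..<p}. a' 15 i = b 15 i) \<and>
     [(\<Sum>i\<in>{1..<p}. a' 0 i * b 15 i) = x * w mod p] (mod p))"
  proof (rule run_mono, rule run_phase2[where It = It and S = S and m = mu], goal_cases)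
    case 6 show ?case by (simp add: It_def s)
  next
    case 11 show ?case using upper L.mu s by simp
  next
    case 12 show ?case using forest s by simp
  next
    case (13 i)
    then have i: "p \<le> i" "i < ?n" using s by auto
    show ?case using flag[OF i] key[OF ch(1)[OF i]] ch(1,2)[OF i] s by auto
  next
    case (14 x)
    then show ?case using Itsub key[of x] s by auto
  next
    case (15 i) then show ?case using old(1)[of i] s by simp
  next
    case 19
    have "{j \<in> {p..<?n}. b 15 j = 1} = {p..<?n}" using f by auto
    then show ?case using s by (simp add: occ_def)
  next
    case (21 x)
    then have "b 15 x \<le> p - 1" using key[of x] Itsub by auto
    then have "b 15 x div (32 * mu) \<le> (p - 1) div (32 * mu)" by (rule div_le_mono)
    moreover have "b 15 x mod 8 < 8" by simp
    moreover have "A \<le> C \<Longrightarrow> m < 8 \<Longrightarrow> 8 * A + m < 8 * (C + 1)" for A C m :: nat by simp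
    ultimately show ?case unfolding stream_def S_def s by blast
  next
    case 22
    have "(p - 1) div (32 * mu) \<le> (p - 1) div 32" using L.mu by (intro div_le_mono2) auto
    then have "(p - 1) div (32 * mu) * 32 \<le> p - 1" by linarith
    moreover have "8 * (D + 1) \<le> 2 * p" if "D * 32 \<le> p - 1" for D :: nat
    proof -
      have "16384 \<le> 16384 * mu" using L.mu by simp
      then have "16384 < p" using L.mu by linarith
      moreover have "32 * D \<le> p" using that by simp
      ultimately show ?thesis by simp
    qed
    ultimately show ?case unfolding S_def s by blast
  next
    case (23 k)
    have "card {x \<in> It. b 15 x = k} \<le> card {i \<in> {1..<p}. b 15 i = k}" using Itsub by (intro card_mono) auto
    also have "\<dots> \<le> mu" using w(2) by (rule occ_scale[where f = "a 15"]) (use L.key ky L.mult in auto)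
    finally show ?case .
  next
    case 24
    have "32 * z + 1 \<le> p" "p \<le> card It + 64 * mu + 1" using z lower p0 by (simp_all add: Suc_le_eq)
    then show ?case unfolding Sm s using L.mu by simp
  next
    case (25 c) then show ?case using L.zero(2)[of c] s old by simp
  next
    case (26 s' a' t') then show ?case using s by simp
  qed (use s L.mu p0 B in simp_all)
  then show ?thesis
    by (rule run_mono) (use unscale_sum[OF w(2), of "{1..<p}" "b 15" "a 15"] ky in auto)
qed

lemma run_mode1:
  assumes "level1 (s 0) (s 3) (s 6) a" and s: "s 13 = 8" "s 7 = s 6" "s 22 < s 0" "s 26 = 32 * s 3"
    and B: "s 0 * s 0 < B" "2 * s 0 + 1 < B" and u: "s 4 \<in> a 15 ` {s 0..<s 6}"
    and cnt: "32 * s 3 \<le> occ (a 15) (s 0) (s 6) (s 4)"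
  shows "run B (mode1_code ;; tail_code) s a t (\<lambda>s' a' t'.
     t' \<le> t + 80 * s 0 + 30 \<and> (\<forall>i\<in>{1..<s 0}. a' 0 i \<le> 1) \<and>
     [(\<Sum>i\<in>{1..<s 0}. a' 0 i * a 15 i) = s 22] (mod s 0))"
proof -
  interpret L: level1 "s 0" "s 3" "s 6" a by fact
  define p where "p = s 0"
  define mu where "mu = s 3"
  define n1 where "n1 = s 6"
  define x where "x = s 22"
  define u where "u = s 4"
  define w where "w = nat (modular_inverse (int p) (int u))"
  note d = p_def mu_def n1_def x_def u_def
  have mu: "0 < mu" "16384 * mu < p" using L.mu by (simp_all add: d)
  obtain j where j: "s 0 \<le> j" "j < s 6" "s 4 = a 15 j" using u by auto
  have u1: "1 \<le> u" "u < p" using L.node[OF j(1,2)] L.mu j(3) by (auto simp: d)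
  have w: "w < p" "[u * w = 1] (mod p)"
    using nat_modular_inverse[of p u w] u1 L.prime by (auto simp: d w_def)
  have n1: "p \<le> n1" "n1 \<le> 2 * p" using L.n1 by (simp_all add: d)
  have pB: "i * j < B" if "i < p" "j < p" for i j
    using mult_strict_mono[of i p j p] that B(1) by (simp add: d)
  let ?Q = "\<lambda>(s'::vars) (a'::arrays) (t'::nat). t' \<le> t + 80 * p + 30 \<and> (\<forall>i\<in>{1..<p}. a' 0 i \<le> 1) \<and>
     [(\<Sum>i\<in>{1..<p}. a' 0 i * a 15 i) = x] (mod p)"
  let ?c2 = "Assign 22 (Modulo (Times (V 22) (V 4)) (V 0)) ;;
     Assign 8 (V 0) ;; Assign 9 (V 6) ;; Assign 2 (N 1) ;; Assign 11 (V 0) ;; tail_code"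
  let ?c1 = "Assign 4 (Inv (V 0) (V 4)) ;; Assign 2 (N 1) ;; scale_code 15 ;; ?c2"
  let ?s = "s(12 := 32 * mu, 26 := p + 32 * mu, 2 := p, 6 := p)"
  have "run B keep_code ?s a (Suc (Suc (Suc (Suc t)))) (\<lambda>s a t. run B ?c1 s a t ?Q)"
  proof (rule run_mono, rule run_keep_code, goal_cases)
    case (7 i)
    then show ?case using L.node[of i] s by (auto simp: d)
  next
    case (8 x) then show ?case using L.zero(3)[of x] by simp
  next
    case (9 s1 a1 t1)
    then have k: "same_except {2, 6} ?s s1" "same_except {2, 3, 10, 15} a a1" "t1 \<le> t + 4 + 10 * p + 1"
     "s1 6 = p + min (32 * mu) (occ (a 15) p n1 u)" "\<forall>x<p. a1 15 x = a 15 x"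
     "\<forall>x<2 * p. a1 10 x = (if \<exists>m. p \<le> m \<and> m < s1 6 \<and> (x = a1 2 m \<or> x = a1 3 m) then 1 else 0)"
      using s by (simp_all add: d)
    have "\<exists>f. \<forall>m. p \<le> m \<longrightarrow> m < s1 6 \<longrightarrow> p \<le> f m \<and> f m < n1 \<and> a 15 (f m) = u \<and> a1 15 m = 1 \<and>
        a1 2 m = a 2 (f m) \<and> a1 3 m = a 3 (f m) \<and> (\<forall>m'. p \<le> m' \<longrightarrow> m' < s1 6 \<longrightarrow> m' \<noteq> m \<longrightarrow> f m' \<noteq> f m)"
      using 9[THEN conjunct2, THEN conjunct2, THEN conjunct2, THEN conjunct2, THEN conjunct2, THEN conjunct2] s
      by (simp add: d)
    then obtain f where f: "\<forall>m. p \<le> m \<longrightarrow> m < s1 6 \<longrightarrow> p \<le> f m \<and> f m < n1 \<and> a 15 (f m) = u \<and> a1 15 m = 1 \<and>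
        a1 2 m = a 2 (f m) \<and> a1 3 m = a 3 (f m) \<and> (\<forall>m'. p \<le> m' \<longrightarrow> m' < s1 6 \<longrightarrow> m' \<noteq> m \<longrightarrow> f m' \<noteq> f m)"
      by (elim exE) (rule that)
    have s16: "s1 6 = p + 32 * mu" using k(4) cnt by (simp add: d)
    have e1: "s1 0 = p" "s1 4 = u" "s1 22 = x" "s1 12 = 32 * mu" "s1 13 = 8" "a1 0 = a 0" "a1 7 = a 7"
      using k(1,2) s by (simp_all add: same_except_def d)
    have "run B (scale_code 15) (s1(4 := w, 2 := 1)) a1 (Suc (Suc t1)) (\<lambda>s a t. run B ?c2 s a t ?Q)"
    proof (rule run_mono, rule run_scale_code, goal_cases)
      case (5 i)
      then show ?case using pB[of "a1 15 i" w] k(5) L.key[of i] w(1) e1 by (simp add: d)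
    next
      case (6 s2 a2 t2)
      then have h: "same_except {2} (s1(4 := w, 2 := 1)) s2" "same_except {0, 15} a1 a2" "t2 \<le> t1 + 2 + 4 * p + 1"
       "\<forall>i. a2 15 i = (if 1 \<le> i \<and> i < p then a1 15 i * w mod p else a1 15 i)"
       "\<forall>i. a2 0 i = (if 1 \<le> i \<and> i < p then 0 else a1 0 i)"
        by (simp_all add: e1)
      have e2: "s2 0 = p" "s2 4 = w" "s2 22 = x" "s2 12 = 32 * mu" "s2 13 = 8" "s2 6 = p + 32 * mu"
        "a2 7 = a 7" "a2 2 = a1 2" "a2 3 = a1 3" "a2 10 = a1 10"
        using h(1,2) e1 s16 by (simp_all add: same_except_def)
      have xw: "x * w < B" using pB[of x w] w(1) s(3) by (simp add: d)
      let ?s3 = "s2(22 := x * w mod p, 8 := p, 9 := p + 32 * mu, 2 := 1, 11 := p, 23 := p + 32 * mu)"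
      have "run B (pair_code 7 10 ;; finish_code) ?s3 a2 (Suc (Suc (Suc (Suc (Suc (Suc t2)))))) ?Q"
      proof (rule run_mono, rule run_mode1_tail[where a = a and p = p and mu = mu and ?n1.0 = n1 and u = u and w = w and x = x and f = f], goal_cases)
        case 1 show ?case using assms(1) by (simp add: d)
      next
        case (17 i) then show ?case using L.zero(1)[of i] h(5) e1 by (simp add: d)
      next
        case (19 i) then show ?case using h(4) k(5) by auto
      next
        case (20 y) then show ?case using k(6) s16 by (simp add: e2)
      next
        case (21 m) then show ?case using f s16 h(4) by (simp add: e2)
      next
        case (22 m m') then show ?case using f[THEN spec, of m] s16 by simp
      next
        case (23 s' a' t') then show ?case using h(3) k(3) by auto
      qed (use e2 u1 w B in \<open>simp_all add: d\<close>)
      moreover have "1 < B" using B(2) mu by linarith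
      ultimately show ?case using xw by (simp add: tail_code_def e2)
    qed (use mu B in \<open>simp_all add: e1 d\<close>)
    moreover have "1 < B" using B(2) by linarith
    ultimately show ?case using mu by (simp add: e1 w_def)
  qed (use mu n1 s B in \<open>simp_all add: d\<close>)
  moreover have "s 0 + 32 * s 3 < B" using B(2) mu by (simp add: d)
  ultimately show ?thesis using s by (simp add: mode1_code_def d)
qed

text \<open>With residue modulus \<open>1\<close> a stream is just a window, and different keys in
  it always have a usable difference. The second count looks for the most frequent difference, which
  decides between the two ways to continue.\<close>

definition case2_code :: com where
  "case2_code =
     Assign 2 (N 1) ;; flag_code ;;
     Assign 2 (N 1) ;; Assign 11 (V 0) ;; Assign 6 (V 0) ;; Assign 12 (Times (N 8) (V 3)) ;; Assign 13 (N 1) ;;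
     pair_code 6 9 ;;
     Assign 7 (V 6) ;; Assign 2 (V 0) ;; Assign 11 (V 6) ;; Assign 14 (N 0) ;; count_code 15 5 ;;
     Assign 13 (N 8) ;; Assign 26 (Times (N 32) (V 3)) ;;
     If (Less (V 14) (V 26)) (mode2_code ;; tail_code) (mode1_code ;; tail_code)"

lemma occ_cong: "(\<And>i. l \<le> i \<Longrightarrow> i < h \<Longrightarrow> f i = g i) \<Longrightarrow> occ f l h v = occ g l h v"
  unfolding occ_def by (rule arg_cong[where f = card]) auto

lemma run_case2:
  assumes prime: "prime (s 0)" and mu: "0 < s 3" "16384 * s 3 < s 0" and x: "s 22 < s 0"
    and B: "s 0 * s 0 < B" "2 * s 0 + 1 < B"
    and key: "\<And>i. i \<in> {1..<s 0} \<Longrightarrow> 1 \<le> a 15 i \<and> a 15 i < s 0"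
    and ones: "occ (a 15) 1 (s 0) 1 = s 3" and mult: "\<And>v. occ (a 15) 1 (s 0) v \<le> s 3"
    and zero: "\<And>i. 1 \<le> i \<Longrightarrow> i < 2 * s 0 \<Longrightarrow> a 0 i = 0"
      "\<And>k i. k \<in> {5, 6, 7, 9, 10} \<Longrightarrow> i < 2 * s 0 \<Longrightarrow> a k i = 0"
  shows "run B case2_code s a t (\<lambda>s' a' t'.
     t' \<le> t + 120 * s 0 + 60 \<and> (\<forall>i\<in>{1..<s 0}. a' 0 i \<le> 1) \<and>
     [(\<Sum>i\<in>{1..<s 0}. a' 0 i * a 15 i) = s 22] (mod s 0))"
proof -
  define p where "p = s 0"
  define mu' where "mu' = s 3"
  note d = p_def mu'_def
  have p: "16384 * mu' < p" "0 < mu'" using mu by (simp_all add: d)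
  have p1: "16384 < p" using p by linarith
  let ?Q = "\<lambda>(s'::vars) (a'::arrays) (t'::nat). t' \<le> t + 120 * p + 60 \<and> (\<forall>i\<in>{1..<p}. a' 0 i \<le> 1) \<and>
     [(\<Sum>i\<in>{1..<p}. a' 0 i * a 15 i) = s 22] (mod p)"
  let ?c3 = "Assign 13 (N 8) ;; Assign 26 (Times (N 32) (V 3)) ;;
     If (Less (V 14) (V 26)) (mode2_code ;; tail_code) (mode1_code ;; tail_code)"
  let ?c2 = "Assign 7 (V 6) ;; Assign 2 (V 0) ;; Assign 11 (V 6) ;; Assign 14 (N 0) ;; count_code 15 5 ;; ?c3"
  let ?c1 = "Assign 2 (N 1) ;; Assign 11 (V 0) ;; Assign 6 (V 0) ;; Assign 12 (Times (N 8) (V 3)) ;; Assign 13 (N 1) ;;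
     pair_code 6 9 ;; ?c2"
  have "run B flag_code (s(2 := 1)) a (Suc t) (\<lambda>s a t. run B ?c1 s a t ?Q)"
  proof (rule run_mono, rule run_flag_code, goal_cases)
    case (4 i) then show ?case using zero(2)[of 9 i] by simp
  next
    case (5 s1 a1 t1)
    then have h1: "same_except {2} (s(2 := 1)) s1" "same_except {9} a a1" "t1 \<le> t + 1 + 4 * p + 1"
     "\<forall>i. 1 \<le> i \<longrightarrow> i < p \<longrightarrow> a1 9 i = (if a 15 i = 1 then 1 else 0)"
      by (simp_all add: d)
    have e1: "s1 0 = p" "s1 3 = mu'" "s1 22 = s 22" "\<And>k. k \<noteq> 9 \<Longrightarrow> a1 k = a k"
      using h1(1,2) by (simp_all add: same_except_def d)
    define It where "It = {i \<in> {1..<p}. a 15 i \<noteq> 1}"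
    have It': "It = {x \<in> {1..<p}. a1 9 x = 0}" unfolding It_def using h1(4) by auto
    have fin: "finite It" by (simp add: It_def)
    have cIt: "card It = p - 1 - mu'"
    proof -
      have "It = {1..<p} - {i \<in> {1..<p}. a 15 i = 1}" by (auto simp: It_def)
      moreover have "card ({1..<p} - {i \<in> {1..<p}. a 15 i = 1}) = card {1..<p} - card {i \<in> {1..<p}. a 15 i = 1}"
        by (rule card_Diff_subset) auto
      moreover have "card {i \<in> {1..<p}. a 15 i = 1} = mu'" using ones by (simp add: occ_def d)
      ultimately show ?thesis by (simp only: card_atLeastLessThan)
    qed
    have stream: "stream 1 (8 * mu') k = k div (8 * mu')" for k by (simp add: stream_def)
    let ?s2 = "s1(2 := 1, 11 := p, 6 := p, 12 := 8 * mu', 13 := 1)"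
    have "run B (pair_code 6 9) ?s2 a1 (Suc (Suc (Suc (Suc (Suc t1))))) (\<lambda>s a t. run B ?c2 s a t ?Q)"
    proof (rule run_mono, rule run_pair_code[where It = It], goal_cases)
      case 3 show ?case by (simp add: It')
    next
      case 7 show ?case using cIt by (simp add: e1)
    next
      case 11 show ?case using B by (simp add: e1 d)
    next
      case (12 x)
      then have "a 15 x < p" using key[of x] by (simp add: It_def d)
      moreover have "a 15 x div (8 * mu') \<le> a 15 x" by simp
      ultimately have "a 15 x div (8 * mu') < 2 * p" by linarith
      then show ?case by (simp add: e1 stream[unfolded One_nat_def])
    next
      case (13 c) then show ?case using zero(2)[of 6 c] by (simp add: e1 d)
    next
      case (14 s2 a2 t2)
      then obtain nxt head L where h2: "same_except {2, 5, 6, 21, 24, 25} ?s2 s2" "same_except {2, 3, 8, 15, 6} a1 a2"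
        "t2 \<le> t1 + 5 + 20 * (p - 1) + 1" "s2 6 \<le> p + card It"
        and P: "pinv It (a 15) 1 (8 * mu') p (2 * p) p (s2 6) nxt head (a2 2) (a2 3) (a2 15) L"
        by (auto simp: e1)
      interpret P: pinv It "a 15" 1 "8 * mu'" p "2 * p" p "s2 6" nxt head "a2 2" "a2 3" "a2 15" L
        by (rule P)
      define n1 where "n1 = s2 6"
      have e2: "s2 0 = p" "s2 3 = mu'" "s2 22 = s 22"
        using h2(1) e1 by (simp_all add: same_except_def)
      have a2: "a2 k = a k" if "k \<in> {0, 5, 7, 10}" for k
        using h2(2) e1(4)[of k] that by (auto simp: same_except_def)
      have old: "a2 15 i = a 15 i" if "i < p" for i using P.ky[OF that] .
      have occ2: "occ (a2 15) 1 p v = occ (a 15) 1 p v" for v using old by (rule occ_cong)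
      have n1a: "p \<le> n1" using P.n by (simp add: n1_def)
      have lt: "{x \<in> It. x < p} = It" by (auto simp: It_def)
      have n1b: "2 * (n1 - p) \<le> p - 1" using P.card cIt by (simp add: n1_def lt)
      have n1c: "p - 1 - mu' \<le> 2 * (n1 - p) + ((p - 1) div (8 * mu') + 1) * mu'"
      proof -
        have "card It \<le> 2 * (s2 6 - p) + ((p - 1) div (8 * mu') + 1) * mu'"
        proof (rule pinv_card[OF P fin])
          fix x assume x: "x \<in> It"
          then have "a 15 x \<le> p - 1" using key[of x] by (auto simp: It_def d)
          then have "a 15 x div (8 * mu') \<le> (p - 1) div (8 * mu')" by (rule div_le_mono)
          then show "x < p \<and> stream 1 (8 * mu') (a 15 x) < (p - 1) div (8 * mu') + 1"
            using x by (simp add: stream[unfolded One_nat_def] It_def)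
        next
          fix k
          have "card {x \<in> It. a 15 x = k} \<le> card {j \<in> {1..<p}. a 15 j = k}"
            by (intro card_mono) (auto simp: It_def)
          then show "card {x \<in> It. a 15 x = k} \<le> mu'" using mult[of k] by (simp add: occ_def d)
        qed
        then show ?thesis using cIt by (simp add: n1_def)
      qed
      have node: "a2 2 i \<in> {1..<p} \<and> a2 3 i \<in> {1..<p} \<and> a2 15 (a2 2 i) \<noteq> 1 \<and> a2 15 (a2 3 i) \<noteq> 1 \<and>
        a2 2 i \<noteq> a2 3 i \<and> a2 15 i + a2 15 (a2 2 i) = a2 15 (a2 3 i) \<and> 1 \<le> a2 15 i \<and> a2 15 i < 8 * mu'"
        if "p \<le> i" "i < n1" for i
        using P.child[of i] P.diff[of i] that by (auto simp: n1_def It_def old)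
      let ?s3 = "s2(7 := n1, 2 := p, 11 := n1, 14 := 0)"
      have "run B (count_code 15 5) ?s3 a2 (Suc (Suc (Suc (Suc t2)))) (\<lambda>s a t. run B ?c3 s a t ?Q)"
      proof (rule run_mono, rule run_count_code, goal_cases)
        case (6 i)
        then have "a2 15 i < 8 * mu'" using node[of i] by simp
        then show ?case using p by (simp add: e2)
      next
        case (7 i) then show ?case using zero(2)[of 5 i] a2[of 5] by (simp add: e2 d)
      next
        case (8 s3 a3 t3)
        then have h3: "same_except {2, 4, 5, 14} ?s3 s3" "same_except {5} a2 a3" "t3 \<le> t2 + 4 + 7 * (n1 - p) + 1"
          "\<forall>v<2 * p. occ (a2 15) p n1 v \<le> s3 14"
          "p < n1 \<longrightarrow> s3 4 \<in> a2 15 ` {p..<n1} \<and> occ (a2 15) p n1 (s3 4) = s3 14"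
          "s3 14 \<le> n1 - p"
          by (simp_all add: e2)
        have e3: "s3 0 = p" "s3 3 = mu'" "s3 22 = s 22" "s3 6 = n1" "s3 7 = n1" "s3 11 = n1"
          using h3(1) e2 by (simp_all add: same_except_def n1_def)
        have a3: "a3 k = a2 k" if "k \<noteq> 5" for k using h3(2) that by (simp add: same_except_def)
        let ?s4 = "s3(13 := 8, 26 := 32 * mu')"
        have lev: "level1 p mu' n1 a3"
        proof (unfold_locales, goal_cases)
          case (4 i) then show ?case using key[of i] old[of i] by (simp add: a3 d)
        next
          case 5 show ?case using ones occ2 by (simp add: a3 d)
        next
          case (6 v) show ?case using mult[of v] occ2 by (simp add: a3 d)
        next
          case (10 i) then show ?case using node[of i] by (simp add: a3)
        next
          case (11 i j) then show ?case using P.disj[of i j] by (simp add: a3 n1_def)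
        next
          case (12 i) then show ?case using zero(1)[of i] by (simp add: a3 a2 d)
        next
          case (13 i) then show ?case using zero(2)[of 7 i] by (simp add: a3 a2 d)
        next
          case (14 i) then show ?case using zero(2)[of 10 i] by (simp add: a3 a2 d)
        qed (use prime p n1a n1b n1c in \<open>simp_all add: d\<close>)
        have tt: "t3 + 3 + 80 * p + 30 \<le> t + 120 * p + 60" using h3(3) h2(3) h1(3) n1b n1a by linarith
        have fin: "t' \<le> t + 120 * p + 60 \<and> (\<forall>i\<in>{1..<p}. a' 0 i \<le> 1) \<and>
             [(\<Sum>i\<in>{1..<p}. a' 0 i * a 15 i) = s 22] (mod p)"
          if "t' \<le> t3 + 3 + 80 * p + 30 \<and> (\<forall>i\<in>{1..<p}. a' 0 i \<le> 1) \<and>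
             [(\<Sum>i\<in>{1..<p}. a' 0 i * a3 15 i) = s 22] (mod p)" for a' :: arrays and t'
        proof -
          have "(\<Sum>i\<in>{1..<p}. a' 0 i * a3 15 i) = (\<Sum>i\<in>{1..<p}. a' 0 i * a 15 i)"
            by (intro sum.cong) (auto simp: a3 old)
          then show ?thesis using that tt by simp
        qed
        have B32: "32 * mu' < B" "32 < B" using B p by (simp_all add: d)
        show ?case
        proof (cases "s3 14 < 32 * mu'")
          case True
          have "run B (mode2_code ;; tail_code) ?s4 a3 (Suc (Suc (Suc t3))) ?Q"
          proof (rule run_mono, rule run_mode2, goal_cases)
            case 1 show ?case using lev by (simp add: e3)
          next
            case (6 v)
            then have "occ (a2 15) p n1 v \<le> s3 14" using h3(4) by (simp add: e3)
            then show ?case using True by (simp add: e3 a3)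
          next
            case (7 s' a' t') then show ?case using fin[of t' a'] by (simp add: e3)
          qed (use x B in \<open>simp_all add: e3 d\<close>)
          then show ?thesis using True B32 by (simp add: e3)
        next
          case False
          have pn: "p < n1" using False h3(6) p by linarith
          have "run B (mode1_code ;; tail_code) ?s4 a3 (Suc (Suc (Suc t3))) ?Q"
          proof (rule run_mono, rule run_mode1, goal_cases)
            case 1 show ?case using lev by (simp add: e3)
          next
            case 8 show ?case using h3(5) pn by (simp add: e3 a3)
          next
            case 9 show ?case using h3(5) pn False by (simp add: e3 a3)
          next
            case (10 s' a' t') then show ?case using fin[of t' a'] by (simp add: e3)
          qed (use x B in \<open>simp_all add: e3 d\<close>)
          then show ?thesis using False B32 by (simp add: e3)
        qed
      qed (use n1a n1b B in \<open>simp_all add: e2 d\<close>)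
      then show ?case using B by (simp add: e2 n1_def d)
    qed (use p p1 in \<open>simp_all add: e1\<close>)
    moreover have "8 * mu' < B" "8 < B" "1 < B" using B p by (simp_all add: d)
    ultimately show ?case by (simp add: e1)
  qed (use p1 B in \<open>simp_all add: d\<close>)
  moreover have "1 < B" using B by linarith
  ultimately show ?thesis by (simp add: case2_code_def d)
qed

section \<open>Large multiplicities\<close>

text \<open>Subtracting \<open>k\<close> is written as a shift by \<open>p - k\<close>, so
  \<open>p - 1\<close> means the predecessor on the cycle of residues. This keeps the sum itself
  free of truncated subtraction.\<close>

definition shift :: "nat \<Rightarrow> nat \<Rightarrow> nat \<Rightarrow> nat" where
  "shift p y k = (y + k) mod p"

lemma shift_shift: "shift p (shift p y k) l = shift p y (k + l)"
  by (simp add: shift_def mod_simps add.assoc)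

lemma shift_less: "0 < p \<Longrightarrow> shift p y k < p"
  by (simp add: shift_def)

lemma shift_0: "y < p \<Longrightarrow> shift p y 0 = y"
  by (simp add: shift_def)

lemma shift_p: "y < p \<Longrightarrow> shift p y p = y"
  by (simp add: shift_def)

lemma shift_add_p: "shift p y (k + p) = shift p y k"
  by (simp add: shift_def flip: add.assoc)

lemma shift_inj: "y < p \<Longrightarrow> k < p \<Longrightarrow> l < p \<Longrightarrow> shift p y k = shift p y l \<Longrightarrow> k = (l::nat)"
  unfolding shift_def by (metis cong_add_lcancel_nat cong_def mod_less)

text \<open>A nonzero \<open>d\<close> generates the additive group: with \<open>w\<close> the
  inverse of \<open>d\<close>, the residue \<open>z\<close> is reached from \<open>x\<close> by
  \<open>w * (z - x)\<close> steps of length \<open>d\<close>.\<close>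

lemma shift_closed_imp_all:
  assumes "prime p" "0 < d" "d < p" "x < p" "P x"
    and cl: "\<And>y. y < p \<Longrightarrow> P y \<Longrightarrow> P (shift p y d)" and z: "z < p"
  shows "P z"
proof -
  have p0: "0 < p" using assms by simp
  have it: "P (shift p x (d * n))" for n
  proof (induction n)
    case 0 then show ?case using assms by (simp add: shift_0)
  next
    case (Suc n)
    have "P (shift p (shift p x (d * n)) d)" using cl[OF shift_less[OF p0] Suc] .
    then show ?case by (simp add: shift_shift add.commute)
  qed
  define w where "w = nat (modular_inverse (int p) (int d))"
  have w: "[d * w = 1] (mod p)" using nat_modular_inverse[OF assms(1-3) w_def] by simp
  have "[x + d * (w * (z + p - x)) = x + (z + p - x)] (mod p)"
  proof -
    have "[d * w * (z + p - x) = 1 * (z + p - x)] (mod p)" using w by (rule cong_mult[OF _ cong_refl])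
    then show ?thesis by (intro cong_add[OF cong_refl]) (simp add: mult.assoc)
  qed
  then have "shift p x (d * (w * (z + p - x))) = z" using assms(4) z by (simp add: shift_def cong_def)
  then show ?thesis using it by metis
qed

text \<open>
  \<open>par y \<noteq> 0\<close> means that \<open>y\<close> is already known to be a subset sum; \<open>par y = p\<close> marks the initial
  interval and otherwise \<open>par y\<close> is the last element used. Every maximal interval of the set has
  more than \<open>mu\<close> elements, its left end is listed in \<open>E\<close> and the position behind its right end in \<open>F\<close>.
\<close>

locale cinv =
  fixes p mu :: nat and key par E F :: "nat \<Rightarrow> nat" and ne j :: nat
  assumes prime: "prime p" and mu: "0 < mu" "mu < p"
    and key: "1 \<le> i \<Longrightarrow> i < p \<Longrightarrow> 1 \<le> key i \<and> key i < p"
    and base: "y < p \<Longrightarrow> par y = p \<longleftrightarrow> y \<le> mu"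
    and par: "y < p \<Longrightarrow> par y \<noteq> 0 \<Longrightarrow> par y \<noteq> p \<Longrightarrow> 1 \<le> par y \<and> par y < j \<and> key (par y) \<noteq> 1 \<and>
      par (shift p y (p - key (par y))) \<noteq> 0 \<and>
      (par (shift p y (p - key (par y))) = p \<or> par (shift p y (p - key (par y))) < par y)"
    and j: "1 \<le> j" "j \<le> p"
    and E: "i < ne \<Longrightarrow> E i < p" "i < ne \<Longrightarrow> k \<le> mu \<Longrightarrow> par (shift p (E i) k) \<noteq> 0"
    and F: "i < ne \<Longrightarrow> F i < p" "i < ne \<Longrightarrow> par (shift p (F i) (p - 1)) \<noteq> 0"
    and left: "y < p \<Longrightarrow> par y \<noteq> 0 \<Longrightarrow> par (shift p y (p - 1)) = 0 \<Longrightarrow> \<exists>i<ne. E i = y"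
    and right: "y < p \<Longrightarrow> par y = 0 \<Longrightarrow> par (shift p y (p - 1)) \<noteq> 0 \<Longrightarrow> \<exists>i<ne. F i = y"
    and ne: "ne * (mu + 1) \<le> card {y. y < p \<and> par y \<noteq> 0}"
    and card: "p \<le> card {y. y < p \<and> par y \<noteq> 0} \<or>
      mu + 1 + card {i \<in> {1..<j}. key i \<noteq> 1} \<le> card {y. y < p \<and> par y \<noteq> 0}"
begin

lemma p: "1 < p" "0 < p" using prime prime_gt_1_nat prime_gt_0_nat by auto

lemma pred_Suc: "y < p \<Longrightarrow> shift p (shift p y 1) (p - 1) = y"
  using p by (simp add: shift_shift shift_p)

lemma Suc_pred: "y < p \<Longrightarrow> shift p (shift p y (p - 1)) 1 = y"
  using p by (simp add: shift_shift shift_p)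

lemma card_index_Suc: "card {i \<in> {1..<Suc j}. key i \<noteq> 1} = card {i \<in> {1..<j}. key i \<noteq> 1} + (if key j \<noteq> 1 then 1 else 0)"
proof -
  have "{i \<in> {1..<Suc j}. key i \<noteq> 1} =
      (if key j \<noteq> 1 then insert j {i \<in> {1..<j}. key i \<noteq> 1} else {i \<in> {1..<j}. key i \<noteq> 1})"
    using j by (auto simp: less_Suc_eq)
  then show ?thesis by simp
qed

lemma skip:
  assumes "j < p" "key j = 1 \<or> (\<forall>y<p. par y \<noteq> 0)"
  shows "cinv p mu key par E F ne (Suc j)"
proof (unfold_locales, goal_cases)
  case (6 y)
  then show ?case using par[OF 6] by auto
next
  case 16
  show ?case
  proof (cases "key j = 1")
    case True then show ?thesis using card card_index_Suc by simp
  next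
    case False
    then have "{y. y < p \<and> par y \<noteq> 0} = {..<p}" using assms by auto
    then show ?thesis by simp
  qed
qed (use prime mu key base j E F left right ne assms in auto)

text \<open>What the three rules below have in common. After intervals have met, \<open>E\<close>
  and \<open>F\<close> may contain stale ends; it matters only that every actual end is listed. So
  the length of the lists is not bounded by counting intervals but by payment: a new entry has to
  come with \<open>mu + 1\<close> new residues.\<close>

lemma grow:
  assumes jp: "j < p" "key j \<noteq> 1" and N: "finite X" "X \<noteq> {}" "\<And>y. y \<in> X \<Longrightarrow> y < p \<and> par y = 0 \<and> par (shift p y (p - key j)) \<noteq> 0"
    and par': "\<And>y. par' y = (if y \<in> X then j else par y)"
    and E': "\<And>i. i < ne' \<Longrightarrow> E' i < p" "\<And>i k. i < ne' \<Longrightarrow> k \<le> mu \<Longrightarrow> par' (shift p (E' i) k) \<noteq> 0"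
    and F': "\<And>i. i < ne' \<Longrightarrow> F' i < p" "\<And>i. i < ne' \<Longrightarrow> par' (shift p (F' i) (p - 1)) \<noteq> 0"
    and left': "\<And>y. y < p \<Longrightarrow> par' y \<noteq> 0 \<Longrightarrow> par' (shift p y (p - 1)) = 0 \<Longrightarrow> \<exists>i<ne'. E' i = y"
    and right': "\<And>y. y < p \<Longrightarrow> par' y = 0 \<Longrightarrow> par' (shift p y (p - 1)) \<noteq> 0 \<Longrightarrow> \<exists>i<ne'. F' i = y"
    and ne': "ne' * (mu + 1) \<le> ne * (mu + 1) + card X"
  shows "cinv p mu key par' E' F' ne' (Suc j)"
    and "card {y. y < p \<and> par' y \<noteq> 0} = card {y. y < p \<and> par y \<noteq> 0} + card X"
proof -
  have e: "{y. y < p \<and> par' y \<noteq> 0} = {y. y < p \<and> par y \<noteq> 0} \<union> X" using N(3) par' j by auto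
  have "card ({y. y < p \<and> par y \<noteq> 0} \<union> X) = card {y. y < p \<and> par y \<noteq> 0} + card X"
    using N by (intro card_Un_disjoint) auto
  then show c: "card {y. y < p \<and> par' y \<noteq> 0} = card {y. y < p \<and> par y \<noteq> 0} + card X" by (simp only: e)
  have N1: "1 \<le> card X" using N by (simp add: Suc_le_eq card_gt_0_iff)
  have sN: "shift p y k \<notin> X" if "par (shift p y k) \<noteq> 0" for y k using N(3) that by auto
  show "cinv p mu key par' E' F' ne' (Suc j)"
  proof (unfold_locales, goal_cases)
    case (5 y)
    show ?case
    proof (cases "y \<in> X")
      case True
      then have "par y = 0" using N(3) by blast
      then have "\<not> y \<le> mu" using base[OF 5] p by auto
      then show ?thesis using True par' jp by auto
    next
      case False then show ?thesis using base[OF 5] par' by simp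
    qed
  next
    case (6 y)
    show ?case
    proof (cases "y \<in> X")
      case True
      then have e: "par' y = j" using par' by simp
      have z: "par (shift p y (p - key j)) \<noteq> 0" using N(3)[OF True] by simp
      \<comment> \<open>Entries made earlier are \<open>p\<close> or below \<open>j\<close>, so
        recording \<open>j\<close> keeps the entries decreasing along predecessors.\<close>
      have "par (shift p y (p - key j)) = p \<or> par (shift p y (p - key j)) < j"
        using par[OF shift_less z] p by blast
      then show ?thesis using z sN[OF z] par' e j jp by auto
    next
      case False
      then have e: "par' y = par y" using par' by simp
      have "par (shift p y (p - key (par y))) \<noteq> 0" using par[of y] 6 e by auto
      then show ?thesis using par[of y] 6 e sN par' by auto
    qed
  next
    case 15
    show ?case using ne' ne c by linarith
  next
    case 16
    show ?case using card card_index_Suc c N1 by auto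
  qed (use prime mu key j jp E' F' left' right' in auto)
qed

text \<open>Places where a new sum may appear: just behind a right end (\<open>condA\<close>), just
  before a left end (\<open>condC\<close>), or at a left end moved by the new element
  (\<open>condB\<close>).\<close>

definition "condA i \<longleftrightarrow> par (F i) = 0 \<and> par (shift p (F i) (p - key j)) \<noteq> 0"
definition "condC i \<longleftrightarrow> par (shift p (E i) (p - 1)) = 0 \<and> par (shift p (shift p (E i) (p - 1)) (p - key j)) \<noteq> 0"
definition "condB i \<longleftrightarrow> par (shift p (E i) (key j)) = 0"

lemma addA:
  assumes jp: "j < p" "key j \<noteq> 1" and i: "i < ne" "condA i"
  shows "cinv p mu key (par(F i := j)) E (F(i := shift p (F i) 1)) ne (Suc j)"
    and "card {y. y < p \<and> (par(F i := j)) y \<noteq> 0} = card {y. y < p \<and> par y \<noteq> 0} + 1"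
proof -
  let ?par = "par(F i := j)"
  have Fi: "F i < p" "par (F i) = 0" "par (shift p (F i) (p - key j)) \<noteq> 0" "par (shift p (F i) (p - 1)) \<noteq> 0"
    using F i by (auto simp: condA_def)
  have le: "?par y = 0 \<Longrightarrow> par y = 0" for y using j by (auto split: if_splits)
  have le': "par y \<noteq> 0 \<Longrightarrow> ?par y \<noteq> 0" for y using j by (auto split: if_splits)
  note g = grow[where X = "{F i}" and par' = ?par and E' = E and F' = "F(i := shift p (F i) 1)" and ne' = ne]
  have 1: "\<exists>i<ne. E i = y" if y: "y < p" "?par y \<noteq> 0" "?par (shift p y (p - 1)) = 0" for y
  proof (cases "y = F i")
    case True then show ?thesis using le[OF y(3)] Fi(4) by simp
  next
    case False then show ?thesis using left[of y] y le by auto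
  qed
  have 2: "\<exists>k<ne. (F(i := shift p (F i) 1)) k = y" if y: "y < p" "?par y = 0" "?par (shift p y (p - 1)) \<noteq> 0" for y
  proof (cases "shift p y (p - 1) = F i")
    case True
    then have "y = shift p (F i) 1" using Suc_pred[OF y(1)] by simp
    then show ?thesis using i by (intro exI[of _ i]) simp
  next
    case False
    then obtain k where k: "k < ne" "F k = y" using right[OF y(1) le[OF y(2)]] y(3) by auto
    then have "k \<noteq> i" using y(2) j by auto
    then show ?thesis using k by (intro exI[of _ k]) simp
  qed
  have N: "y < p \<and> par y = 0 \<and> par (shift p y (p - key j)) \<noteq> 0" if "y \<in> {F i}" for y using that Fi by simp
  have P: "?par y = (if y \<in> {F i} then j else par y)" for y by simp
  have 3: "?par (shift p (E m) k) \<noteq> 0" if "m < ne" "k \<le> mu" for m k using E(2)[OF that] by (rule le')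
  have 4: "(F(i := shift p (F i) 1)) m < p" if "m < ne" for m using F(1)[OF that] p by (simp add: shift_less)
  have 5: "?par (shift p ((F(i := shift p (F i) 1)) m) (p - 1)) \<noteq> 0" if "m < ne" for m
  proof (cases "m = i")
    case True
    then have "shift p ((F(i := shift p (F i) 1)) m) (p - 1) = F i" using pred_Suc[OF Fi(1)] by simp
    then show ?thesis using j by simp
  next
    case False
    then have "(F(i := shift p (F i) 1)) m = F m" by simp
    then show ?thesis using le'[OF F(2)[OF that]] by simp
  qed
  have 6: "finite {F i}" "{F i} \<noteq> {}" by auto
  have 7: "ne * (mu + 1) \<le> ne * (mu + 1) + card {F i}" by simp
  show "cinv p mu key ?par E (F(i := shift p (F i) 1)) ne (Suc j)"
    by (rule g(1)[OF jp 6 N P E(1) 3 4 5 1 2 7])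
  show "card {y. y < p \<and> ?par y \<noteq> 0} = card {y. y < p \<and> par y \<noteq> 0} + 1"
    using g(2)[OF jp 6 N P E(1) 3 4 5 1 2 7] by simp
qed

lemma addC:
  assumes jp: "j < p" "key j \<noteq> 1" and i: "i < ne" "condC i" and y0: "y0 = shift p (E i) (p - 1)"
  shows "cinv p mu key (par(y0 := j)) (E(i := y0)) F ne (Suc j)"
    and "card {y. y < p \<and> (par(y0 := j)) y \<noteq> 0} = card {y. y < p \<and> par y \<noteq> 0} + 1"
proof -
  let ?par = "par(y0 := j)"
  have y: "y0 < p" "par y0 = 0" "par (shift p y0 (p - key j)) \<noteq> 0" "shift p y0 1 = E i" "par (E i) \<noteq> 0"
    using E[of i] E(2)[of i 0] i Suc_pred p by (auto simp: condC_def y0 shift_less shift_0)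
  have le: "?par y = 0 \<Longrightarrow> par y = 0" for y using j by (auto split: if_splits)
  have le': "par y \<noteq> 0 \<Longrightarrow> ?par y \<noteq> 0" for y using j by (auto split: if_splits)
  note g = grow[where X = "{y0}" and par' = ?par and E' = "E(i := y0)" and F' = F and ne' = ne]
  have 0: "?par (shift p y0 k) \<noteq> 0" if "k \<le> mu" for k
  proof (cases k)
    case 0 then show ?thesis using y j by (simp add: shift_0)
  next
    case (Suc l)
    then have "shift p y0 k = shift p (E i) l" using y(4) by (simp add: shift_shift flip: y(4))
    then show ?thesis using le'[OF E(2)[of i l]] i that Suc by simp
  qed
  have 1: "\<exists>k<ne. (E(i := y0)) k = y" if yy: "y < p" "?par y \<noteq> 0" "?par (shift p y (p - 1)) = 0" for y
  proof (cases "y = y0")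
    case True then show ?thesis using i by (intro exI[of _ i]) simp
  next
    case False
    then obtain k where k: "k < ne" "E k = y" using left[OF yy(1) _ le[OF yy(3)]] yy(2) by auto
    then have "k \<noteq> i" using yy(3) j y0 by auto
    then show ?thesis using k by (intro exI[of _ k]) simp
  qed
  have 2: "\<exists>k<ne. F k = y" if yy: "y < p" "?par y = 0" "?par (shift p y (p - 1)) \<noteq> 0" for y
  proof (cases "shift p y (p - 1) = y0")
    case True
    then have "y = E i" using Suc_pred[OF yy(1)] y(4) by simp
    then show ?thesis using le[OF yy(2)] y(5) by simp
  next
    case False then show ?thesis using right[OF yy(1) le[OF yy(2)]] yy(3) by auto
  qed
  have 3: "?par (shift p ((E(i := y0)) m) k) \<noteq> 0" if "m < ne" "k \<le> mu" for m k
    using 0[OF that(2)] le'[OF E(2)[OF that]] by (cases "m = i") auto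
  have N: "z < p \<and> par z = 0 \<and> par (shift p z (p - key j)) \<noteq> 0" if "z \<in> {y0}" for z using that y by simp
  have P: "?par z = (if z \<in> {y0} then j else par z)" for z by simp
  have 4: "(E(i := y0)) m < p" if "m < ne" for m using E(1)[OF that] y by simp
  have 5: "?par (shift p (F m) (p - 1)) \<noteq> 0" if "m < ne" for m using F(2)[OF that] by (rule le')
  have 6: "finite {y0}" "{y0} \<noteq> {}" by auto
  have 7: "ne * (mu + 1) \<le> ne * (mu + 1) + card {y0}" by simp
  show "cinv p mu key ?par (E(i := y0)) F ne (Suc j)"
    by (rule g(1)[OF jp 6 N P 4 3 F(1) 5 1 2 7])
  show "card {y. y < p \<and> ?par y \<noteq> 0} = card {y. y < p \<and> par y \<noteq> 0} + 1"
    using g(2)[OF jp 6 N P 4 3 F(1) 5 1 2 7] by simp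
qed

text \<open>A whole block of \<open>mu + 1\<close> residues can be added. Its members are old
  residues plus \<open>key j\<close>, and none of them is in the set: otherwise the first that is
  would be a left end whose predecessor the rule \<open>condC\<close> could add.\<close>

lemma addB:
  assumes jp: "j < p" "key j \<noteq> 1" and i: "i < ne" "condB i" and noC: "\<And>k. k < ne \<Longrightarrow> \<not> condC k"
    and y0: "y0 = shift p (E i) (key j)" and par': "\<And>y. par' y = (if y \<in> shift p y0 ` {..mu} then j else par y)"
  shows "cinv p mu key par' (E(ne := y0)) (F(ne := shift p y0 (mu + 1))) (Suc ne) (Suc j)"
    and "card {y. y < p \<and> par' y \<noteq> 0} = card {y. y < p \<and> par y \<noteq> 0} + (mu + 1)"
proof -
  let ?N = "shift p y0 ` {..mu}"
  have kj: "1 \<le> key j" "key j < p" using key[of j] j jp by auto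
  have y0p: "y0 < p" using p by (simp add: y0 shift_less)
  have prev: "shift p (shift p y0 k) (p - key j) = shift p (E i) k" for k
  proof -
    have "key j + k + (p - key j) = k + p" using kj by simp
    then show ?thesis unfolding y0 shift_shift by (metis shift_add_p)
  qed
  have new: "par (shift p y0 k) = 0" if "k \<le> mu" for k
    using that
  proof (induction k)
    case 0
    then show ?case using i by (simp add: condB_def y0 shift_shift)
  next
    case (Suc k)
    then have k: "par (shift p y0 k) = 0" by simp
    show ?case
    proof (rule ccontr)
      let ?z = "shift p y0 (Suc k)"
      assume z: "par ?z \<noteq> 0"
      have "shift p (shift p y0 k) 1 = ?z" by (simp add: shift_shift)
      then have zk: "shift p ?z (p - 1) = shift p y0 k" using pred_Suc[OF shift_less[OF p(2)], of y0 k] by simp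
      then obtain m where m: "m < ne" "E m = ?z" using left[OF shift_less[OF p(2)] z] k by auto
      have "condC m" unfolding condC_def m(2) zk prev using k E(2)[of i k] i Suc.prems by simp
      then show False using noC m by blast
    qed
  qed
  have inj: "inj_on (shift p y0) {..mu}"
    using shift_inj[OF y0p] mu by (auto intro!: inj_onI)
  then have cN: "card ?N = mu + 1" by (simp add: card_image)
  have N: "y < p \<and> par y = 0 \<and> par (shift p y (p - key j)) \<noteq> 0" if yN: "y \<in> ?N" for y
  proof -
    obtain k where k: "k \<le> mu" "y = shift p y0 k" using yN by auto
    show ?thesis using new[OF k(1)] E(2)[OF i(1) k(1)] k(2) prev[of k] p by (simp add: shift_less)
  qed
  have le: "par' y = 0 \<Longrightarrow> par y = 0 \<and> y \<notin> ?N" for y using j par' by (auto split: if_splits)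
  have le': "par y \<noteq> 0 \<Longrightarrow> par' y \<noteq> 0" for y using le[of y] by auto
  have nN: "y \<in> ?N \<Longrightarrow> par' y \<noteq> 0" for y using le[of y] by auto
  note g = grow[where X = ?N and par' = par' and E' = "E(ne := y0)" and F' = "F(ne := shift p y0 (mu + 1))" and ne' = "Suc ne"]
  have mem: "shift p y0 k \<in> ?N" if "k \<le> mu" for k using that by auto
  have 1: "\<exists>k<Suc ne. (E(ne := y0)) k = y" if yy: "y < p" "par' y \<noteq> 0" "par' (shift p y (p - 1)) = 0" for y
  proof (cases "y \<in> ?N")
    case True
    then obtain k where k: "k \<le> mu" "y = shift p y0 k" by auto
    show ?thesis
    proof (cases k)
      case 0 then show ?thesis using k y0p by (intro exI[of _ ne]) (simp add: shift_0)
    next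
      case (Suc l)
      have "shift p (shift p y0 l) 1 = y" using k Suc by (simp add: shift_shift)
      then have "shift p y (p - 1) = shift p y0 l" using pred_Suc[OF shift_less[OF p(2)], of y0 l] by simp
      then show ?thesis using le[OF yy(3)] mem[of l] k Suc by simp
    qed
  next
    case False
    then obtain k where "k < ne" "E k = y" using left[OF yy(1)] le[OF yy(3)] yy(2) par' by auto
    then show ?thesis by (intro exI[of _ k]) simp
  qed
  have 2: "\<exists>k<Suc ne. (F(ne := shift p y0 (mu + 1))) k = y" if yy: "y < p" "par' y = 0" "par' (shift p y (p - 1)) \<noteq> 0" for y
  proof (cases "shift p y (p - 1) \<in> ?N")
    case True
    then obtain k where k: "k \<le> mu" "shift p y (p - 1) = shift p y0 k" by auto
    then have y: "y = shift p y0 (Suc k)" using Suc_pred[OF yy(1)] by (simp add: shift_shift)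
    then have "\<not> Suc k \<le> mu" using le[OF yy(2)] mem[of "Suc k"] by auto
    then have "k = mu" using k by simp
    then show ?thesis using y by (intro exI[of _ ne]) simp
  next
    case False
    then obtain k where "k < ne" "F k = y" using right[OF yy(1)] le[OF yy(2)] yy(3) par' by auto
    then show ?thesis by (intro exI[of _ k]) simp
  qed
  have 3: "par' (shift p ((E(ne := y0)) m) k) \<noteq> 0" if "m < Suc ne" "k \<le> mu" for m k
    using le'[OF E(2)[of m k]] nN[OF mem[OF that(2)]] that by (cases "m = ne") auto
  have "shift p (shift p y0 (mu + 1)) (p - 1) = shift p y0 mu"
    using pred_Suc[OF shift_less[OF p(2)], of y0 mu] by (simp add: shift_shift)
  then have 4: "par' (shift p ((F(ne := shift p y0 (mu + 1))) m) (p - 1)) \<noteq> 0" if "m < Suc ne" for m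
    using le'[OF F(2)[of m]] nN[OF mem[of mu]] that by (cases "m = ne") auto
  have 5: "(E(ne := y0)) m < p" "(F(ne := shift p y0 (mu + 1))) m < p" if "m < Suc ne" for m
    using E(1)[of m] F(1)[of m] y0p p that by (auto simp: shift_less)
  have 6: "finite ?N" "?N \<noteq> {}" by auto
  have 7: "Suc ne * (mu + 1) \<le> ne * (mu + 1) + card ?N" using cN by simp
  show "cinv p mu key par' (E(ne := y0)) (F(ne := shift p y0 (mu + 1))) (Suc ne) (Suc j)"
    by (rule g(1)[OF jp 6 N par' 5(1) 3 5(2) 4 1 2 7])
  show "card {y. y < p \<and> par' y \<noteq> 0} = card {y. y < p \<and> par y \<noteq> 0} + (mu + 1)"
    using g(2)[OF jp 6 N par' 5(1) 3 5(2) 4 1 2 7] unfolding cN .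
qed

text \<open>
  If neither rule applies, a pair \<open>x \<in> S\<close>, \<open>x + d \<notin> S\<close> could be moved to the left forever, so \<open>S\<close> is
  closed under adding \<open>d\<close>.
\<close>

lemma saturated:
  assumes jp: "j < p" and noA: "\<And>k. k < ne \<Longrightarrow> \<not> condA k" and noB: "\<And>k. k < ne \<Longrightarrow> \<not> condB k" and y: "y < p"
  shows "par y \<noteq> 0"
proof -
  have kj: "1 \<le> key j" "key j < p" using key[of j] j jp by auto
  have cl: "par (shift p x (key j)) \<noteq> 0" if x: "x < p" "par x \<noteq> 0" for x
  proof
    assume a: "par (shift p x (key j)) = 0"
    have st: "par (shift p z (p - 1)) \<noteq> 0 \<and> par (shift p (shift p z (p - 1)) (key j)) = 0"
      if z: "z < p" "par z \<noteq> 0" "par (shift p z (key j)) = 0" for z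
    proof
      show "par (shift p z (p - 1)) \<noteq> 0"
      proof
        assume "par (shift p z (p - 1)) = 0"
        then obtain m where "m < ne" "E m = z" using left[OF z(1,2)] by blast
        then show False using noB[of m] z(3) by (simp add: condB_def)
      qed
      show "par (shift p (shift p z (p - 1)) (key j)) = 0"
      proof (rule ccontr)
        let ?z = "shift p z (key j)"
        assume "par (shift p (shift p z (p - 1)) (key j)) \<noteq> 0"
        then have "par (shift p ?z (p - 1)) \<noteq> 0" by (simp add: shift_shift add.commute)
        then obtain m where m: "m < ne" "F m = ?z" using right[OF shift_less[OF p(2)] z(3)] by blast
        have "shift p ?z (p - key j) = z" using kj z by (simp add: shift_shift shift_p)
        then have "condA m" using z m(2) by (simp add: condA_def)
        then show False using noA m by blast
      qed
    qed
    have it: "par (shift p x ((p - 1) * n)) \<noteq> 0 \<and> par (shift p (shift p x ((p - 1) * n)) (key j)) = 0" for n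
    proof (induction n)
      case 0 then show ?case using x a by (simp add: shift_0)
    next
      case (Suc n)
      then show ?case using st[OF shift_less[OF p(2)], of x "(p - 1) * n"] by (simp add: shift_shift add.commute)
    qed
    \<comment> \<open>The walk to the left stays inside the set. After \<open>p - key j\<close>
      steps it has moved by minus \<open>p - key j\<close>, that is by \<open>key j\<close> modulo
      \<open>p\<close>, so it arrives at \<open>x + key j\<close>, which was assumed to lie
      outside.\<close>
    have "shift p x ((p - 1) * (p - key j)) = shift p x (key j)"
    proof -
      have "[x + (p - 1) * (p - key j) = x + key j] (mod p)"
      proof -
        define e where "e = p - key j"
        have e: "(p - 1) * e + e = p * e" using p by (cases p) auto
        have "key j + e = p" using kj by (simp add: e_def)
        then have "[x + (p - 1) * e + e = x + key j + e] (mod p)"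
          unfolding add.assoc e by (simp add: cong_def)
        then show ?thesis unfolding e_def[symmetric] using cong_add_rcancel_nat by blast
      qed
      then show ?thesis by (simp add: shift_def cong_def)
    qed
    then show False using it[of "p - key j"] a by simp
  qed
  have "par 0 \<noteq> 0" using base[of 0] p by simp
  then show ?thesis
    using shift_closed_imp_all[OF prime, of "key j" 0 "\<lambda>y. par y \<noteq> 0" y] kj p cl y by auto
qed

end

section \<open>Searching the lists of interval ends\<close>

lemma run_search:
  assumes s2: "s 2 = 0"
    and body: "\<And>i s' t'. i < s 16 \<Longrightarrow> same_except X s s' \<Longrightarrow> s' 2 = i \<Longrightarrow> s' 16 = s 16 \<Longrightarrow> s' 17 = s 17 \<Longrightarrow>
      run B body s' a (t' + 1) (\<lambda>s'' a'' t''.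
        (\<not> C i \<and> a'' = a \<and> same_except X s s'' \<and> s'' 2 = Suc i \<and> s'' 16 = s 16 \<and> s'' 17 = s 17 \<and> t'' \<le> t' + K) \<or>
        (C i \<and> R i s'' a'' \<and> s'' 2 = s'' 16 \<and> t'' \<le> t' + H))"
  shows "run B (While (Less (V 2) (V 16)) body) s a t (\<lambda>s' a' t'.
    ((\<forall>i<s 16. \<not> C i) \<and> a' = a \<and> same_except X s s' \<and> s' 16 = s 16 \<and> s' 17 = s 17 \<and> t' \<le> t + K * s 16 + 1) \<or>
    (\<exists>i<s 16. C i \<and> R i s' a' \<and> t' \<le> t + K * s 16 + H + 1))"
proof -
  \<comment> \<open>A hit leaves the loop by making the counter equal to the bound, and the hit
    itself may have changed that bound; hence the second alternative compares with the current
    \<open>s' 16\<close>.\<close>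
  define I where "I = (\<lambda>(s'::vars) (a'::arrays) (t'::nat).
    ((\<forall>i<s' 2. \<not> C i) \<and> s' 2 \<le> s 16 \<and> a' = a \<and> same_except X s s' \<and> s' 16 = s 16 \<and> s' 17 = s 17 \<and> t' \<le> t + K * s' 2) \<or>
    (\<exists>i<s 16. C i \<and> R i s' a' \<and> s' 2 = s' 16 \<and> t' \<le> t + K * s 16 + H))"
  show ?thesis
  proof (rule run_While[where M = "\<lambda>s' a'. s' 16 - s' 2" and I = I], goal_cases)
    case 1
    show ?case unfolding I_def using s2 by auto
  next
    case (2 s' a' t')
    have "run B body s' a' (t' + 1) (\<lambda>s'' a'' t''. I s'' a'' t'' \<and> s'' 16 - s'' 2 < s' 16 - s' 2)"
      if lt: "s' 2 < s' 16"
    proof -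
      have h: "\<forall>i<s' 2. \<not> C i" "s' 2 \<le> s 16" "a' = a" "same_except X s s'" "s' 16 = s 16" "s' 17 = s 17" "t' \<le> t + K * s' 2"
        using 2 lt unfolding I_def by auto
      have Kle: "K * s' 2 \<le> K * s 16" using h(2) by simp
      show ?thesis unfolding h(3)
      proof (rule run_mono, rule body[of "s' 2"], goal_cases)
        case (6 s'' a'' t'')
        then show ?case
        proof
          assume n: "\<not> C (s' 2) \<and> a'' = a \<and> same_except X s s'' \<and> s'' 2 = Suc (s' 2) \<and> s'' 16 = s 16 \<and> s'' 17 = s 17 \<and> t'' \<le> t' + K"
          then have "t'' \<le> t + K * s'' 2" using h(7) by simp
          moreover have "\<forall>i<s'' 2. \<not> C i" using n h(1) by (auto simp: less_Suc_eq)
          ultimately have "I s'' a'' t''" unfolding I_def using n lt h(5) by auto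
          then show ?thesis using n lt h(5) by simp
        next
          assume y: "C (s' 2) \<and> R (s' 2) s'' a'' \<and> s'' 2 = s'' 16 \<and> t'' \<le> t' + H"
          then have "t'' \<le> t + K * s 16 + H" using h(7) Kle by linarith
          then have "I s'' a'' t''" unfolding I_def using y lt h(5) by auto
          then show ?thesis using y lt by simp
        qed
      qed (use lt h in auto)
    qed
    then show ?case by simp
  next
    case (3 s' a' t')
    then show ?case unfolding I_def
    proof (elim disjE)
      assume h: "(\<forall>i<s' 2. \<not> C i) \<and> s' 2 \<le> s 16 \<and> a' = a \<and> same_except X s s' \<and> s' 16 = s 16 \<and> s' 17 = s 17 \<and> t' \<le> t + K * s' 2"
      then have "s' 2 = s 16" using 3(2) by simp
      then show ?thesis using h by auto
    next
      assume "\<exists>i<s 16. C i \<and> R i s' a' \<and> s' 2 = s' 16 \<and> t' \<le> t + K * s 16 + H"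
      then show ?thesis by auto
    qed
  qed
qed

definition fill_code :: com where
  "fill_code = While (Less (V 19) (Plus (V 3) (N 1)))
     (Upd 11 (Modulo (Plus (V 18) (V 19)) (V 0)) (V 20) ;; Assign 19 (Plus (V 19) (N 1)))"

lemma run_fill_code:
  assumes "s 19 = 0" "0 < s 0" "s 18 < s 0" "s 3 < s 0" "2 * s 0 + 1 < B"
  shows "run B fill_code s a t (\<lambda>s' a' t'. same_except {19} s s' \<and> t' \<le> t + 3 * (s 3 + 1) + 1 \<and>
     a' = a(11 := (\<lambda>y. if y \<in> shift (s 0) (s 18) ` {..s 3} then s 20 else a 11 y)))"
proof -
  define f where "f = (\<lambda>k y. if y \<in> shift (s 0) (s 18) ` {..<k} then s 20 else a 11 y)"
  define I where "I = (\<lambda>(s'::vars) (a'::arrays) (t'::nat). same_except {19} s s' \<and> s' 19 \<le> s 3 + 1 \<and>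
     t' \<le> t + 3 * s' 19 \<and> a' = a(11 := f (s' 19)))"
  show ?thesis unfolding fill_code_def
  proof (rule run_While[where M = "\<lambda>s' a'. s 3 + 1 - s' 19" and I = I], goal_cases)
    case 1
    have "f 0 = a 11" by (auto simp: f_def)
    then show ?case unfolding I_def using assms by simp
  next
    case (2 s' a' t')
    then have h: "same_except {19} s s'" "s' 19 \<le> s 3 + 1" "t' \<le> t + 3 * s' 19" "a' = a(11 := f (s' 19))"
      by (simp_all add: I_def)
    have e: "s' 0 = s 0" "s' 18 = s 18" "s' 3 = s 3" "s' 20 = s 20" using h(1) by (simp_all add: same_except_def)
    have B3: "Suc (s 3) < B" "s 18 + s' 19 < B" "Suc (s' 19) < B" using assms h(2) by linarith+
    have f: "(f (s' 19))(shift (s 0) (s 18) (s' 19) := s 20) = f (Suc (s' 19))"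
      by (rule ext) (auto simp: f_def lessThan_Suc)
    have m: "(s 18 + s' 19) mod s 0 < 2 * s 0"
      using mod_less_divisor[OF assms(2), of "s 18 + s' 19"] by linarith
    show ?case
    proof (cases "s' 19 < s 3 + 1")
      case True
      have "I (s'(19 := Suc (s' 19))) (a(11 := f (Suc (s' 19)))) (Suc (Suc (Suc t')))"
        unfolding I_def using h True by simp
      then show ?thesis using True B3 m f[unfolded shift_def] h(4) by (simp add: e)
    qed (use B3 in \<open>simp add: e\<close>)
  next
    case (3 s' a' t')
    then have h: "same_except {19} s s'" "s' 19 = s 3 + 1" "t' \<le> t + 3 * s' 19" "a' = a(11 := f (s' 19))"
      by (auto simp: I_def same_except_def)
    have "{..<s 3 + 1} = {..s 3}" by auto
    then show ?case using h by (simp add: f_def)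
  qed
qed

text \<open>Variable \<open>27\<close> holds the new element, and \<open>17\<close> tells
  \<open>step_code\<close> about a hit. \<open>searchB\<close> is tried last and reports
  nothing.\<close>

definition hit_test :: "com \<Rightarrow> com" where
  "hit_test c = If (Eq (Arr 11 (V 18)) (N 0))
     (If (Eq (Arr 11 (Modulo (Plus (V 18) (Minus (V 0) (V 27))) (V 0))) (N 0)) (Assign 2 (Plus (V 2) (N 1))) c)
     (Assign 2 (Plus (V 2) (N 1)))"

definition searchA :: com where
  "searchA = While (Less (V 2) (V 16))
     (Assign 18 (Arr 13 (V 2)) ;;
      hit_test (Upd 11 (V 18) (V 20) ;; Upd 13 (V 2) (Modulo (Plus (V 18) (N 1)) (V 0)) ;; Assign 17 (N 1) ;; Assign 2 (V 16)))"

definition searchC :: com where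
  "searchC = While (Less (V 2) (V 16))
     (Assign 18 (Modulo (Plus (Arr 12 (V 2)) (Minus (V 0) (N 1))) (V 0)) ;;
      hit_test (Upd 11 (V 18) (V 20) ;; Upd 12 (V 2) (V 18) ;; Assign 17 (N 1) ;; Assign 2 (V 16)))"

definition searchB :: com where
  "searchB = While (Less (V 2) (V 16))
     (Assign 18 (Modulo (Plus (Arr 12 (V 2)) (V 27)) (V 0)) ;;
      If (Eq (Arr 11 (V 18)) (N 0))
        (Assign 19 (N 0) ;; fill_code ;;
         Upd 12 (V 16) (V 18) ;; Upd 13 (V 16) (Modulo (Plus (V 18) (Plus (V 3) (N 1))) (V 0)) ;;
         Assign 16 (Plus (V 16) (N 1)) ;; Assign 2 (V 16))
        (Assign 2 (Plus (V 2) (N 1))))"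

lemma run_searchA:
  assumes s: "s 2 = 0" "s 17 = 0" "s 16 \<le> s 0" "0 < s 0" "s 27 \<le> s 0" and B: "2 * s 0 + 1 < B"
    and F: "\<And>i. i < s 16 \<Longrightarrow> a 13 i < s 0"
    and C: "\<And>i. C i \<longleftrightarrow> a 11 (a 13 i) = 0 \<and> a 11 (shift (s 0) (a 13 i) (s 0 - s 27)) \<noteq> 0"
  shows "run B searchA s a t (\<lambda>s' a' t'.
    ((\<forall>i<s 16. \<not> C i) \<and> a' = a \<and> same_except {2, 18} s s' \<and> s' 16 = s 16 \<and> s' 17 = s 17 \<and> t' \<le> t + 8 * s 16 + 1) \<or>
    (\<exists>i<s 16. C i \<and> (same_except {2, 17, 18} s s' \<and> s' 17 = 1 \<and>
       a' = a(11 := (a 11)(a 13 i := s 20), 13 := (a 13)(i := shift (s 0) (a 13 i) 1))) \<and> t' \<le> t + 8 * s 16 + 8 + 1))"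
  unfolding searchA_def
proof (rule run_search, goal_cases)
  case 1 show ?case by (rule s(1))
next
  case (2 i s' t')
  have e: "s' 0 = s 0" "s' 20 = s 20" "s' 27 = s 27" using 2(2) by (simp_all add: same_except_def)
  have i: "i < 2 * s 0" "a 13 i < s 0" "Suc i < B" using 2(1) s F B by auto
  have sh: "(a 13 i + (s 0 - s 27)) mod s 0 = shift (s 0) (a 13 i) (s 0 - s 27)"
    "(a 13 i + s 0 - s 27) mod s 0 = shift (s 0) (a 13 i) (s 0 - s 27)"
    "Suc (a 13 i) mod s 0 = shift (s 0) (a 13 i) 1" using s(5) by (simp_all add: shift_def)
  have lt: "shift (s 0) (a 13 i) (s 0 - s 27) < 2 * s 0" "a 13 i + (s 0 - s 27) < B"
    using shift_less[OF s(4), of "a 13 i" "s 0 - s 27"] i B by linarith+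
  have x: "same_except {2, 17, 18} s s'" using 2(2) by (auto simp: same_except_def)
  show ?case
    using 2 i lt s B C[of i] x unfolding hit_test_def by (simp add: e sh)
qed

lemma run_searchC:
  assumes s: "s 2 = 0" "s 17 = 0" "s 16 \<le> s 0" "0 < s 0" "s 27 \<le> s 0" and B: "2 * s 0 + 1 < B"
    and F: "\<And>i. i < s 16 \<Longrightarrow> a 12 i < s 0"
    and C: "\<And>i. C i \<longleftrightarrow> a 11 (shift (s 0) (a 12 i) (s 0 - 1)) = 0 \<and>
      a 11 (shift (s 0) (shift (s 0) (a 12 i) (s 0 - 1)) (s 0 - s 27)) \<noteq> 0"
  shows "run B searchC s a t (\<lambda>s' a' t'.
    ((\<forall>i<s 16. \<not> C i) \<and> a' = a \<and> same_except {2, 18} s s' \<and> s' 16 = s 16 \<and> s' 17 = s 17 \<and> t' \<le> t + 8 * s 16 + 1) \<or>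
    (\<exists>i<s 16. C i \<and> (same_except {2, 17, 18} s s' \<and> s' 17 = 1 \<and>
       a' = a(11 := (a 11)(shift (s 0) (a 12 i) (s 0 - 1) := s 20), 12 := (a 12)(i := shift (s 0) (a 12 i) (s 0 - 1)))) \<and>
       t' \<le> t + 8 * s 16 + 8 + 1))"
  unfolding searchC_def
proof (rule run_search, goal_cases)
  case 1 show ?case by (rule s(1))
next
  case (2 i s' t')
  have e: "s' 0 = s 0" "s' 20 = s 20" "s' 27 = s 27" using 2(2) by (simp_all add: same_except_def)
  let ?y = "shift (s 0) (a 12 i) (s 0 - 1)"
  have i: "i < 2 * s 0" "a 12 i < s 0" "Suc i < B" "1 < B" "a 12 i + (s 0 - 1) < B" using 2(1) s F[of i] B by auto
  have "a 12 i + s 0 - Suc 0 = a 12 i + (s 0 - 1)" "?y + s 0 - s 27 = ?y + (s 0 - s 27)" using s(4,5) by simp_all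
  then have sh: "(a 12 i + s 0 - Suc 0) mod s 0 = ?y" "(?y + s 0 - s 27) mod s 0 = shift (s 0) ?y (s 0 - s 27)"
    by (simp_all only: shift_def)
  have lt: "shift (s 0) ?y (s 0 - s 27) < 2 * s 0" "?y + (s 0 - s 27) < B" "?y < 2 * s 0"
    using shift_less[OF s(4), of ?y "s 0 - s 27"] shift_less[OF s(4), of "a 12 i" "s 0 - 1"] i B by linarith+
  have x: "same_except {2, 17, 18} s s'" using 2(2) by (auto simp: same_except_def)
  show ?case
    using 2 i lt s B C[of i] x unfolding hit_test_def by (simp add: e sh[unfolded One_nat_def])
qed

lemma run_searchB:
  assumes s: "s 2 = 0" "s 17 = 0" "s 16 \<le> s 0" "0 < s 0" "s 27 \<le> s 0" "s 3 < s 0" and B: "2 * s 0 + 1 < B"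
    and F: "\<And>i. i < s 16 \<Longrightarrow> a 12 i < s 0"
    and C: "\<And>i. C i \<longleftrightarrow> a 11 (shift (s 0) (a 12 i) (s 27)) = 0"
  shows "run B searchB s a t (\<lambda>s' a' t'.
    ((\<forall>i<s 16. \<not> C i) \<and> a' = a \<and> same_except {2, 18} s s' \<and> s' 16 = s 16 \<and> s' 17 = s 17 \<and> t' \<le> t + 8 * s 16 + 1) \<or>
    (\<exists>i<s 16. C i \<and> (same_except {2, 16, 18, 19} s s' \<and> s' 16 = Suc (s 16) \<and>
       a' = a(11 := (\<lambda>y. if y \<in> shift (s 0) (shift (s 0) (a 12 i) (s 27)) ` {..s 3} then s 20 else a 11 y),
         12 := (a 12)(s 16 := shift (s 0) (a 12 i) (s 27)),
         13 := (a 13)(s 16 := shift (s 0) (shift (s 0) (a 12 i) (s 27)) (s 3 + 1)))) \<and>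
       t' \<le> t + 8 * s 16 + (3 * (s 3 + 1) + 10) + 1))"
  unfolding searchB_def
proof (rule run_search, goal_cases)
  case 1 show ?case by (rule s(1))
next
  case (2 i s' t')
  have e: "s' 0 = s 0" "s' 20 = s 20" "s' 27 = s 27" "s' 3 = s 3" "s' 16 = s 16" using 2(2) by (simp_all add: same_except_def)
  let ?y = "shift (s 0) (a 12 i) (s 27)"
  have i: "i < 2 * s 0" "a 12 i < s 0" "Suc i < B" "1 < B" "a 12 i + s 27 < B" "s 16 < 2 * s 0" using 2(1) s F[of i] B by auto
  have sh: "(a 12 i + s 27) mod s 0 = ?y" by (simp add: shift_def)
  have lt: "?y < s 0" "?y < 2 * s 0" using shift_less[OF s(4), of "a 12 i" "s 27"] by linarith+
  have B2: "?y + Suc (s 3) < B" "Suc (s 3) < B" "Suc (s 16) < B" using lt s B by linarith+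
  have x: "same_except {2, 16, 18, 19} s s'" using 2(2) by (auto simp: same_except_def)
  show ?case
  proof (cases "a 11 ?y = 0")
    case False
    then show ?thesis using 2 i lt C[of i] by (simp add: e sh)
  next
    case True
    let ?s = "s'(18 := ?y, 19 := 0)"
    let ?a = "a(11 := (\<lambda>y. if y \<in> shift (s 0) ?y ` {..s 3} then s 20 else a 11 y))"
    have "run B fill_code ?s a (Suc (Suc (Suc (Suc t')))) (\<lambda>u v w. run B (Upd 12 (V 16) (V 18) ;;
         Upd 13 (V 16) (Modulo (Plus (V 18) (Plus (V 3) (N 1))) (V 0)) ;;
         Assign 16 (Plus (V 16) (N 1)) ;; Assign 2 (V 16)) u v w (\<lambda>s'' a'' t''.
        (\<not> C i \<and> a'' = a \<and> same_except {2, 18} s s'' \<and> s'' 2 = Suc i \<and> s'' 16 = s 16 \<and> s'' 17 = s 17 \<and> t'' \<le> t' + 8) \<or>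
        (C i \<and> (same_except {2, 16, 18, 19} s s'' \<and> s'' 16 = Suc (s 16) \<and>
       a'' = a(11 := (\<lambda>y. if y \<in> shift (s 0) ?y ` {..s 3} then s 20 else a 11 y),
         12 := (a 12)(s 16 := ?y), 13 := (a 13)(s 16 := shift (s 0) ?y (s 3 + 1)))) \<and> s'' 2 = s'' 16 \<and>
         t'' \<le> t' + (3 * (s 3 + 1) + 10))))"
    proof (rule run_mono, rule run_fill_code, goal_cases)
      case (6 s1 a1 t1)
      then have h: "same_except {19} ?s s1" "t1 \<le> t' + 3 * (s 3 + 1) + 5" "a1 = ?a" by (simp_all add: e cong: if_cong)
      have e1: "s1 0 = s 0" "s1 16 = s 16" "s1 18 = ?y" "s1 3 = s 3" using h(1) e by (simp_all add: same_except_def)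
      have x1: "same_except {2, 16, 18, 19} s s1" using h(1) x by (auto simp: same_except_def)
      have sh2: "Suc (?y + s 3) mod s 0 = shift (s 0) ?y (Suc (s 3))" by (simp add: shift_def)
      show ?case using True B2 i x1 h(2) C[of i] by (simp add: e1 h(3) sh2)
    qed (use lt s B in \<open>simp_all add: e\<close>)
    then show ?thesis using 2 i lt True B2 by (simp add: e sh)
  qed
qed

text \<open>The order matters: a full block may only be opened after \<open>searchC\<close> has
  failed at every left end. If \<open>searchA\<close> and \<open>searchB\<close> fail too, the set
  is everything.\<close>

definition step_code :: com where
  "step_code =
     Assign 27 (Arr 15 (V 20)) ;; Assign 17 (N 0) ;; Assign 2 (N 0) ;; searchA ;;
     If (Eq (V 17) (N 0))
       (Assign 2 (N 0) ;; searchC ;; If (Eq (V 17) (N 0)) (Assign 2 (N 0) ;; searchB) Skip)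
       Skip"

definition psize :: "nat \<Rightarrow> arrays \<Rightarrow> nat" where
  "psize p a = card {y. y < p \<and> a 11 y \<noteq> 0}"

lemma psize_le: "psize p a \<le> p"
proof -
  have "card {y. y < p \<and> a 11 y \<noteq> 0} \<le> card {..<p}" by (intro card_mono) auto
  then show ?thesis by (simp add: psize_def)
qed

text \<open>Opening a block takes about \<open>3 * (mu + 1)\<close> steps, too many for a single
  element, but it adds \<open>mu + 1\<close> residues. With \<open>3 * psize\<close> as potential
  the cost is paid by the growth of the set, which is bounded by \<open>p\<close> over the whole
  run.\<close>

lemma run_step_code:
  assumes inv: "cinv (s 0) (s 3) (a 15) (a 11) (a 12) (a 13) (s 16) (s 20)"
    and j: "s 20 < s 0" "a 15 (s 20) \<noteq> 1" and B: "2 * s 0 + 1 < B"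
  shows "run B step_code s a t (\<lambda>s' a' t'.
     same_except {2, 16, 17, 18, 19, 27} s s' \<and> same_except {11, 12, 13} a a' \<and>
     cinv (s 0) (s 3) (a' 15) (a' 11) (a' 12) (a' 13) (s' 16) (Suc (s 20)) \<and>
     t' + 3 * psize (s 0) a \<le> t + 24 * s 16 + 30 + 3 * psize (s 0) a')"
proof -
  interpret I: cinv "s 0" "s 3" "a 15" "a 11" "a 12" "a 13" "s 16" "s 20" by (rule inv)
  let ?p = "s 0" and ?d = "a 15 (s 20)" and ?j = "s 20" and ?ne = "s 16"
  let ?Q = "\<lambda>(s'::vars) (a'::arrays) (t'::nat).
     same_except {2, 16, 17, 18, 19, 27} s s' \<and> same_except {11, 12, 13} a a' \<and>
     cinv (s 0) (s 3) (a' 15) (a' 11) (a' 12) (a' 13) (s' 16) (Suc (s 20)) \<and>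
     t' + 3 * psize (s 0) a \<le> t + 24 * s 16 + 30 + 3 * psize (s 0) a'"
  have d: "1 \<le> ?d" "?d < ?p" using I.key[of ?j] I.j j by auto
  have ne: "?ne \<le> ?p"
  proof -
    have "?ne \<le> ?ne * (s 3 + 1)" by simp
    also have "\<dots> \<le> psize ?p a" using I.ne by (simp only: psize_def)
    also have "\<dots> \<le> ?p" by (rule psize_le)
    finally show ?thesis .
  qed
  let ?s1 = "s(27 := ?d, 17 := 0, 2 := 0)"
  let ?c2 = "If (Eq (V 17) (N 0)) (Assign 2 (N 0) ;; searchB) Skip"
  let ?c1 = "If (Eq (V 17) (N 0)) (Assign 2 (N 0) ;; searchC ;; ?c2) Skip"
  have B0: "0 < B" using B by simp
  have A: "run B searchA ?s1 a (Suc (Suc (Suc t))) (\<lambda>u v w. run B ?c1 u v w ?Q)"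
  proof (rule run_mono, rule run_searchA[where C = I.condA], goal_cases)
    case (8 i) show ?case by (simp add: I.condA_def)
  next
    case (9 s1 a1 t1)
    then show ?case
    proof (elim disjE exE conjE, goal_cases)
      case (2 i)
      then have h: "i < ?ne" "I.condA i" "same_except {2, 17, 18} ?s1 s1" "s1 17 = 1"
        "a1 = a(11 := (a 11)(a 13 i := ?j), 13 := (a 13)(i := shift ?p (a 13 i) 1))" "t1 \<le> t + 8 * ?ne + 12"
        by (simp_all cong: if_cong)
      note g = I.addA[OF j h(1,2)]
      have p: "psize ?p a1 = psize ?p a + 1" using g(2) unfolding psize_def h(5) by simp
      have "s1 16 = ?ne" using h(3) by (simp add: same_except_def)
      then have "cinv ?p (s 3) (a1 15) (a1 11) (a1 12) (a1 13) (s1 16) (Suc ?j)" using g(1) unfolding h(5) by simp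
      moreover have "same_except {2, 16, 17, 18, 19, 27} s s1" using h(3) by (auto simp: same_except_def)
      moreover have "same_except {11, 12, 13} a a1" unfolding h(5) by simp
      ultimately show ?case using h(4,6) p B0 by simp
    next
      case 1
      then have h: "\<forall>i<?ne. \<not> I.condA i" "a1 = a" "same_except {2, 18} ?s1 s1" "s1 16 = ?ne" "s1 17 = 0"
        "t1 \<le> t + 8 * ?ne + 4"
        by (simp_all cong: if_cong)
      have e1: "s1 0 = ?p" "s1 3 = s 3" "s1 20 = ?j" "s1 27 = ?d" using h(3) by (simp_all add: same_except_def)
      let ?s2 = "s1(2 := 0)"
      have "run B searchC ?s2 a (Suc (Suc t1)) (\<lambda>u v w. run B ?c2 u v w ?Q)"
      proof (rule run_mono, rule run_searchC[where C = I.condC], goal_cases)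
        case (8 i) show ?case by (simp add: I.condC_def e1)
      next
        case (9 s2 a2 t2)
        then show ?case
        proof (elim disjE exE conjE, goal_cases)
          case (2 i)
          then have h2: "i < ?ne" "I.condC i" "same_except {2, 17, 18} ?s2 s2" "s2 17 = 1"
            "a2 = a(11 := (a 11)(shift ?p (a 12 i) (?p - 1) := ?j), 12 := (a 12)(i := shift ?p (a 12 i) (?p - 1)))"
            "t2 \<le> t1 + 8 * ?ne + 11"
            by (simp_all add: e1 h cong: if_cong)
          note g = I.addC[OF j h2(1,2) refl]
          have p: "psize ?p a2 = psize ?p a + 1" using g(2) unfolding psize_def h2(5) by simp
          have "s2 16 = ?ne" using h2(3) h by (simp add: same_except_def)
          then have "cinv ?p (s 3) (a2 15) (a2 11) (a2 12) (a2 13) (s2 16) (Suc ?j)" using g(1) unfolding h2(5) by simp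
          moreover have "same_except {2, 16, 17, 18, 19, 27} s s2" using h(3) h2(3) by (auto simp: same_except_def)
          moreover have "same_except {11, 12, 13} a a2" unfolding h2(5) by simp
          ultimately show ?case using h(6) h2(4,6) p B0 by simp
        next
          case 1
          then have h2: "\<forall>i<?ne. \<not> I.condC i" "a2 = a" "same_except {2, 18} ?s2 s2" "s2 16 = ?ne" "s2 17 = 0"
            "t2 \<le> t1 + 8 * ?ne + 3"
            by (simp_all add: e1 h cong: if_cong)
          have e2: "s2 0 = ?p" "s2 3 = s 3" "s2 20 = ?j" "s2 27 = ?d" using h2(3) e1 by (simp_all add: same_except_def)
          let ?s3 = "s2(2 := 0)"
          have x: "same_except {2, 16, 17, 18, 19, 27} s s2" using h(3) h2(3) by (auto simp: same_except_def)
          have "run B searchB ?s3 a (Suc (Suc t2)) ?Q"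
          proof (rule run_mono, rule run_searchB[where C = I.condB], goal_cases)
            case (9 i) show ?case by (simp add: I.condB_def e2)
          next
            case (10 s3 a3 t3)
            then show ?case
            proof (elim disjE exE conjE, goal_cases)
              case (2 i)
              let ?y = "shift ?p (a 12 i) ?d"
              have h3: "i < ?ne" "I.condB i" "same_except {2, 16, 18, 19} ?s3 s3" "s3 16 = Suc ?ne"
                "t3 \<le> t2 + 8 * ?ne + 3 * (s 3 + 1) + 13"
                "a3 = a(11 := (\<lambda>y. if y \<in> shift ?p ?y ` {..s 3} then ?j else a 11 y),
                   12 := (a 12)(?ne := ?y), 13 := (a 13)(?ne := shift ?p ?y (s 3 + 1)))"
                using 2 by (simp_all add: e2 h2 cong: if_cong)
              note g = I.addB[OF j h3(1,2) _ refl, of "\<lambda>y. if y \<in> shift ?p ?y ` {..s 3} then ?j else a 11 y", OF _ refl]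
              have noC: "\<not> I.condC k" if "k < ?ne" for k using h2(1) that by blast
              have p: "psize ?p a3 = psize ?p a + (s 3 + 1)" using g(2)[OF noC] unfolding psize_def h3(6) by simp
              have "cinv ?p (s 3) (a3 15) (a3 11) (a3 12) (a3 13) (s3 16) (Suc ?j)"
                using g(1)[OF noC] unfolding h3(4,6) by simp
              moreover have "same_except {2, 16, 17, 18, 19, 27} s s3" using x h3(3) by (auto simp: same_except_def)
              moreover have "same_except {11, 12, 13} a a3" unfolding h3(6) by simp
              ultimately show ?case using h(6) h2(6) h3(5) p by simp
            next
              case 1
              then have h3: "\<forall>i<?ne. \<not> I.condB i" "a3 = a" "same_except {2, 18} ?s3 s3" "s3 16 = ?ne"
                "t3 \<le> t2 + 8 * ?ne + 3"
                by (simp_all add: e2 h2 cong: if_cong)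
              have "\<forall>y<?p. a 11 y \<noteq> 0" using I.saturated[OF j(1)] h(1) h3(1) by blast
              then have "cinv ?p (s 3) (a 15) (a 11) (a 12) (a 13) ?ne (Suc ?j)" using I.skip[OF j(1)] by blast
              moreover have "same_except {2, 16, 17, 18, 19, 27} s s3" using x h3(3) by (auto simp: same_except_def)
              ultimately show ?case using h(6) h2(6) h3(2,4,5) by simp
            qed
          qed (use ne d I.mu I.p I.E(1) B h2 in \<open>simp_all add: e2\<close>)
          then show ?case using h2 B0 by simp
        qed
      qed (use ne d I.p I.E(1) B h in \<open>simp_all add: e1\<close>)
      then show ?case using h B0 by simp
    qed
  qed (use ne d I.p I.F(1) B in simp_all)
  show ?thesis using A j B0 unfolding step_code_def by simp
qed

section \<open>Processing all elements when one value is frequent\<close>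

definition grow_code :: com where
  "grow_code = While (Less (V 20) (V 0))
     (If (Eq (Arr 15 (V 20)) (N 1)) Skip step_code ;; Assign 20 (Plus (V 20) (N 1)))"

definition case1_code :: com where
  "case1_code =
     Assign 18 (N 0) ;; Assign 19 (N 0) ;; Assign 20 (V 0) ;; fill_code ;;
     Upd 12 (N 0) (N 0) ;; Upd 13 (N 0) (Modulo (Plus (V 3) (N 1)) (V 0)) ;;
     Assign 16 (N 1) ;; Assign 20 (N 1) ;; grow_code ;;
     Assign 20 (V 0) ;; read_code ;; Assign 2 (N 1) ;; Assign 9 (V 0) ;; base_code"

lemma run_grow_code:
  assumes inv: "cinv (s 0) (s 3) (a 15) (a 11) (a 12) (a 13) (s 16) 1" and s20: "s 20 = 1"
    and B: "2 * s 0 + 1 < B" and mu: "s 0 \<le> 16384 * s 3"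
  shows "run B grow_code s a t (\<lambda>s' a' t'.
     same_except {2, 16, 17, 18, 19, 20, 27} s s' \<and> same_except {11, 12, 13} a a' \<and>
     cinv (s 0) (s 3) (a' 15) (a' 11) (a' 12) (a' 13) (s' 16) (s 0) \<and> t' \<le> t + 400003 * s 0 + 1)"
proof -
  define I where "I = (\<lambda>(s'::vars) (a'::arrays) (t'::nat).
     same_except {2, 16, 17, 18, 19, 20, 27} s s' \<and> same_except {11, 12, 13} a a' \<and>
     cinv (s 0) (s 3) (a' 15) (a' 11) (a' 12) (a' 13) (s' 16) (s' 20) \<and>
     t' \<le> t + 400000 * s' 20 + 3 * psize (s 0) a')"
  show ?thesis unfolding grow_code_def
  proof (rule run_While[where M = "\<lambda>s' a'. s 0 - s' 20" and I = I], goal_cases)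
    case 1
    show ?case unfolding I_def using inv s20 by simp
  next
    case (2 s' a' t')
    then have h: "same_except {2, 16, 17, 18, 19, 20, 27} s s'" "same_except {11, 12, 13} a a'"
      "cinv (s 0) (s 3) (a' 15) (a' 11) (a' 12) (a' 13) (s' 16) (s' 20)" "t' \<le> t + 400000 * s' 20 + 3 * psize (s 0) a'"
      by (simp_all add: I_def)
    interpret C: cinv "s 0" "s 3" "a' 15" "a' 11" "a' 12" "a' 13" "s' 16" "s' 20" by (rule h(3))
    have e: "s' 0 = s 0" "s' 3 = s 3" using h(1) by (simp_all add: same_except_def)
    show ?case
    proof (cases "s' 20 < s 0")
      case True
      have b: "1 < B" "Suc (s' 20) < B" "s' 20 < 2 * s 0" using True B by linarith+
      have ms: "s 0 - Suc (s' 20) < s 0 - s' 20" using True by simp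
      show ?thesis
      proof (cases "a' 15 (s' 20) = 1")
        case k: True
        have "I (s'(20 := Suc (s' 20))) a' (Suc (Suc (Suc t')))"
          unfolding I_def using h C.skip[OF True] k by simp
        then show ?thesis using True k b ms by (simp add: e)
      next
        case k: False
        have ne: "s' 16 \<le> 16384"
        proof (rule ccontr)
          assume "\<not> s' 16 \<le> 16384"
          then have "16384 * (s 3 + 1) \<le> s' 16 * (s 3 + 1)" by (intro mult_le_mono1) simp
          also have "\<dots> \<le> psize (s 0) a'" using C.ne by (simp only: psize_def)
          also have "\<dots> \<le> s 0" by (rule psize_le)
          finally show False using mu by simp
        qed
        have "run B step_code s' a' (Suc (Suc t')) (\<lambda>u v w. run B (Assign 20 (Plus (V 20) (N 1))) u v w
            (\<lambda>s'' a'' t''. I s'' a'' t'' \<and> s 0 - s'' 20 < s 0 - s' 20))"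
        proof (rule run_mono, rule run_step_code, goal_cases)
          case 1 show ?case using h(3) by (simp add: e)
        next
          case (5 s1 a1 t1)
          then have g: "same_except {2, 16, 17, 18, 19, 27} s' s1" "same_except {11, 12, 13} a' a1"
            "cinv (s 0) (s 3) (a1 15) (a1 11) (a1 12) (a1 13) (s1 16) (Suc (s' 20))"
            "t1 + 3 * psize (s 0) a' \<le> t' + 2 + 24 * s' 16 + 30 + 3 * psize (s 0) a1"
            by (simp_all add: e)
          have e1: "s1 20 = s' 20" using g(1) by (simp add: same_except_def)
          have x: "same_except {2, 16, 17, 18, 19, 20, 27} s s1" using h(1) g(1) by (auto simp: same_except_def)
          have y: "same_except {11, 12, 13} a a1" using h(2) g(2) by (auto simp: same_except_def)
          \<comment> \<open>The three searches cost at most \<open>24 * 16384 = 393216\<close>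
            steps; together with the overhead this stays below \<open>400000\<close>.\<close>
          have "t1 + 1 \<le> t + (400000 * s' 20 + 400000) + 3 * psize (s 0) a1" using g(4) h(4) ne by linarith
          then have "Suc t1 \<le> t + 400000 * Suc (s' 20) + 3 * psize (s 0) a1" by simp
          then have "I (s1(20 := Suc (s' 20))) a1 (Suc t1)"
            unfolding I_def using x y g(3) by simp
          then show ?case using b ms by (simp add: e1)
        qed (use True k B in \<open>simp_all add: e\<close>)
        then show ?thesis using True k b by (simp add: e)
      qed
    qed (simp add: e)
  next
    case (3 s' a' t')
    then have h: "same_except {2, 16, 17, 18, 19, 20, 27} s s'" "same_except {11, 12, 13} a a'"
      "cinv (s 0) (s 3) (a' 15) (a' 11) (a' 12) (a' 13) (s' 16) (s' 20)" "t' \<le> t + 400000 * s' 20 + 3 * psize (s 0) a'"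
      by (simp_all add: I_def)
    interpret C: cinv "s 0" "s 3" "a' 15" "a' 11" "a' 12" "a' 13" "s' 16" "s' 20" by (rule h(3))
    have "s' 20 = s 0" using 3(2) C.j(2) h(1) by (simp add: same_except_def)
    moreover have "psize (s 0) a' \<le> s 0" by (rule psize_le)
    ultimately show ?case using h by simp
  qed
qed

lemma cinv_init:
  assumes "prime p" "0 < mu" "mu < p" "\<And>i. 1 \<le> i \<Longrightarrow> i < p \<Longrightarrow> 1 \<le> key i \<and> key i < p"
    and par: "\<And>y. y < p \<Longrightarrow> par y = (if y \<le> mu then p else 0)" and "E 0 = 0" "F 0 = (mu + 1) mod p"
  shows "cinv p mu key par E F 1 1"
proof -
  have p: "1 < p" using assms(1) prime_gt_1_nat by simp
  have pred: "shift p y (p - 1) = y - 1" if "1 \<le> y" "y < p" for y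
  proof -
    have "y + (p - 1) = (y - 1) + p" using that p by simp
    then have "shift p y (p - 1) = (y - 1 + p) mod p" unfolding shift_def by (rule arg_cong)
    also have "\<dots> = (y - 1) mod p" by (rule mod_add_self2)
    also have "\<dots> = y - 1" using that by (intro mod_less) simp
    finally show ?thesis .
  qed
  have S: "{y. y < p \<and> par y \<noteq> 0} = {..mu}" using par assms(3) p by (auto split: if_splits)
  have sh: "shift p 0 k = k" if "k \<le> mu" for k using that assms(3) by (simp add: shift_def)
  \<comment> \<open>For \<open>mu = p - 1\<close> the entry \<open>F 0\<close> wraps around to
    \<open>0\<close>, a member of the set; it is then a stale entry, but its predecessor is still
    \<open>mu\<close>.\<close>
  have F0: "shift p (F 0) (p - 1) = mu"
  proof -
    have "mu + 1 + (p - 1) = mu + p" using p by simp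
    then show ?thesis using assms(3,7) unfolding shift_def by (metis mod_add_left_eq mod_add_self2 mod_less)
  qed
  show ?thesis
  proof (unfold_locales, goal_cases)
    case (5 y) then show ?case using par[of y] p by simp
  next
    case (6 y) then show ?case using par[of y] p by (auto split: if_splits)
  next
    case (9 i) then show ?case using assms(6) p by simp
  next
    case (10 i k) then show ?case using assms(3,6) par[of k] p sh[of k] by simp
  next
    case (11 i) then show ?case using assms(7) p by simp
  next
    case (12 i) then show ?case using F0 par[of mu] assms(3) p by simp
  next
    case (13 y)
    have y: "y \<le> mu" using 13 par[of y] by (auto split: if_splits)
    have "y = 0"
    proof (rule ccontr)
      assume "y \<noteq> 0"
      then have "par (shift p y (p - 1)) = p" using pred[of y] 13(1) par[of "y - 1"] y by simp
      then show False using 13(3) p by simp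
    qed
    then show ?case using assms(6) by auto
  next
    case (14 y)
    have y: "\<not> y \<le> mu" using 14 par[of y] p by (auto split: if_splits)
    then have "shift p y (p - 1) = y - 1" using pred[of y] 14(1) by simp
    then have "y - 1 \<le> mu" using 14(1,3) par[of "y - 1"] by (auto split: if_splits)
    then have "y = mu + 1" using y by simp
    then show ?case using assms(7) 14(1) by auto
  next
    case 15 then show ?case unfolding S by simp
  next
    case 16 then show ?case unfolding S by simp
  qed (use assms p in auto)
qed

lemma run_case1:
  assumes prime: "prime (s 0)" and mu: "0 < s 3" "s 0 \<le> 16384 * s 3" and x: "s 22 < s 0"
    and B: "2 * s 0 + 1 < B"
    and key: "\<And>i. i \<in> {1..<s 0} \<Longrightarrow> 1 \<le> a 15 i \<and> a 15 i < s 0"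
    and ones: "occ (a 15) 1 (s 0) 1 = s 3"
    and zero: "\<And>i. 1 \<le> i \<Longrightarrow> i < s 0 \<Longrightarrow> a 0 i = 0" "\<And>i. i < s 0 \<Longrightarrow> a 11 i = 0"
  shows "run B case1_code s a t (\<lambda>s' a' t'.
     t' \<le> t + 400100 * s 0 + 100 \<and> (\<forall>i\<in>{1..<s 0}. a' 0 i \<le> 1) \<and>
     [(\<Sum>i\<in>{1..<s 0}. a' 0 i * a 15 i) = s 22] (mod s 0))"
proof -
  define p where "p = s 0"
  define m where "m = s 3"
  note d = p_def m_def
  have p: "1 < p" using prime prime_gt_1_nat by (simp add: d)
  have m: "m < p" using ones occ_le[of "a 15" 1 "s 0" 1] p by (simp add: d)
  let ?Q = "\<lambda>(s'::vars) (a'::arrays) (t'::nat). t' \<le> t + 400100 * p + 100 \<and> (\<forall>i\<in>{1..<p}. a' 0 i \<le> 1) \<and>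
     [(\<Sum>i\<in>{1..<p}. a' 0 i * a 15 i) = s 22] (mod p)"
  let ?c3 = "Assign 2 (N 1) ;; Assign 9 (V 0) ;; base_code"
  let ?c2 = "Assign 20 (V 0) ;; read_code ;; ?c3"
  let ?c1 = "Upd 12 (N 0) (N 0) ;; Upd 13 (N 0) (Modulo (Plus (V 3) (N 1)) (V 0)) ;;
     Assign 16 (N 1) ;; Assign 20 (N 1) ;; grow_code ;; ?c2"
  have b: "1 < B" "Suc m < B" using B m by (simp_all add: d)
  let ?s = "s(18 := 0, 19 := 0, 20 := p)"
  have "run B fill_code ?s a (Suc (Suc (Suc t))) (\<lambda>u v w. run B ?c1 u v w ?Q)"
  proof (rule run_mono, rule run_fill_code, goal_cases)
    case (6 s1 a1 t1)
    then have h1: "same_except {19} ?s s1" "t1 \<le> t + 3 * (m + 1) + 4"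
      "a1 = a(11 := (\<lambda>y. if y \<in> shift p 0 ` {..m} then p else a 11 y))"
      by (simp_all add: d cong: if_cong)
    have e1: "s1 0 = p" "s1 3 = m" "s1 22 = s 22" using h1(1) by (simp_all add: same_except_def d)
    let ?a2 = "a1(12 := (a1 12)(0 := 0), 13 := (a1 13)(0 := Suc m mod p))"
    let ?s2 = "s1(16 := 1, 20 := 1)"
    have im: "shift p 0 ` {..m} = {..m}" using m by (auto simp: shift_def image_iff)
    have ci: "cinv p m (a 15) (a1 11) (?a2 12) (?a2 13) 1 1"
      using prime mu m key zero(2) by (intro cinv_init) (auto simp: d h1(3) im[unfolded d])
    have "run B grow_code ?s2 ?a2 (Suc (Suc (Suc (Suc t1)))) (\<lambda>u v w. run B ?c2 u v w ?Q)"
    proof (rule run_mono, rule run_grow_code, goal_cases)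
      case 1 show ?case using ci by (simp add: e1 h1(3))
    next
      case (5 s2 a2 t2)
      then have h2: "same_except {2, 16, 17, 18, 19, 20, 27} ?s2 s2" "same_except {11, 12, 13} ?a2 a2"
        "cinv p m (a2 15) (a2 11) (a2 12) (a2 13) (s2 16) p" "t2 \<le> t1 + 4 + 400003 * p + 1"
        by (simp_all add: e1)
      have e2: "s2 0 = p" "s2 3 = m" "s2 22 = s 22" "a2 15 = a 15" "a2 0 = a 0"
        using h2(1,2) e1 by (simp_all add: same_except_def h1(3))
      interpret C: cinv p m "a 15" "a2 11" "a2 12" "a2 13" "s2 16" p using h2(3) by (simp add: e2)
      have ones': "card {i \<in> {1..<p}. a 15 i = 1} = m" using ones by (simp add: occ_def d)
      have "card ({1..<p} - {i \<in> {1..<p}. a 15 i = 1}) = card {1..<p} - card {i \<in> {1..<p}. a 15 i = 1}"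
        by (rule card_Diff_subset) auto
      moreover have "{1..<p} - {i \<in> {1..<p}. a 15 i = 1} = {i \<in> {1..<p}. a 15 i \<noteq> 1}" by auto
      ultimately have "card {i \<in> {1..<p}. a 15 i \<noteq> 1} = p - 1 - m" using ones' by (simp only: card_atLeastLessThan)
      \<comment> \<open>Unless the set was full before, each of the \<open>p - 1 - mu\<close>
        elements different from \<open>1\<close> has enlarged it, starting from
        \<open>mu + 1\<close> residues.\<close>
      then have full: "p \<le> card {y. y < p \<and> a2 11 y \<noteq> 0}" using C.card m by linarith
      have all: "a2 11 y \<noteq> 0" if "y < p" for y
      proof -
        have "{y. y < p \<and> a2 11 y \<noteq> 0} = {..<p}"
          using full by (intro card_subset_eq) (auto intro!: antisym card_mono[of "{..<p}", simplified])
        then show ?thesis using that by blast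
      qed
      let ?s3 = "s2(20 := p)"
      have "run B read_code ?s3 a2 (Suc t2) (\<lambda>u v w. run B ?c3 u v w ?Q)"
      proof (rule run_mono, rule run_read_code, goal_cases)
        case (4 y)
        then have y: "y < p" "a2 11 y \<noteq> p" by (simp_all add: e2)
        have c: "1 \<le> a2 11 y" "a2 11 y < p" "a 15 (a2 11 y) \<noteq> 1"
          "a2 11 (shift p y (p - a 15 (a2 11 y))) = p \<or> a2 11 (shift p y (p - a 15 (a2 11 y))) < a2 11 y"
          using C.par[OF y(1) all[OF y(1)] y(2)] by auto
        have k: "a 15 (a2 11 y) < p" using C.key[OF c(1,2)] by simp
        then have "(y + p - a 15 (a2 11 y)) mod p = shift p y (p - a 15 (a2 11 y))" by (simp add: shift_def)
        then show ?case using c k by (simp add: e2)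
      next
        case (5 s3 a3 t3)
        then have h3: "same_except {20, 22} ?s3 s3" "same_except {0} a2 a3" "t3 \<le> t2 + 1 + 5 * p + 1"
          "s3 22 < p" "a2 11 (s3 22) = p"
          by (simp_all add: e2)
        have "\<exists>T. T \<subseteq> {i \<in> {1..<p}. a 15 i \<noteq> 1} \<and> [(\<Sum>i\<in>T. a 15 i) + s3 22 = s 22] (mod p) \<and>
            a3 0 = (\<lambda>i. if i \<in> T then 1 else a 0 i)"
          using 5[THEN conjunct2, THEN conjunct2, THEN conjunct2, THEN conjunct2, THEN conjunct2] by (simp add: e2 cong: if_cong)
        then obtain T where T: "T \<subseteq> {i \<in> {1..<p}. a 15 i \<noteq> 1}" "[(\<Sum>i\<in>T. a 15 i) + s3 22 = s 22] (mod p)"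
            "a3 0 = (\<lambda>i. if i \<in> T then 1 else a 0 i)"
          by (elim exE conjE) (rule that)
        have e3: "s3 0 = p" "a3 15 = a 15" using h3(1,2) e2 by (simp_all add: same_except_def)
        have xm: "s3 22 \<le> m" using C.base[OF h3(4)] h3(5) by simp
        let ?s4 = "s3(2 := 1, 9 := p)"
        have "run B base_code ?s4 a3 (Suc (Suc t3)) ?Q"
        proof (rule run_mono, rule run_base_code, goal_cases)
          case 4 show ?case using xm ones by (simp add: e3 d)
        next
          case (5 s4 a4 t4)
          then have h4: "t4 \<le> t3 + 2 + 6 * (p - 1) + 1" by (simp add: e3)
          have "\<exists>U. U \<subseteq> {i \<in> {1..<p}. a 15 i = 1} \<and> card U = s3 22 \<and> a4 0 = (\<lambda>i. if i \<in> U then 1 else a3 0 i)"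
            using 5[THEN conjunct2, THEN conjunct2, THEN conjunct2] by (simp add: e3 cong: if_cong)
          then obtain U where U: "U \<subseteq> {i \<in> {1..<p}. a 15 i = 1}" "card U = s3 22" "a4 0 = (\<lambda>i. if i \<in> U then 1 else a3 0 i)"
            by (elim exE conjE) (rule that)
          have fU: "finite U" using U(1) finite_subset by fastforce
          have fT: "finite T" using T(1) finite_subset by fastforce
          have TU: "T \<inter> U = {}" using T(1) U(1) by fastforce
          have bit: "a4 0 i = (if i \<in> T \<union> U then 1 else 0)" if "i \<in> {1..<p}" for i
            using T(3) U(3) zero(1)[of i] that by (auto simp: d)
          have "(\<Sum>i\<in>{1..<p}. a4 0 i * a 15 i) = (\<Sum>i\<in>T \<union> U. a 15 i)"
          proof (rule sum_indicator_mult)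
            show "T \<union> U \<subseteq> {1..<p}" using T(1) U(1) by auto
          next
            show "a4 0 i = 0" if "i \<in> {1..<p}" "i \<notin> T \<union> U" for i using bit[of i] that by auto
            show "a4 0 i = 1" if "i \<in> T \<union> U" for i using T(3) U(3) that by auto
          qed simp
          also have "\<dots> = (\<Sum>i\<in>T. a 15 i) + (\<Sum>i\<in>U. a 15 i)" using fT fU TU by (rule sum.union_disjoint)
          also have "(\<Sum>i\<in>U. a 15 i) = (\<Sum>i\<in>U. 1)" using U(1) by (intro sum.cong) auto
          also have "\<dots> = s3 22" using U(2) by simp
          finally have "[(\<Sum>i\<in>{1..<p}. a4 0 i * a 15 i) = s 22] (mod p)" using T(2) by simp
          moreover have "\<forall>i\<in>{1..<p}. a4 0 i \<le> 1" using bit by auto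
          moreover have "t4 \<le> t + 400100 * p + 100"
          proof -
            have "t1 \<le> t + 3 * m + 7" "t4 \<le> t3 + 6 * p + 3" using h1(2) h4 by simp_all
            then show ?thesis using h3(3) h2(4) m by linarith
          qed
          ultimately show ?case by blast
        qed (use p B in \<open>simp_all add: e3 d\<close>)
        then show ?case using b by (simp add: e3)
      qed (use x B in \<open>simp_all add: e2 d\<close>)
      then show ?case by (simp add: e2)
    qed (use mu B in \<open>simp_all add: e1 d\<close>)
    then show ?case using b p by (simp add: e1)
  qed (use p m B in \<open>simp_all add: d\<close>)
  then show ?thesis using b by (simp add: case1_code_def d)
qed

section \<open>The complete program and its resource bounds\<close>

definition main_code :: com where
  "main_code =
     Assign 2 (N 1) ;; Assign 11 (V 0) ;; Assign 14 (N 0) ;; count_code 0 4 ;;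
     Assign 3 (V 14) ;; Assign 4 (Inv (V 0) (V 4)) ;; Assign 2 (N 1) ;; scale_code 0 ;;
     Assign 22 (Modulo (Times (V 1) (V 4)) (V 0)) ;;
     If (Less (Times (N 16384) (V 3)) (V 0)) case2_code case1_code"

lemma run_main_code:
  assumes prime: "prime (s 0)" and x: "s 1 < s 0"
    and B: "s 0 * s 0 < B" "16384 * s 0 < B" "2 * s 0 + 1 < B"
    and dk: "\<And>i. i \<in> {1..<s 0} \<Longrightarrow> 1 \<le> a 0 i \<and> a 0 i < s 0"
    and zero: "\<And>i. s 0 \<le> i \<Longrightarrow> i < 2 * s 0 \<Longrightarrow> a 0 i = 0"
      "\<And>k i. k \<in> {4, 5, 6, 7, 9, 10, 11} \<Longrightarrow> i < 2 * s 0 \<Longrightarrow> a k i = 0"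
  shows "run B main_code s a 0 (\<lambda>s' a' t'.
     t' \<le> 400200 * s 0 + 200 \<and> (\<forall>i\<in>{1..<s 0}. a' 0 i \<le> 1) \<and>
     [(\<Sum>i\<in>{1..<s 0}. a' 0 i * a 0 i) = s 1] (mod s 0))"
proof -
  define p where "p = s 0"
  have p: "1 < p" using prime prime_gt_1_nat by (simp add: p_def)
  note d = p_def
  let ?Q = "\<lambda>(s'::vars) (a'::arrays) (t'::nat). t' \<le> 400200 * p + 200 \<and> (\<forall>i\<in>{1..<p}. a' 0 i \<le> 1) \<and>
     [(\<Sum>i\<in>{1..<p}. a' 0 i * a 0 i) = s 1] (mod p)"
  let ?c2 = "Assign 22 (Modulo (Times (V 1) (V 4)) (V 0)) ;;
     If (Less (Times (N 16384) (V 3)) (V 0)) case2_code case1_code"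
  let ?c1 = "Assign 3 (V 14) ;; Assign 4 (Inv (V 0) (V 4)) ;; Assign 2 (N 1) ;; scale_code 0 ;; ?c2"
  have b: "1 < B" "0 < B" "16384 < B" using B p by (simp_all add: d)
  have pB: "i * j < B" if "i < p" "j < p" for i j
    using mult_strict_mono[of i p j p] that B(1) by (simp add: d)
  let ?s = "s(2 := 1, 11 := p, 14 := 0)"
  have "run B (count_code 0 4) ?s a (Suc (Suc (Suc 0))) (\<lambda>u v w. run B ?c1 u v w ?Q)"
  proof (rule run_mono, rule run_count_code, goal_cases)
    case (6 i) then show ?case using dk[of i] by (simp add: d)
  next
    case (7 i) then show ?case using zero(2)[of 4 i] by simp
  next
    case (8 s1 a1 t1)
    then have h1: "same_except {2, 4, 5, 14} ?s s1" "same_except {4} a a1" "t1 \<le> 7 * (p - 1) + 4"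
      "\<forall>v<2 * p. occ (a 0) 1 p v \<le> s1 14" "s1 14 \<le> p - 1" "s1 4 \<in> a 0 ` {1..<p}" "occ (a 0) 1 p (s1 4) = s1 14" "0 < s1 14"
      using p by (simp_all add: d)
    define v where "v = s1 4"
    define m where "m = s1 14"
    define w where "w = nat (modular_inverse (int p) (int v))"
    have e1: "s1 0 = p" "s1 1 = s 1" using h1(1) by (simp_all add: same_except_def d)
    have a1: "a1 k = a k" if "k \<noteq> 4" for k using h1(2) that by (simp add: same_except_def)
    obtain i0 where i0: "i0 \<in> {1..<p}" "v = a 0 i0" using h1(6) unfolding v_def by blast
    have v: "0 < v" "v < p" using dk[of i0] i0 by (auto simp: d)
    have w: "w < p" "[v * w = 1] (mod p)"
      using nat_modular_inverse[of p v w] v prime by (auto simp: d w_def)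
    let ?s2 = "s1(3 := m, 4 := w, 2 := 1)"
    have "run B (scale_code 0) ?s2 a1 (Suc (Suc (Suc t1))) (\<lambda>u v w. run B ?c2 u v w ?Q)"
    proof (rule run_mono, rule run_scale_code, goal_cases)
      case (5 i) then show ?case using pB[of "a 0 i" w] dk[of i] w by (simp add: e1 a1 d)
    next
      case (6 s2 a2 t2)
      then have h2: "same_except {2} ?s2 s2" "same_except {0, 15} a1 a2" "t2 \<le> t1 + 3 + 4 * p + 1"
       "\<forall>i. a2 15 i = (if 1 \<le> i \<and> i < p then a 0 i * w mod p else a1 15 i)"
       "\<forall>i. a2 0 i = (if 1 \<le> i \<and> i < p then 0 else a 0 i)"
        by (simp_all add: e1 a1)
      have e2: "s2 0 = p" "s2 1 = s 1" "s2 3 = m" "s2 4 = w" using h2(1) e1 by (simp_all add: same_except_def)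
      have a2: "a2 k = a k" if "k \<notin> {0, 4, 15}" for k using h2(2) a1[of k] that by (simp add: same_except_def)
      have ky: "a2 15 i = a 0 i * w mod p" if "i \<in> {1..<p}" for i using h2(4) that by simp
      have key: "1 \<le> a2 15 i \<and> a2 15 i < p" if "i \<in> {1..<p}" for i
      proof -
        have "a 0 i * w mod p \<noteq> 0 * w mod p" using scale_inj[OF w(2), of "a 0 i" 0] dk[of i] that p by (auto simp: d)
        then show ?thesis using ky[OF that] p by simp
      qed
      have sc: "a 0 i < p \<and> a2 15 i = a 0 i * w mod p" if "i \<in> {1..<p}" for i using dk[of i] ky that by (simp add: d)
      have mult0: "occ (a 0) 1 p u \<le> m" for u
      proof (cases "u < 2 * p")
        case True then show ?thesis using h1(4) by (simp add: m_def)
      next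
        case False
        then have "{j \<in> {1..<p}. a 0 j = u} = {}" using dk by (force simp: d)
        then show ?thesis by (simp only: occ_def card.empty)
      qed
      have mult: "occ (a2 15) 1 p u \<le> m" for u
        using occ_scale[OF w(2) sc mult0, of u] by (simp only: occ_def)
      have ones: "occ (a2 15) 1 p 1 = m"
      proof -
        have vw: "v * w mod p = 1" using w(2) p by (simp add: cong_def)
        have "a2 15 i = 1 \<longleftrightarrow> a 0 i = v" if "i \<in> {1..<p}" for i
          using scale_inj[OF w(2), of "a 0 i" v] vw v sc[OF that] by auto
        then have "{j \<in> {1..<p}. a2 15 j = 1} = {j \<in> {1..<p}. a 0 j = v}" by blast
        then have "occ (a2 15) 1 p 1 = occ (a 0) 1 p v" by (simp only: occ_def)
        then show ?thesis using h1(7) by (simp add: v_def m_def)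
      qed
      have z0: "a2 0 i = 0" if "1 \<le> i" "i < 2 * p" for i using h2(5) zero(1)[of i] that by (simp add: d)
      have fin: "?Q s' a' t'" if "t' \<le> t2 + 2 + 400100 * p + 100 \<and> (\<forall>i\<in>{1..<p}. a' 0 i \<le> 1) \<and>
          [(\<Sum>i\<in>{1..<p}. a' 0 i * a2 15 i) = s 1 * w mod p] (mod p)" for s' a' t'
        using that h2(3) h1(3) unscale_sum[OF w(2), of "{1..<p}" "a2 15" "a 0" "a' 0" "s 1"] ky by auto
      let ?s3 = "s2(22 := s 1 * w mod p)"
      have m: "0 < m" "m \<le> p" using h1(5,8) by (simp_all add: m_def)
      have bm: "16384 * m < B" using B(2) m by (simp add: d)
      have xw: "s 1 * w < B" using pB[of "s 1" w] x w by (simp add: d)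
      show ?case
      proof (cases "16384 * m < p")
        case True
        have "run B case2_code ?s3 a2 (Suc (Suc t2)) ?Q"
        proof (rule run_mono, rule run_case2, goal_cases)
          case (7 i) then show ?case using key[of i] by (simp add: e2)
        next
          case (10 i) then show ?case using z0[of i] by (simp add: e2)
        next
          case (11 k i) then show ?case using zero(2)[of k i] a2[of k] by (auto simp: e2 d)
        next
          case (12 s' a' t') then show ?case using fin[of t' a'] by (simp add: e2)
        qed (use prime m True p B ones mult in \<open>simp_all add: e2 d\<close>)
        then show ?thesis using True xw bm b by (simp add: e2 e2(2)[unfolded One_nat_def])
      next
        case False
        have "run B case1_code ?s3 a2 (Suc (Suc t2)) ?Q"
        proof (rule run_mono, rule run_case1, goal_cases)
          case (6 i) then show ?case using key[of i] by (simp add: e2)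
        next
          case (8 i) then show ?case using z0[of i] by (simp add: e2)
        next
          case (9 i) then show ?case using zero(2)[of 11 i] a2[of 11] by (simp add: e2 d)
        next
          case (10 s' a' t') then show ?case using fin[of t' a'] by (simp add: e2)
        qed (use prime m False p B ones in \<open>simp_all add: e2 d\<close>)
        then show ?thesis using False xw bm b by (simp add: e2 e2(2)[unfolded One_nat_def])
      qed
    qed (use p B in \<open>simp_all add: e1 d\<close>)
    then show ?case using b p v by (simp add: e1 v_def m_def w_def)
  qed (use p B in \<open>simp_all add: d\<close>)
  then show ?thesis using b by (simp add: main_code_def d)
qed

lemma cwf_main_code: "cwf main_code"
  by (simp add: main_code_def count_code_def scale_code_def case2_code_def case1_code_def flag_code_def
      pair_code_def join_code_def mode1_code_def mode2_code_def tail_code_def keep_code_def finish_code_def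
      off_code_def greedy_code_def base_code_def push_code_def fill_code_def grow_code_def read_code_def
      step_code_def searchA_def searchB_def searchC_def hit_test_def tmp_def narr_def)

text \<open>The word bound is \<open>r ^ 20\<close> with \<open>p < r\<close>. Two of the factors
  absorb a product of two residues, and the other eighteen give at least \<open>2 ^ 18\<close>,
  which exceeds the constants \<open>16384\<close> and \<open>40\<close> for small primes as
  well.\<close>

lemma word_size_large:
  assumes "1 < p" "w = 20 * floorlog 2 p"
  shows "p * p < (2::nat) ^ w" "16384 * p < (2::nat) ^ w" "2 * p + 1 < (2::nat) ^ w" "40 * p \<le> (2::nat) ^ w"
proof -
  define r :: nat where "r = 2 ^ floorlog 2 p"
  have r: "p < r" using floorlog_bounds[of p 2] assms(1) by (simp add: r_def)
  have r2: "2 \<le> r" using r assms(1) by linarith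
  have e: "(2::nat) ^ w = r ^ 20" by (simp add: r_def assms(2) power_mult[symmetric] mult.commute)
  have "(2::nat) ^ 18 * (r * r) \<le> r ^ 18 * (r * r)" using r2 by (intro mult_le_mono1 power_mono) auto
  also have "r ^ 18 * (r * r) = r ^ 20" by (simp add: power_numeral_reduce)
  finally have "262144 * (r * r) \<le> r ^ 20" by simp
  moreover have "p * p < r * r" using r by (simp add: mult_strict_mono)
  moreover have "r \<le> r * r" using r2 by simp
  ultimately show "p * p < (2::nat) ^ w" "16384 * p < (2::nat) ^ w" "2 * p + 1 < (2::nat) ^ w" "40 * p \<le> (2::nat) ^ w"
    unfolding e using r r2 by linarith+
qed

theorem theorem4:
  shows "\<exists>(P :: program) (k :: nat) (T :: nat \<Rightarrow> nat) (S :: nat \<Rightarrow> nat).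
    k > 0 \<and>
    (\<lambda>p. real (T p)) \<in> O(\<lambda>p. real p) \<and>
    (\<lambda>p. real (S p)) \<in> O(\<lambda>p. real p) \<and>
    (\<forall>(p :: nat) (d :: nat \<Rightarrow> nat) (\<tau> :: nat).
       prime p \<longrightarrow> (\<forall>j\<in>{1..p - 1}. d j \<in> {0<..<p}) \<longrightarrow> \<tau> \<in> {0..<p} \<longrightarrow>
       (\<exists>c J. runs_within (k * floorlog 2 p) P (input_config p d \<tau>) (T p) (S p) c \<and>
              outputs_subset p c J \<and>
              [(\<Sum>j\<in>J. d j) = \<tau>] (mod p)))"
proof -
  define P where "P = compile 0 main_code"
  define T where "T = (\<lambda>p. clen main_code * (400300 * p))"
  define S :: "nat \<Rightarrow> nat" where "S = (\<lambda>p. 40 * p)"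
  have T: "(\<lambda>p. real (T p)) \<in> O(\<lambda>p. real p)"
    by (rule bigoI[where c = "real (clen main_code) * 400300"]) (simp add: T_def)
  have S: "(\<lambda>p. real (S p)) \<in> O(\<lambda>p. real p)"
    by (rule bigoI[where c = 40]) (simp add: S_def)
  have main: "\<exists>c J. runs_within (20 * floorlog 2 p) P (input_config p d \<tau>) (T p) (S p) c \<and>
              outputs_subset p c J \<and> [(\<Sum>j\<in>J. d j) = \<tau>] (mod p)"
    if pr: "prime p" and dj: "\<forall>j\<in>{1..p - 1}. d j \<in> {0<..<p}" and \<tau>: "\<tau> \<in> {0..<p}" for p d \<tau>
  proof -
    define w where "w = 20 * floorlog 2 p"
    have p: "1 < p" using pr prime_gt_1_nat by simp
    note W = word_size_large[OF p w_def]
    define c0 where "c0 = input_config p d \<tau>"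
    define s where "s = reg c0"
    \<comment> \<open>The initial memory viewed as arrays: array \<open>0\<close> contains the
      input, and all others begin at address \<open>2 * p\<close> or later, hence are zero.\<close>
    define a where "a = (\<lambda>k i. mem c0 (2 * k * p + i))"
    have m0: "mem c0 j = (if j \<in> {1..p - 1} then d j else 0)" for j by (simp add: c0_def input_config_def)
    have s0: "s 0 = p" "s 1 = \<tau>" "\<And>x. s x < 2 ^ w"
      using \<tau> W by (auto simp: s_def c0_def input_config_def)
    have a0: "a 0 i = d i" if "i \<in> {1..<p}" for i using that by (auto simp: a_def m0)
    have az: "a k i = 0" if "0 < k" "i < 2 * p" for k i
    proof -
      have "2 * p \<le> 2 * k * p" using that by simp
      then have "\<not> 2 * k * p + i \<le> p - 1" using p by linarith
      then show ?thesis by (simp add: a_def m0)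
    qed
    have mt: "match p (2 ^ w) s a c0"
    proof -
      have "d j < 2 ^ w" if "j \<in> {1..p - 1}" for j
      proof -
        have "d j < p" using dj that by auto
        then show ?thesis using W(3) by linarith
      qed
      then have "mem c0 j < 2 ^ w" for j by (simp add: m0)
      then show ?thesis using s0 by (simp add: match_def s_def a_def)
    qed
    have "run (2 ^ w) main_code s a 0 (\<lambda>s' a' t'. t' \<le> 400200 * s 0 + 200 \<and> (\<forall>i\<in>{1..<s 0}. a' 0 i \<le> 1) \<and>
       [(\<Sum>i\<in>{1..<s 0}. a' 0 i * a 0 i) = s 1] (mod s 0))"
    proof (rule run_main_code, goal_cases)
      case (6 i)
      then have "i \<in> {1..p - 1}" "i \<in> {1..<p}" by (auto simp: s0)
      then show ?case using bspec[OF dj, of i] a0[of i] by (simp add: s0 Suc_le_eq)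
    next
      case (7 i) then show ?case using p by (auto simp: s0 a_def m0)
    next
      case (8 k i) then show ?case using az[of k i] by (auto simp: s0)
    qed (use pr \<tau> W in \<open>simp_all add: s0 s0(2)[unfolded One_nat_def]\<close>)
    then obtain n s' a' where big: "big (2 ^ w) main_code s a n s' a'" and n: "n \<le> 400200 * p + 200"
      and bits: "\<forall>i\<in>{1..<p}. a' 0 i \<le> 1" and sum: "[(\<Sum>i\<in>{1..<p}. a' 0 i * a 0 i) = \<tau>] (mod p)"
      by (auto simp: run_def s0 s0(2)[unfolded One_nat_def])
    have "code_at P (pc c0) (compile (pc c0) main_code)" by (simp add: code_at_def P_def c0_def input_config_def)
    moreover have "2 * narr * p \<le> 2 ^ w" "2 * narr * p \<le> S p" using W by (simp_all add: narr_def S_def)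
    ultimately obtain t c1 where c1: "t \<le> clen main_code * n" "reach w P (S p) t c0 c1"
        "pc c1 = pc c0 + clen main_code" "match p (2 ^ w) s' a' c1"
      using compile_correct[OF big cwf_main_code mt] by blast
    \<comment> \<open>The additive constant is absorbed because \<open>p\<close> is at least
      2.\<close>
    have "n \<le> 400300 * p" using n p by linarith
    then have "clen main_code * n \<le> T p" unfolding T_def by (rule mult_le_mono2)
    then have "t \<le> T p" using c1(1) by linarith
    moreover have "halted P c1" using c1(3) by (simp add: halted_def P_def)
    ultimately have rw: "runs_within w P c0 (T p) (S p) c1"
      using reach_funpow[OF c1(2)] unfolding runs_within_def by blast
    define J where "J = {j \<in> {1..<p}. a' 0 j = 1}"
    have mem: "mem c1 j = a' 0 j" if "j < 2 * p" for j
    proof -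
      have "0 < narr" by (simp add: narr_def)
      then have "mem c1 (2 * 0 * p + j) = a' 0 j" using c1(4) that unfolding match_def by blast
      then show ?thesis by simp
    qed
    have bit: "a' 0 j = (if j \<in> J then 1 else 0)" if "j \<in> {1..<p}" for j
    proof -
      have "a' 0 j \<le> 1" using bits that by blast
      then show ?thesis using that by (auto simp: J_def)
    qed
    have "outputs_subset p c1 J"
      unfolding outputs_subset_def
    proof (intro conjI ballI)
      show "J \<subseteq> {1..p - 1}" by (auto simp: J_def)
      show "mem c1 j = (if j \<in> J then 1 else 0)" if "j \<in> {1..p - 1}" for j
        using that mem[of j] bit[of j] by auto
    qed
    moreover have "[(\<Sum>j\<in>J. d j) = \<tau>] (mod p)"
    proof -
      have "(\<Sum>i\<in>{1..<p}. a' 0 i * a 0 i) = (\<Sum>i\<in>J. a 0 i)"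
      proof (rule sum_indicator_mult)
        show "J \<subseteq> {1..<p}" by (auto simp: J_def)
        show "a' 0 i = 0" if "i \<in> {1..<p}" "i \<notin> J" for i using bit[OF that(1)] that(2) by simp
        show "a' 0 i = 1" if "i \<in> J" for i using that by (simp add: J_def)
      qed simp
      also have "\<dots> = (\<Sum>i\<in>J. d i)" using a0 by (intro sum.cong) (auto simp: J_def)
      finally show ?thesis using sum by simp
    qed
    ultimately show ?thesis using rw unfolding w_def c0_def by blast
  qed
  show ?thesis
    by (rule exI[of _ P], rule exI[of _ 20], rule exI[of _ T], rule exI[of _ S]) (use T S main in auto)
qed

end
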